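(* Let $2\le p\le\infty$. Let $\mathcal{H}$ be a Hilbert space with norm $\mathcal{N}$, and let $C\subset\mathbb{R}^n$ be a regular cone. Let $\mathbf{f}:T^C\to\mathcal{H}$ be analytic on $T^C=\mathbb{R}^n+iC$. Assume that there are a nonnegative integer $R$ and an integer $k>1$ such that for every compact subcone $C'\subset C$ and every $r>0$ there is a constant $M(C',r)$ (depending on $C'$ and $r$, while $R$ and $k$ depend on neither) with $$\mathcal{N}(\mathbf{f}(x+iy))\le M(C',r)\,(1+|x|)^{R}\,|y|^{-k},\qquad x\in\mathbb{R}^n,\ y\in C'\setminus (C'\cap N(\overline{0},r)).$$ Assume that the boundary value of $\mathbf{f}$ in $\mathcal{S}'(\mathbb{R}^n,\mathcal{H})$ is a function $\mathbf{h}\in L^p(\mathbb{R}^n,\mathcal{H})$, i.e. $$\lim_{y\to\overline{0},\,y\in C}\mathcal{N}\Big(\int_{\mathbb{R}^n}\mathbf{f}(x+iy)\phi(x)\,dx-\int_{\mathbb{R}^n}\mathbf{h}(x)\phi(x)\,dx\Big)=0,\qquad \phi\in\mathcal{S}(\mathbb{R}^n).$$ Then $\mathbf{f}\in H^p(T^C,\mathcal{H})$.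
   Context: A set $C\subset\mathbb{R}^n$ is a cone (with vertex $\overline{0}=(0,\dots,0)$) if $y\in C$ implies $\lambda y\in C$ for all $\lambda>0$. A regular cone is an open convex cone which does not contain any entire straight line. The projection $pr(C)$ of a cone is its intersection with the unit sphere $|y|=1$. A cone $C'\subset C$ is a compact subcone of $C$ if $pr(\overline{C'})\subset pr(C)$. $N(\overline{0},r)$ is the closed ball of radius $r$ centered at $\overline{0}$. "$y\to\overline{0}$, $y\in C$" means $y\to\overline{0}$ with $y\in C'$, for every compact subcone $C'$ of $C$. $L^p(\mathbb{R}^n,\mathcal{H})$, $1\le p<\infty$, is the space of strongly measurable functions $\mathbf{f}:\mathbb{R}^n\to\mathcal{H}$ with $\int_{\mathbb{R}^n}(\mathcal{N}(\mathbf{f}(t)))^p\,dt<\infty$; for $p=\infty$ one requires $\mathcal{N}(\mathbf{f}(\cdot))$ to be essentially bounded. $\mathcal{S}(\mathbb{R}^n)$ is the Schwartz space of scalar rapidly decreasing functions and $\mathcal{S}'(\mathbb{R}^n,\mathcal{H})$ is the space of $\mathcal{H}$-valued tempered distributions (continuous linear maps $\mathcal{S}(\mathbb{R}^n)\to\mathcal{H}$); a function $\mathbf{f}$ acts by $\langle\mathbf{f},\phi\rangle=\int\mathbf{f}(t)\phi(t)\,dt$ (Bochner integral). The Hardy space $H^p(T^C,\mathcal{H})$, $1\le p<\infty$, consists of the analytic functions $\mathbf{f}:T^C\to\mathcal{H}$ for which there is a constant $A$ independent of $y\in C$ with $\int_{\mathbb{R}^n}(\mathcal{N}(\mathbf{f}(x+iy)))^p\,dx\le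 A$ for all $y\in C$; $H^\infty(T^C,\mathcal{H})$ consists of the analytic $\mathbf{f}$ with $\mathcal{N}(\mathbf{f}(z))$ bounded on $T^C$. *)

theory Defs
  imports "HOL-Analysis.Analysis"
begin

text \<open>
  The inner product is linear in its first argument. The real vector space structure and the norm
  are the inherited ones and are tied to the complex structure by the axioms; completeness comes
  from \<^class>\<open>banach\<close>. No separability is assumed.
\<close>

class complex_hilbert = banach +
  fixes scaleC :: "complex \<Rightarrow> 'a \<Rightarrow> 'a"  (infixr "*\<^sub>C" 75)
    and cinner :: "'a \<Rightarrow> 'a \<Rightarrow> complex"
  assumes scaleC_add_right: "c *\<^sub>C (x + y) = c *\<^sub>C x + c *\<^sub>C y"
    and scaleC_add_left: "(c + d) *\<^sub>C x = c *\<^sub>C x + d *\<^sub>C x"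
    and scaleC_scaleC: "c *\<^sub>C (d *\<^sub>C x) = (c * d) *\<^sub>C x"
    and scaleC_of_real: "complex_of_real r *\<^sub>C x = r *\<^sub>R x"
    and cinner_commute: "cinner x y = cnj (cinner y x)"
    and cinner_add_left: "cinner (x + y) z = cinner x z + cinner y z"
    and cinner_scaleC_left: "cinner (c *\<^sub>C x) y = c * cinner x y"
    and cinner_nonneg: "0 \<le> Re (cinner x x)"
    and cinner_eq_zero_iff: "cinner x x = 0 \<longleftrightarrow> x = 0"
    and norm_eq_sqrt_cinner: "norm x = sqrt (Re (cinner x x))"

instantiation complex :: complex_hilbert
begin

definition "scaleC_complex (c :: complex) (x :: complex) = c * x"
definition "cinner_complex (x :: complex) (y :: complex) = x * cnj y"

instance
  by standard
    (auto simp: scaleC_complex_def cinner_complex_def algebra_simps scaleR_conv_of_real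
      cmod_def power2_eq_square)

end

text \<open>
  The library's \<^const>\<open>cone\<close> demands invariance under all factors \<open>c \<ge> 0\<close>, so a nonempty cone would
  contain the vertex; here only positive factors are allowed, and a regular cone omits the vertex.
\<close>

definition positive_cone :: "'a::real_vector set \<Rightarrow> bool" where
  "positive_cone C \<longleftrightarrow> (\<forall>y\<in>C. \<forall>c>0. c *\<^sub>R y \<in> C)"

definition regular_cone :: "'a::real_normed_vector set \<Rightarrow> bool" where
  "regular_cone C \<longleftrightarrow> open C \<and> convex C \<and> positive_cone C \<and>
     \<not> (\<exists>a d. d \<noteq> 0 \<and> (\<forall>t::real. a + t *\<^sub>R d \<in> C))"

definition cone_projection :: "'a::real_normed_vector set \<Rightarrow> 'a set" where
  "cone_projection C = C \<inter> sphere 0 1"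

definition compact_subcone :: "'a::real_normed_vector set \<Rightarrow> 'a set \<Rightarrow> bool" where
  "compact_subcone C' C \<longleftrightarrow>
     positive_cone C' \<and> C' \<subseteq> C \<and> cone_projection (closure C') \<subseteq> cone_projection C"

definition cvec :: "real ^ 'n \<Rightarrow> real ^ 'n \<Rightarrow> complex ^ 'n" where
  "cvec x y = (\<chi> i. Complex (x $ i) (y $ i))"

definition tube :: "(real ^ 'n) set \<Rightarrow> (complex ^ 'n) set" where
  "tube C = {cvec x y | x y. y \<in> C}"

text \<open>
  Analyticity is complex Frechet differentiability: the real derivative exists at every point and is
  complex linear. Functions on a tube are total functions whose values off the tube are irrelevant
  (tubes over open cones are open).
\<close>

definition vector_analytic_on ::
    "(complex ^ 'n \<Rightarrow> 'h::complex_hilbert) \<Rightarrow> (complex ^ 'n) set \<Rightarrow> bool" where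
  "vector_analytic_on f S \<longleftrightarrow>
     (\<forall>z\<in>S. \<exists>D. (f has_derivative D) (at z) \<and> (\<forall>c v. D (c *s v) = c *\<^sub>C D v))"

text \<open>
  The library's Bochner integral is confined to second countable spaces. The following definitions
  repeat it for arbitrary target spaces, with strong measurability (being almost everywhere a limit
  of simple functions) in place of Borel measurability.
\<close>

definition strongly_measurable :: "'a measure \<Rightarrow> ('a \<Rightarrow> 'b::real_normed_vector) \<Rightarrow> bool" where
  "strongly_measurable M f \<longleftrightarrow>
     (\<exists>s. (\<forall>i. simple_function M (s i)) \<and> (AE x in M. (\<lambda>i. s i x) \<longlonglongrightarrow> f x))"

definition has_strong_bochner_integral ::
    "'a measure \<Rightarrow> ('a \<Rightarrow> 'b::real_normed_vector) \<Rightarrow> 'b \<Rightarrow> bool" where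
  "has_strong_bochner_integral M f I \<longleftrightarrow> strongly_measurable M f \<and>
     (\<exists>s. (\<forall>i. Bochner_Integration.simple_bochner_integrable M (s i)) \<and>
       (\<lambda>i. \<integral>\<^sup>+x. ennreal (norm (f x - s i x)) \<partial>M) \<longlonglongrightarrow> 0 \<and>
       (\<lambda>i. Bochner_Integration.simple_bochner_integral M (s i)) \<longlonglongrightarrow> I)"

definition strong_bochner_integral ::
    "'a measure \<Rightarrow> ('a \<Rightarrow> 'b::real_normed_vector) \<Rightarrow> 'b" where
  "strong_bochner_integral M f =
     (if \<exists>I. has_strong_bochner_integral M f I
      then THE I. has_strong_bochner_integral M f I else 0)"

definition vector_Lp :: "ereal \<Rightarrow> (real ^ 'n \<Rightarrow> 'h::complex_hilbert) set" where
  "vector_Lp p = {h. strongly_measurable lebesgue h \<and>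
     (if p = \<infinity> then \<exists>B::real. AE t in lebesgue. norm (h t) \<le> B
      else (\<integral>\<^sup>+t. ennreal (norm (h t) powr real_of_ereal p) \<partial>lebesgue) < \<infinity>)}"

definition partial_derivative ::
    "'n \<Rightarrow> (real ^ 'n \<Rightarrow> complex) \<Rightarrow> real ^ 'n \<Rightarrow> complex" where
  "partial_derivative i \<phi> x = frechet_derivative \<phi> (at x) (axis i 1)"

text \<open>
  A list of coordinates encodes an iterated partial derivative, so mixed derivatives are ranged over
  in every order. Requiring all of them to be differentiable is smoothness.
\<close>

definition schwartz_space :: "(real ^ 'n \<Rightarrow> complex) set" where
  "schwartz_space = {\<phi>. \<forall>is :: 'n list.
     (\<forall>x. foldr partial_derivative is \<phi> differentiable (at x)) \<and>
     (\<forall>m::nat. \<exists>B::real. \<forall>x. norm x ^ m * norm (foldr partial_derivative is \<phi> x) \<le> B)}"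

text \<open>The integral of a non-integrable function is \<open>0\<close>; under polynomial growth this does not occur.\<close>

definition distribution_pairing ::
    "(real ^ 'n \<Rightarrow> 'h::complex_hilbert) \<Rightarrow> (real ^ 'n \<Rightarrow> complex) \<Rightarrow> 'h" where
  "distribution_pairing g \<phi> = strong_bochner_integral lebesgue (\<lambda>x. \<phi> x *\<^sub>C g x)"

definition has_boundary_value ::
    "(complex ^ 'n \<Rightarrow> 'h::complex_hilbert) \<Rightarrow> (real ^ 'n) set \<Rightarrow> (real ^ 'n \<Rightarrow> 'h) \<Rightarrow> bool" where
  "has_boundary_value f C h \<longleftrightarrow>
     (\<forall>\<phi>\<in>schwartz_space. \<forall>C'. compact_subcone C' C \<longrightarrow>
       ((\<lambda>y. norm (distribution_pairing (\<lambda>x. f (cvec x y)) \<phi> - distribution_pairing h \<phi>))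
         \<longlongrightarrow> 0) (at 0 within C'))"

definition hardy_space ::
    "ereal \<Rightarrow> (real ^ 'n) set \<Rightarrow> (complex ^ 'n \<Rightarrow> 'h::complex_hilbert) set" where
  "hardy_space p C = {f. vector_analytic_on f (tube C) \<and>
     (if p = \<infinity> then \<exists>A::real. \<forall>z\<in>tube C. norm (f z) \<le> A
      else \<exists>A::real. \<forall>y\<in>C.
        (\<integral>\<^sup>+x. ennreal (norm (f (cvec x y)) powr real_of_ereal p) \<partial>lebesgue) \<le> ennreal A)}"

end

theory Submission
  imports Defs "HOL-Complex_Analysis.Cauchy_Integral_Formula" "HOL-Real_Asymp.Real_Asymp"
begin

text \<open>
  Fix \<open>d \<in> C\<close> and a vector \<open>e\<close>, and look at \<open>f\<close> only on the complex lines \<open>x + w d\<close> with \<open>Im w > 0\<close>.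
  For a Schwartz function \<open>\<phi>\<close> the function \<open>F(w) = \<integral> \<phi>(x) \<langle>f(x + w d), e\<rangle> dx\<close> is holomorphic on the upper
  half-plane. By translation \<open>F(s + i t)\<close> pairs \<open>f(\<cdot> + i t d)\<close> with \<open>\<phi>(\<cdot> - s d)\<close>, so it tends to
  \<open>F\<^sub>0(s) = \<integral> \<phi>(x - s d) \<langle>h(x), e\<rangle> dx\<close> as \<open>t\<close> decreases to 0. If \<open>F\<close> grows at most polynomially on the
  half-plane, a Phragmen-Lindelof argument bounds \<open>|F(i)|\<close> by the mean of \<open>|F\<^sub>0|\<close> against the Poisson
  kernel of the point \<open>i\<close> (\<open>halfplane_boundary_mean_bound\<close>).

  Polynomial growth is given at heights \<open>t \<ge> \<tau>\<close>, but near the real axis the hypotheses only provide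
  a limit for each single test function. The passage to a uniform bound is a uniform
  boundedness principle for the translates of \<open>\<phi>\<close> (\<open>gliding_hump\<close>), applied to rapidly convergent
  series of translates, which are again Schwartz functions (\<open>schwartz_translate_series\<close>).

  Taking for \<open>\<phi>\<close> a Gaussian of mass one and width \<open>\<delta>\<close> centred at \<open>a\<close>, the value \<open>\<langle>f(\<cdot> + i d), e\<rangle>\<close> smeared
  around \<open>a\<close> is for \<open>\<parallel>e\<parallel> \<le> 1\<close> at most the mean of \<open>\<parallel>h\<parallel>\<close> under a probability measure that moves with \<open>a\<close>
  by translation (\<open>smeared_value_le\<close>). For finite \<open>p\<close>, Jensen's inequality, Tonelli's theorem in \<open>a\<close> and
  Fatou's lemma for \<open>\<delta> \<rightarrow> 0\<close> give \<open>\<integral> \<parallel>f(x + i d)\<parallel>\<^sup>p dx \<le> \<integral> \<parallel>h(x)\<parallel>\<^sup>p dx\<close>; for \<open>p = \<infinity>\<close> the essential bound of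
  \<open>h\<close> passes directly to \<open>f\<close>. The right-hand sides do not depend on \<open>d\<close>.
\<close>

section \<open>Inner products\<close>

lemma cinner_add_right: "cinner x (y + z) = cinner x y + cinner x (z :: 'h::complex_hilbert)"
  by (metis cinner_add_left cinner_commute complex_cnj_add)

lemma cinner_scaleR_left: "cinner (r *\<^sub>R x) y = r *\<^sub>R cinner x (y :: 'h::complex_hilbert)"
  by (metis cinner_scaleC_left scaleC_of_real scaleR_conv_of_real)

lemma cinner_scaleC_right: "cinner x (c *\<^sub>C y) = cnj c * cinner x (y :: 'h::complex_hilbert)"
  by (metis cinner_commute cinner_scaleC_left complex_cnj_mult)

lemma cinner_zero_left [simp]: "cinner 0 (y :: 'h::complex_hilbert) = 0"
  using cinner_scaleR_left[of 0 0 y] by simp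

lemma cinner_self: "cinner x x = complex_of_real ((norm (x :: 'h::complex_hilbert))\<^sup>2)"
proof -
  have "Im (cinner x x) = 0"
    using cinner_commute[of x x] by (metis Reals_cnj_iff complex_is_Real_iff)
  moreover have "Re (cinner x x) = (norm x)\<^sup>2"
    using cinner_nonneg[of x] by (simp add: norm_eq_sqrt_cinner)
  ultimately show ?thesis by (simp add: complex_eq_iff)
qed

lemma norm_scaleC: "norm (c *\<^sub>C (x :: 'h::complex_hilbert)) = cmod c * norm x"
proof -
  have "complex_of_real ((norm (c *\<^sub>C x))\<^sup>2) = complex_of_real ((cmod c * norm x)\<^sup>2)"
    by (simp only: cinner_self[symmetric] cinner_scaleC_left cinner_scaleC_right)
       (simp add: cinner_self complex_norm_square[of c] power_mult_distrib del: of_real_power)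
  then have "(norm (c *\<^sub>C x))\<^sup>2 = (cmod c * norm x)\<^sup>2"
    by (simp only: of_real_eq_iff)
  then show ?thesis by (simp add: power2_eq_iff_nonneg)
qed

text \<open>Subtracting from \<open>x\<close> its projection on \<open>y\<close> leaves a vector of nonnegative squared length.\<close>

lemma norm_cinner_le: "cmod (cinner x y) \<le> norm x * norm (y :: 'h::complex_hilbert)"
proof (cases "y = 0")
  case True
  then have "cinner x y = 0" using cinner_commute[of x y] by simp
  with True show ?thesis by simp
next
  case False
  define a where "a = cinner x y"
  define N where "N = (norm y)\<^sup>2"
  have N: "N > 0" using False by (simp add: N_def)
  define z where "z = x + (- a / of_real N) *\<^sub>C y"
  have "cinner z z = of_real ((norm x)\<^sup>2) - of_real ((cmod a)\<^sup>2) / of_real N"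
  proof -
    have yx: "cinner y x = cnj a" using cinner_commute[of y x] by (simp add: a_def)
    have "a * cnj a = of_real ((cmod a)\<^sup>2)" by (simp only: complex_norm_square)
    then show ?thesis
      using N by (simp add: z_def cinner_add_left cinner_add_right cinner_scaleC_left
        cinner_scaleC_right cinner_self[of x] cinner_self[of y] yx a_def[symmetric]
        N_def[symmetric] field_simps del: of_real_power)
  qed
  then have "of_real ((norm z)\<^sup>2) = complex_of_real ((norm x)\<^sup>2 - (cmod a)\<^sup>2 / N)"
    by (simp add: cinner_self)
  then have "(norm z)\<^sup>2 = (norm x)\<^sup>2 - (cmod a)\<^sup>2 / N" by (simp only: of_real_eq_iff)
  moreover have "0 \<le> (norm z)\<^sup>2" by simp
  ultimately have "(cmod a)\<^sup>2 / N \<le> (norm x)\<^sup>2" by linarith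
  then have "(cmod a)\<^sup>2 \<le> (norm x)\<^sup>2 * N" using N by (simp add: field_simps)
  then have "(cmod a)\<^sup>2 \<le> (norm x * norm y)\<^sup>2" by (simp add: N_def power_mult_distrib)
  then show ?thesis unfolding a_def by (rule power2_le_imp_le) simp
qed

lemma bounded_linear_cinner_left: "bounded_linear (\<lambda>x. cinner x (y :: 'h::complex_hilbert))"
  by (rule bounded_linear_intro[where K = "norm y"])
     (auto simp: cinner_add_left cinner_scaleR_left norm_cinner_le)

lemma bounded_bilinear_scaleC: "bounded_bilinear (\<lambda>c (x :: 'h::complex_hilbert). c *\<^sub>C x)"
proof (rule bounded_bilinear.intro)
  fix r c and x :: 'h
  show "(r *\<^sub>R c) *\<^sub>C x = r *\<^sub>R (c *\<^sub>C x)"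
    by (metis scaleC_of_real scaleC_scaleC scaleR_conv_of_real)
  show "c *\<^sub>C (r *\<^sub>R x) = r *\<^sub>R (c *\<^sub>C x)"
    by (metis scaleC_of_real scaleC_scaleC mult.commute)
  show "\<exists>K. \<forall>a (b :: 'h). norm (a *\<^sub>C b) \<le> norm a * norm b * K"
    by (rule exI[of _ 1]) (simp add: norm_scaleC)
qed (simp_all add: scaleC_add_left scaleC_add_right)

section \<open>Strong Bochner integrals\<close>

text \<open>
  Lebesgue measure is complete, so an almost everywhere limit of simple functions is measurable as
  soon as its target is Euclidean.
\<close>

lemma strongly_measurable_compose_borel:
  fixes g :: "'a::euclidean_space \<Rightarrow> 'b::real_normed_vector" and \<psi> :: "'b \<Rightarrow> 'c::euclidean_space"
  assumes "strongly_measurable lebesgue g" "continuous_on UNIV \<psi>"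
  shows "(\<lambda>x. \<psi> (g x)) \<in> borel_measurable lebesgue"
proof -
  obtain s where s: "\<And>i. simple_function lebesgue (s i)"
    and lim: "AE x in lebesgue. (\<lambda>i. s i x) \<longlonglongrightarrow> g x"
    using assms(1) unfolding strongly_measurable_def by blast
  have "(\<lambda>x. \<psi> (s i x)) \<in> borel_measurable lebesgue" for i
    by (rule borel_measurable_simple_function) (rule simple_function_compose1[OF s])
  then have "(\<lambda>x. lim (\<lambda>i. \<psi> (s i x))) \<in> borel_measurable lebesgue"
    by (rule borel_measurable_lim_metric)
  moreover have "AE x in lebesgue. lim (\<lambda>i. \<psi> (s i x)) = \<psi> (g x)"
    using lim
  proof eventually_elim
    case (elim x)
    then have "(\<lambda>i. \<psi> (s i x)) \<longlonglongrightarrow> \<psi> (g x)"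
      using assms(2) continuous_on_tendsto_compose by fastforce
    then show ?case by (rule limI)
  qed
  ultimately show ?thesis by (rule borel_measurable_AE)
qed

lemma strongly_measurable_diff_simple:
  assumes "strongly_measurable M g" "simple_function M t"
  shows "strongly_measurable M (\<lambda>x. g x - t x)"
proof -
  obtain s where s: "\<And>i. simple_function M (s i)" "AE x in M. (\<lambda>i. s i x) \<longlonglongrightarrow> g x"
    using assms(1) unfolding strongly_measurable_def by blast
  show ?thesis unfolding strongly_measurable_def
  proof (intro exI conjI allI)
    show "simple_function M (\<lambda>x. s i x - t x)" for i
      using s(1) assms(2) by (rule simple_function_compose2)
    show "AE x in M. (\<lambda>i. s i x - t x) \<longlonglongrightarrow> g x - t x"
      using s(2) by eventually_elim (auto intro: tendsto_intros)
  qed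
qed

text \<open>
  Composing \<open>g\<close> with simple approximations of the identity of its domain yields simple functions,
  whatever the target space is.
\<close>

lemma continuous_imp_strongly_measurable:
  fixes g :: "'a::euclidean_space \<Rightarrow> 'b::real_normed_vector"
  assumes "continuous_on UNIV g"
  shows "strongly_measurable lebesgue g"
proof -
  obtain F :: "nat \<Rightarrow> 'a \<Rightarrow> 'a" where F: "\<And>i. simple_function borel (F i)"
      "\<And>x. (\<lambda>i. F i x) \<longlonglongrightarrow> x"
    using borel_measurable_implies_sequence_metric[of "\<lambda>x. x" borel 0] by auto
  have "simple_function lebesgue (F i)" for i
    using F(1)[of i] unfolding simple_function_def by (auto simp: space_borel)
  then show ?thesis unfolding strongly_measurable_def
  proof (intro exI conjI allI)
    show "simple_function lebesgue (\<lambda>x. g (F i x))" if "\<And>i. simple_function lebesgue (F i)" for i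
      using that by (rule simple_function_compose1)
    show "AE x in lebesgue. (\<lambda>i. g (F i x)) \<longlonglongrightarrow> g x"
      using F(2) assms by (intro AE_I2) (auto intro: continuous_on_tendsto_compose)
  qed
qed

lemma strongly_measurable_scaleC:
  fixes g :: "'a::euclidean_space \<Rightarrow> 'h::complex_hilbert"
  assumes "continuous_on UNIV \<phi>" "strongly_measurable lebesgue g"
  shows "strongly_measurable lebesgue (\<lambda>x. \<phi> x *\<^sub>C g x)"
proof -
  obtain s where s: "\<And>i. simple_function lebesgue (s i)"
     "AE x in lebesgue. (\<lambda>i. s i x) \<longlonglongrightarrow> g x"
    using assms(2) unfolding strongly_measurable_def by blast
  obtain c where c: "\<And>i. simple_function lebesgue (c i)"
     "AE x in lebesgue. (\<lambda>i. c i x) \<longlonglongrightarrow> \<phi> x"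
    using continuous_imp_strongly_measurable[OF assms(1)] unfolding strongly_measurable_def by blast
  show ?thesis unfolding strongly_measurable_def
  proof (intro exI conjI allI)
    show "simple_function lebesgue (\<lambda>x. c i x *\<^sub>C s i x)" for i
      using c(1) s(1) by (rule simple_function_compose2)
    show "AE x in lebesgue. (\<lambda>i. c i x *\<^sub>C s i x) \<longlonglongrightarrow> \<phi> x *\<^sub>C g x"
      using s(2) c(2) by eventually_elim (rule bounded_bilinear.tendsto[OF bounded_bilinear_scaleC])
  qed
qed

text \<open>
  Without second countability, the comparison of two simple integrals goes through the norm of the
  difference, which is a simple real function.
\<close>

lemma norm_simple_bochner_integral_diff_le:
  fixes g :: "'a::euclidean_space \<Rightarrow> 'b::real_normed_vector"
  assumes g: "strongly_measurable lebesgue g"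
    and s: "Bochner_Integration.simple_bochner_integrable lebesgue s"
    and t: "Bochner_Integration.simple_bochner_integrable lebesgue t"
  shows "ennreal (norm (Bochner_Integration.simple_bochner_integral lebesgue s
      - Bochner_Integration.simple_bochner_integral lebesgue t))
    \<le> (\<integral>\<^sup>+x. ennreal (norm (g x - s x)) \<partial>lebesgue) + (\<integral>\<^sup>+x. ennreal (norm (g x - t x)) \<partial>lebesgue)"
proof -
  note [simp] = Bochner_Integration.simple_bochner_integrable.simps
  have sf: "simple_function lebesgue s" "simple_function lebesgue t" using s t by auto
  have m: "(\<lambda>x. norm (g x - s x)) \<in> borel_measurable lebesgue"
          "(\<lambda>x. norm (g x - t x)) \<in> borel_measurable lebesgue"
    using strongly_measurable_diff_simple[OF g] sf
    by (auto intro!: strongly_measurable_compose_borel[where \<psi> = norm] continuous_intros)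
  have "ennreal (norm (Bochner_Integration.simple_bochner_integral lebesgue s
      - Bochner_Integration.simple_bochner_integral lebesgue t))
    = norm (Bochner_Integration.simple_bochner_integral lebesgue (\<lambda>x. s x - t x))"
    using s t by (subst Bochner_Integration.simple_bochner_integral_diff) auto
  also have "\<dots> \<le> Bochner_Integration.simple_bochner_integral lebesgue (\<lambda>x. norm (s x - t x))"
    using Bochner_Integration.simple_bochner_integrable_compose2[of "(-)" lebesgue s t] s t
    by (auto intro!: Bochner_Integration.simple_bochner_integral_norm_bound ennreal_leI simp del: Bochner_Integration.simple_bochner_integrable.simps)
  also have "\<dots> = (\<integral>\<^sup>+x. ennreal (norm (s x - t x)) \<partial>lebesgue)"
    using Bochner_Integration.simple_bochner_integrable_compose2[of "\<lambda>x y. norm (x - y)" lebesgue s t] s t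
    by (auto intro!: Bochner_Integration.simple_bochner_integral_eq_nn_integral simp del: Bochner_Integration.simple_bochner_integrable.simps)
  also have "\<dots> \<le> (\<integral>\<^sup>+x. ennreal (norm (g x - s x)) + ennreal (norm (g x - t x)) \<partial>lebesgue)"
  proof (rule nn_integral_mono)
    fix x
    have "norm (s x - t x) \<le> norm (g x - s x) + norm (g x - t x)"
      using norm_triangle_ineq4[of "g x - t x" "g x - s x"] by (simp add: algebra_simps)
    then show "ennreal (norm (s x - t x)) \<le> ennreal (norm (g x - s x)) + ennreal (norm (g x - t x))"
      by (simp add: ennreal_leI flip: ennreal_plus)
  qed
  also have "\<dots> = (\<integral>\<^sup>+x. ennreal (norm (g x - s x)) \<partial>lebesgue)
      + (\<integral>\<^sup>+x. ennreal (norm (g x - t x)) \<partial>lebesgue)"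
    using m by (intro nn_integral_add) auto
  finally show ?thesis .
qed

text \<open>
  Cutting an approximating simple function off where it exceeds twice the norm of the limit makes
  the approximation dominated.
\<close>

lemma has_strong_bochner_integral_exists:
  fixes g :: "'a::euclidean_space \<Rightarrow> 'b::banach"
  assumes g: "strongly_measurable lebesgue g" and fin: "(\<integral>\<^sup>+x. ennreal (norm (g x)) \<partial>lebesgue) < \<infinity>"
  shows "\<exists>I. has_strong_bochner_integral lebesgue g I"
proof -
  obtain s where s: "\<And>i. simple_function lebesgue (s i)"
    and lim: "AE x in lebesgue. (\<lambda>i. s i x) \<longlonglongrightarrow> g x"
    using g unfolding strongly_measurable_def by blast
  have ng [measurable]: "(\<lambda>x. norm (g x)) \<in> borel_measurable lebesgue"
    by (intro strongly_measurable_compose_borel[OF g] continuous_intros)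
  have [measurable]: "(\<lambda>x. norm (s i x)) \<in> borel_measurable lebesgue" for i
    by (rule borel_measurable_simple_function) (rule simple_function_compose1[OF s])
  \<comment> \<open>where \<open>g x = 0\<close> the cut-off forces the approximation to vanish as well\<close>
  define t where "t i x = (if x \<in> {x. norm (s i x) \<le> 2 * norm (g x)} then s i x else 0)" for i x
  have t: "simple_function lebesgue (t i)" for i
    unfolding t_def
  proof (rule simple_function_If_set[OF s])
    have "{x \<in> space lebesgue. norm (s i x) \<le> 2 * norm (g x)} \<in> sets lebesgue" by measurable
    then show "{x. norm (s i x) \<le> 2 * norm (g x)} \<inter> space lebesgue \<in> sets lebesgue" by simp
  qed simp
  have tle: "norm (t i x) \<le> 2 * norm (g x)" for i x by (simp add: t_def)
  have tint: "Bochner_Integration.simple_bochner_integrable lebesgue (t i)" for i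
  proof (rule Bochner_Integration.simple_bochner_integrableI_bounded[OF t])
    have "(\<integral>\<^sup>+x. ennreal (norm (t i x)) \<partial>lebesgue) \<le> (\<integral>\<^sup>+x. ennreal 2 * ennreal (norm (g x)) \<partial>lebesgue)"
      by (intro nn_integral_mono) (metis ennreal_leI ennreal_mult'' norm_ge_zero tle)
    also have "\<dots> = ennreal 2 * (\<integral>\<^sup>+x. ennreal (norm (g x)) \<partial>lebesgue)"
      by (rule nn_integral_cmult) simp
    also have "\<dots> < \<infinity>" using fin by (simp add: ennreal_mult_less_top)
    finally show "(\<integral>\<^sup>+x. ennreal (norm (t i x)) \<partial>lebesgue) < \<infinity>" .
  qed
  have conv: "(\<lambda>i. \<integral>\<^sup>+x. ennreal (norm (g x - t i x)) \<partial>lebesgue) \<longlonglongrightarrow> (\<integral>\<^sup>+x. 0 \<partial>(lebesgue :: 'a measure))"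
  proof (rule nn_integral_dominated_convergence[where w = "\<lambda>x. ennreal 3 * ennreal (norm (g x))"])
    show "(\<lambda>x. ennreal (norm (g x - t i x))) \<in> borel_measurable lebesgue" for i
      using strongly_measurable_compose_borel[OF strongly_measurable_diff_simple[OF g t], where \<psi> = norm]
      by (auto intro: continuous_intros)
    show "AE x in lebesgue. ennreal (norm (g x - t i x)) \<le> ennreal 3 * ennreal (norm (g x))" for i
    proof (rule AE_I2)
      fix x
      have "norm (g x - t i x) \<le> 3 * norm (g x)"
        using norm_triangle_ineq4[of "g x" "t i x"] tle[of i x] by simp
      then show "ennreal (norm (g x - t i x)) \<le> ennreal 3 * ennreal (norm (g x))"
        by (metis ennreal_leI ennreal_mult'' norm_ge_zero)
    qed
    show "(\<integral>\<^sup>+x. ennreal 3 * ennreal (norm (g x)) \<partial>lebesgue) < \<infinity>"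
      using fin by (subst nn_integral_cmult) (auto simp: ennreal_mult_less_top)
    show "AE x in lebesgue. (\<lambda>i. ennreal (norm (g x - t i x))) \<longlonglongrightarrow> 0"
      using lim
    proof eventually_elim
      case (elim x)
      have "(\<lambda>i. t i x) \<longlonglongrightarrow> g x"
      proof (cases "g x = 0")
        case True
        then have "t i x = 0" for i using tle[of i x] by simp
        then show ?thesis using True by simp
      next
        case False
        have "(\<lambda>i. norm (s i x)) \<longlonglongrightarrow> norm (g x)" using elim by (rule tendsto_norm)
        then have "eventually (\<lambda>i. norm (s i x) < 2 * norm (g x)) sequentially"
          using False by (intro order_tendstoD(2)) auto
        then have "eventually (\<lambda>i. s i x = t i x) sequentially"
          by eventually_elim (simp add: t_def)
        then show ?thesis using elim by (rule Lim_transform_eventually[rotated])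
      qed
      then have "(\<lambda>i. norm (g x - t i x)) \<longlonglongrightarrow> 0"
        using tendsto_norm[OF tendsto_diff[OF tendsto_const[of "g x"]], of "\<lambda>i. t i x"] by fastforce
      then have "(\<lambda>i. ennreal (norm (g x - t i x))) \<longlonglongrightarrow> ennreal 0" by (rule tendsto_ennrealI)
      then show ?case by simp
    qed
  qed auto
  define e where "e i = (\<integral>\<^sup>+x. ennreal (norm (g x - t i x)) \<partial>lebesgue)" for i
  have e: "e \<longlonglongrightarrow> 0" using conv by (simp add: e_def[abs_def])
  define J where "J i = Bochner_Integration.simple_bochner_integral lebesgue (t i)" for i
  have "Cauchy J"
  proof (rule metric_CauchyI)
    fix \<epsilon> :: real assume "0 < \<epsilon>"
    then have "eventually (\<lambda>i. e i < ennreal (\<epsilon>/2)) sequentially"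
      by (intro order_tendstoD(2)[OF e]) simp
    then obtain N where N: "\<And>i. i \<ge> N \<Longrightarrow> e i < ennreal (\<epsilon>/2)"
      unfolding eventually_sequentially by blast
    show "\<exists>M. \<forall>m\<ge>M. \<forall>n\<ge>M. dist (J m) (J n) < \<epsilon>"
    proof (rule exI[of _ N], intro allI impI)
      fix m n assume "N \<le> m" "N \<le> n"
      have "ennreal (norm (J m - J n)) \<le> e m + e n"
        unfolding J_def e_def by (rule norm_simple_bochner_integral_diff_le[OF g tint tint])
      also have "\<dots> < ennreal (\<epsilon>/2) + ennreal (\<epsilon>/2)"
        using N \<open>N \<le> m\<close> \<open>N \<le> n\<close> by (intro add_strict_mono) auto
      also have "\<dots> = ennreal \<epsilon>" using \<open>0 < \<epsilon>\<close> by (simp flip: ennreal_plus)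
      finally show "dist (J m) (J n) < \<epsilon>"
        using \<open>0 < \<epsilon>\<close> by (simp add: dist_norm ennreal_less_iff)
    qed
  qed
  then obtain I where "J \<longlonglongrightarrow> I" using Cauchy_convergent convergent_def by blast
  then show ?thesis
    unfolding has_strong_bochner_integral_def
    using g tint e unfolding J_def[abs_def] e_def[abs_def] by blast
qed

lemma has_strong_bochner_integral_cinner:
  fixes g :: "'a::euclidean_space \<Rightarrow> 'h::complex_hilbert"
  assumes "has_strong_bochner_integral lebesgue g I"
  shows "has_bochner_integral lebesgue (\<lambda>x. cinner (g x) e) (cinner I e)"
proof -
  obtain s where g: "strongly_measurable lebesgue g"
    and s: "\<And>i. Bochner_Integration.simple_bochner_integrable lebesgue (s i)"
    and lim: "(\<lambda>i. \<integral>\<^sup>+x. ennreal (norm (g x - s i x)) \<partial>lebesgue) \<longlonglongrightarrow> 0"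
    and I: "(\<lambda>i. Bochner_Integration.simple_bochner_integral lebesgue (s i)) \<longlonglongrightarrow> I"
    using assms unfolding has_strong_bochner_integral_def by blast
  interpret L: bounded_linear "\<lambda>x. cinner x e" by (rule bounded_linear_cinner_left)
  have sf: "simple_function lebesgue (s i)" for i
    using s[of i] by (auto simp: Bochner_Integration.simple_bochner_integrable.simps)
  show ?thesis
  proof (rule has_bochner_integral.intros[where s = "\<lambda>i x. cinner (s i x) e"])
    show "(\<lambda>x. cinner (g x) e) \<in> borel_measurable lebesgue"
      by (intro strongly_measurable_compose_borel[OF g] L.continuous_on continuous_intros)
    show "Bochner_Integration.simple_bochner_integrable lebesgue (\<lambda>x. cinner (s i x) e)" for i
      using Bochner_Integration.simple_bochner_integrable_compose2[of "\<lambda>x y. cinner x e", OF _ s s] by simp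
    have m: "(\<lambda>x. norm (g x - s i x)) \<in> borel_measurable lebesgue" for i
      using strongly_measurable_compose_borel[OF strongly_measurable_diff_simple[OF g sf], where \<psi> = norm]
      by (auto intro: continuous_intros)
    have "(\<lambda>i. ennreal (norm e) * (\<integral>\<^sup>+x. ennreal (norm (g x - s i x)) \<partial>lebesgue)) \<longlonglongrightarrow> ennreal (norm e) * 0"
      by (intro ennreal_tendsto_cmult lim) simp
    then have *: "(\<lambda>i. ennreal (norm e) * (\<integral>\<^sup>+x. ennreal (norm (g x - s i x)) \<partial>lebesgue)) \<longlonglongrightarrow> 0"
      by simp
    show "(\<lambda>i. \<integral>\<^sup>+x. ennreal (norm (cinner (g x) e - cinner (s i x) e)) \<partial>lebesgue) \<longlonglongrightarrow> 0"
    proof (rule tendsto_sandwich[OF _ _ tendsto_const *])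
      show "\<forall>\<^sub>F i in sequentially. (\<integral>\<^sup>+x. ennreal (norm (cinner (g x) e - cinner (s i x) e)) \<partial>lebesgue)
         \<le> ennreal (norm e) * (\<integral>\<^sup>+x. ennreal (norm (g x - s i x)) \<partial>lebesgue)"
      proof (rule always_eventually, rule allI)
        fix i
        have "(\<integral>\<^sup>+x. ennreal (norm (cinner (g x) e - cinner (s i x) e)) \<partial>lebesgue)
          \<le> (\<integral>\<^sup>+x. ennreal (norm e) * ennreal (norm (g x - s i x)) \<partial>lebesgue)"
        proof (rule nn_integral_mono)
          fix x
          have "norm (cinner (g x) e - cinner (s i x) e) \<le> norm e * norm (g x - s i x)"
            using norm_cinner_le[of "g x - s i x" e] by (simp add: L.diff mult.commute)
          then show "ennreal (norm (cinner (g x) e - cinner (s i x) e))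
              \<le> ennreal (norm e) * ennreal (norm (g x - s i x))"
            by (simp add: ennreal_leI flip: ennreal_mult)
        qed
        also have "\<dots> = ennreal (norm e) * (\<integral>\<^sup>+x. ennreal (norm (g x - s i x)) \<partial>lebesgue)"
          using m by (intro nn_integral_cmult) auto
        finally show "(\<integral>\<^sup>+x. ennreal (norm (cinner (g x) e - cinner (s i x) e)) \<partial>lebesgue) \<le> \<dots>" .
      qed
    qed simp
    have "Bochner_Integration.simple_bochner_integral lebesgue (\<lambda>x. cinner (s i x) e)
      = cinner (Bochner_Integration.simple_bochner_integral lebesgue (s i)) e" for i
      by (rule Bochner_Integration.simple_bochner_integral_linear[OF L.linear s])
    then show "(\<lambda>i. Bochner_Integration.simple_bochner_integral lebesgue (\<lambda>x. cinner (s i x) e)) \<longlonglongrightarrow> cinner I e"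
      using L.tendsto[OF I] by simp
  qed
qed

text \<open>Inner products determine a vector, so uniqueness of the strong integral is the scalar one.\<close>

lemma has_strong_bochner_integral_unique:
  fixes g :: "'a::euclidean_space \<Rightarrow> 'h::complex_hilbert"
  assumes "has_strong_bochner_integral lebesgue g I" "has_strong_bochner_integral lebesgue g J"
  shows "I = J"
proof -
  have "cinner I e = cinner J e" for e
    using assms by (blast intro: has_bochner_integral_eq has_strong_bochner_integral_cinner)
  then have "cinner (I - J) (I - J) = 0"
    using linear_diff[OF bounded_linear.linear[OF bounded_linear_cinner_left], of I J "I - J"] by simp
  then show ?thesis by (simp add: cinner_eq_zero_iff)
qed

text \<open>Through this identity all later arguments are about integrals of complex functions.\<close>

lemma cinner_strong_bochner_integral:
  fixes g :: "'a::euclidean_space \<Rightarrow> 'h::complex_hilbert"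
  assumes "strongly_measurable lebesgue g" "(\<integral>\<^sup>+x. ennreal (norm (g x)) \<partial>lebesgue) < \<infinity>"
  shows "cinner (strong_bochner_integral lebesgue g) e = (\<integral>x. cinner (g x) e \<partial>lebesgue)"
proof -
  obtain I where I: "has_strong_bochner_integral lebesgue g I"
    using has_strong_bochner_integral_exists[OF assms] by blast
  then have "strong_bochner_integral lebesgue g = I"
    unfolding strong_bochner_integral_def
    using has_strong_bochner_integral_unique by (metis (mono_tags, lifting) the_equality)
  then show ?thesis
    using has_strong_bochner_integral_cinner[OF I] has_bochner_integral_integral_eq by metis
qed

section \<open>Schwartz functions\<close>

text \<open>
  The shell \<open>k \<le> \<parallel>x\<parallel> \<le> k + 1\<close> lies in a ball of volume proportional to \<open>(k + 1) ^ DIM('a)\<close>, which leaves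
  the convergent sum of the \<open>1 / (k + 1)\<^sup>2\<close>.
\<close>

lemma nn_integral_inverse_power_finite:
  "(\<integral>\<^sup>+x. ennreal (1 / (1 + norm (x :: 'a::euclidean_space)) ^ (DIM('a) + 2)) \<partial>lborel) < \<infinity>"
proof -
  let ?D = "DIM('a)"
  define c where "c k = 1 / (1 + real k) ^ (?D + 2)" for k
  have le: "ennreal (1 / (1 + norm x) ^ (?D + 2)) \<le> (\<Sum>k. ennreal (c k) * indicator (cball 0 (real k + 1)) x)"
    (is "_ \<le> suminf ?f") for x :: 'a
  proof -
    define k where "k = nat \<lfloor>norm x\<rfloor>"
    have "real k = of_int \<lfloor>norm x\<rfloor>" by (simp add: k_def)
    then have k: "real k \<le> norm x" "norm x \<le> real k + 1" by linarith+
    have "1 / (1 + norm x) ^ (?D + 2) \<le> c k"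
      unfolding c_def using k by (intro divide_left_mono power_mono mult_pos_pos) auto
    then have "ennreal (1 / (1 + norm x) ^ (?D + 2)) \<le> ?f k"
      using k by (simp add: ennreal_leI)
    also have "\<dots> = sum ?f {k}"
      by (simp only: sum.insert finite.emptyI empty_iff not_False_eq_True sum.empty add_0_right)
    also have "\<dots> \<le> suminf ?f" by (rule sum_le_suminf) auto
    finally show ?thesis .
  qed
  have "(\<integral>\<^sup>+x. ennreal (1 / (1 + norm (x :: 'a)) ^ (?D + 2)) \<partial>lborel)
      \<le> (\<integral>\<^sup>+x. (\<Sum>k. ennreal (c k) * indicator (cball (0 :: 'a) (real k + 1)) x) \<partial>lborel)"
    by (intro nn_integral_mono le)
  also have "\<dots> = (\<Sum>k. \<integral>\<^sup>+x. ennreal (c k) * indicator (cball (0 :: 'a) (real k + 1)) x \<partial>lborel)"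
    by (rule nn_integral_suminf) (intro borel_measurable_times_ennreal borel_measurable_indicator, auto)
  also have "\<dots> = (\<Sum>k. ennreal (unit_ball_vol (real ?D) * (1 / (real k + 1)\<^sup>2)))"
  proof (rule suminf_cong)
    fix k
    have "0 \<le> c k" by (simp add: c_def)
    have "(\<integral>\<^sup>+x. ennreal (c k) * indicator (cball (0 :: 'a) (real k + 1)) x \<partial>lborel)
      = ennreal (c k) * emeasure lborel (cball (0 :: 'a) (real k + 1))"
      by (rule nn_integral_cmult_indicator) simp
    also have "\<dots> = ennreal (c k * (unit_ball_vol (real ?D) * (real k + 1) ^ ?D))"
      using \<open>0 \<le> c k\<close> by (simp add: emeasure_cball flip: ennreal_mult')
    also have "c k * (unit_ball_vol (real ?D) * (real k + 1) ^ ?D) = unit_ball_vol (real ?D) * (1 / (real k + 1)\<^sup>2)"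
      by (simp add: c_def power_add add.commute power2_eq_square)
    finally show "(\<integral>\<^sup>+x. ennreal (c k) * indicator (cball (0 :: 'a) (real k + 1)) x \<partial>lborel)
      = ennreal (unit_ball_vol (real ?D) * (1 / (real k + 1)\<^sup>2))" .
  qed
  also have "\<dots> < \<infinity>"
  proof -
    have "summable (\<lambda>k. 1 / (real k + 1)\<^sup>2)"
      using inverse_power_summable[of 2, where 'a = real] summable_Suc_iff[of "\<lambda>n. inverse (real n ^ 2)"]
      by (simp add: field_simps)
    then have "summable (\<lambda>k. unit_ball_vol (real ?D) * (1 / (real k + 1)\<^sup>2))" by (rule summable_mult)
    then show ?thesis by (simp add: less_top ennreal_suminf_neq_top)
  qed
  finally show ?thesis .
qed

lemma schwartz_differentiable:
  "\<phi> \<in> schwartz_space \<Longrightarrow> foldr partial_derivative is \<phi> differentiable (at x)"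
  by (simp add: schwartz_space_def)

lemma schwartz_continuous: "\<phi> \<in> schwartz_space \<Longrightarrow> continuous_on UNIV \<phi>"
  using schwartz_differentiable[of \<phi> "[]"]
  by (auto intro!: continuous_at_imp_continuous_on differentiable_imp_continuous_within)

lemma one_plus_power_le: "0 \<le> (r :: real) \<Longrightarrow> (1 + r) ^ m \<le> 2 ^ m * (1 + r ^ m)"
proof -
  assume r: "0 \<le> r"
  have "(1 + r) ^ m \<le> (2 * max 1 r) ^ m" using r by (intro power_mono) auto
  also have "\<dots> = 2 ^ m * max 1 r ^ m" by (simp add: power_mult_distrib)
  also have "max 1 r ^ m \<le> 1 + r ^ m" using r by (simp add: max_def)
  finally show ?thesis by simp
qed

lemma schwartz_bound:
  assumes "\<phi> \<in> schwartz_space"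
  obtains B where "0 \<le> B" "\<And>x. (1 + norm x) ^ m * cmod (foldr partial_derivative is \<phi> x) \<le> B"
proof -
  let ?d = "foldr partial_derivative is \<phi>"
  obtain B0 where B0: "\<And>x. norm x ^ 0 * cmod (?d x) \<le> B0"
    using assms unfolding schwartz_space_def by blast
  obtain B1 where B1: "\<And>x. norm x ^ m * cmod (?d x) \<le> B1"
    using assms unfolding schwartz_space_def by blast
  have b: "(1 + norm x) ^ m * cmod (?d x) \<le> 2 ^ m * (B0 + B1)" for x
  proof -
    have "(1 + norm x) ^ m * cmod (?d x) \<le> (2 ^ m * (1 + norm x ^ m)) * cmod (?d x)"
      by (intro mult_right_mono one_plus_power_le) auto
    also have "\<dots> = 2 ^ m * (norm x ^ 0 * cmod (?d x) + norm x ^ m * cmod (?d x))"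
      by (simp add: algebra_simps)
    also have "\<dots> \<le> 2 ^ m * (B0 + B1)" by (intro mult_left_mono add_mono B0 B1) auto
    finally show ?thesis .
  qed
  show ?thesis
  proof (rule that[OF _ b])
    have "0 \<le> (1 + norm (0 :: real ^ 'a)) ^ m * cmod (?d 0)" by simp
    then show "0 \<le> 2 ^ m * (B0 + B1)" using b by (rule order_trans)
  qed
qed

lemma schwartz_moment_finite:
  fixes \<phi> :: "real ^ 'n \<Rightarrow> complex"
  assumes "\<phi> \<in> schwartz_space"
  shows "(\<integral>\<^sup>+x. ennreal ((1 + norm x) ^ R * cmod (\<phi> x)) \<partial>lborel) < \<infinity>"
proof -
  let ?D = "DIM(real ^ 'n)"
  obtain B where B: "0 \<le> B" "\<And>x. (1 + norm x) ^ (R + (?D + 2)) * cmod (\<phi> x) \<le> B"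
    using schwartz_bound[OF assms, of "R + (?D + 2)" "[]"] by auto
  have "(\<integral>\<^sup>+x. ennreal ((1 + norm x) ^ R * cmod (\<phi> x)) \<partial>lborel)
     \<le> (\<integral>\<^sup>+x. ennreal B * ennreal (1 / (1 + norm (x :: real ^ 'n)) ^ (?D + 2)) \<partial>lborel)"
  proof (rule nn_integral_mono)
    fix x :: "real ^ 'n"
    have "0 < (1 + norm x) ^ (?D + 2)" by (intro zero_less_power) (simp add: add_pos_nonneg)
    then have "(1 + norm x) ^ R * cmod (\<phi> x) \<le> B * (1 / (1 + norm x) ^ (?D + 2))"
      using B(2)[of x] by (simp add: power_add field_simps)
    then show "ennreal ((1 + norm x) ^ R * cmod (\<phi> x)) \<le> ennreal B * ennreal (1 / (1 + norm x) ^ (?D + 2))"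
      using B(1) by (simp add: ennreal_leI flip: ennreal_mult)
  qed
  also have "\<dots> = ennreal B * (\<integral>\<^sup>+x. ennreal (1 / (1 + norm (x :: real ^ 'n)) ^ (?D + 2)) \<partial>lborel)"
    by (rule nn_integral_cmult) measurable
  also have "\<dots> < \<infinity>"
    using nn_integral_inverse_power_finite[where 'a = "real ^ 'n"] by (simp add: ennreal_mult_less_top)
  finally show ?thesis .
qed

lemma frechet_derivative_partials:
  assumes "v differentiable (at x)"
  shows "frechet_derivative v (at x) h = (\<Sum>i\<in>UNIV. h $ i *\<^sub>R partial_derivative i v x)"
proof -
  have l: "linear (frechet_derivative v (at x))" using assms by (rule linear_frechet_derivative)
  have "frechet_derivative v (at x) h = frechet_derivative v (at x) (\<Sum>i\<in>UNIV. h $ i *\<^sub>R axis i 1)"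
    by (simp add: basis_expansion[of h, unfolded scalar_mult_eq_scaleR])
  also have "\<dots> = (\<Sum>i\<in>UNIV. h $ i *\<^sub>R frechet_derivative v (at x) (axis i 1))"
    by (simp add: linear_sum[OF l] linear_scale[OF l])
  finally show ?thesis by (simp add: partial_derivative_def)
qed

lemma partial_derivative_eq:
  "(v has_derivative D) (at x) \<Longrightarrow> partial_derivative i v x = D (axis i 1)"
  unfolding partial_derivative_def using frechet_derivative_at[of v D x] by simp

text \<open>
  Termwise differentiation is allowed since every derivative of \<open>\<phi>\<close> is bounded and the coefficients are
  summable; the decay survives translation because \<open>1 + \<parallel>x\<parallel> \<le> (1 + \<parallel>b\<parallel>) (1 + \<parallel>x - b\<parallel>)\<close>, at the price of
  a moment of the coefficients. These series are the test functions that \<open>gliding_hump\<close> needs.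
\<close>

lemma schwartz_translate_series:
  fixes \<phi> :: "real ^ 'n \<Rightarrow> complex" and c :: "nat \<Rightarrow> real" and b :: "nat \<Rightarrow> real ^ 'n"
  assumes \<phi>: "\<phi> \<in> schwartz_space"
    and rapid: "\<And>m. summable (\<lambda>n. \<bar>c n\<bar> * (1 + norm (b n)) ^ m)"
  shows "(\<lambda>x. \<Sum>n. c n *\<^sub>R \<phi> (x - b n)) \<in> schwartz_space"
proof -
  define \<psi> where "\<psi> = (\<lambda>x. \<Sum>n. c n *\<^sub>R \<phi> (x - b n))"
  have sc: "summable (\<lambda>n. \<bar>c n\<bar>)" using rapid[of 0] by simp
  have term_le: "(1 + norm x) ^ m * norm (c n *\<^sub>R w) \<le> B * (\<bar>c n\<bar> * (1 + norm (b n)) ^ m)"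
    if w: "(1 + norm (x - b n)) ^ m * cmod w \<le> B" for x n m w B
  proof -
    have "1 + norm x \<le> (1 + norm (b n)) * (1 + norm (x - b n))"
    proof -
      have "(1 + norm (b n)) * (1 + norm (x - b n)) = 1 + norm (b n) + norm (x - b n) + norm (b n) * norm (x - b n)"
        by (simp add: algebra_simps)
      moreover have "0 \<le> norm (b n) * norm (x - b n)" by simp
      ultimately show ?thesis using norm_triangle_sub[of x "b n"] by linarith
    qed
    then have "(1 + norm x) ^ m \<le> ((1 + norm (b n)) * (1 + norm (x - b n))) ^ m"
      by (intro power_mono) auto
    then have "(1 + norm x) ^ m * norm (c n *\<^sub>R w)
        \<le> ((1 + norm (b n)) * (1 + norm (x - b n))) ^ m * norm (c n *\<^sub>R w)"
      by (intro mult_right_mono) auto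
    also have "\<dots> = (\<bar>c n\<bar> * (1 + norm (b n)) ^ m) * ((1 + norm (x - b n)) ^ m * cmod w)"
      by (simp add: power_mult_distrib mult_ac)
    also have "\<dots> \<le> (\<bar>c n\<bar> * (1 + norm (b n)) ^ m) * B"
      using w by (intro mult_left_mono) auto
    finally show ?thesis by (simp add: mult_ac)
  qed
  have sum_d: "summable (\<lambda>n. norm (c n *\<^sub>R foldr partial_derivative is \<phi> (x - b n)))" for "is" x
  proof -
    obtain B where B: "\<And>x. (1 + norm x) ^ 0 * cmod (foldr partial_derivative is \<phi> x) \<le> B"
      using schwartz_bound[OF \<phi>, of 0 "is"] by blast
    show ?thesis
    proof (rule summable_comparison_test'[where N = 0])
      show "summable (\<lambda>n. B * \<bar>c n\<bar>)" by (intro summable_mult sc)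
      show "norm (norm (c n *\<^sub>R foldr partial_derivative is \<phi> (x - b n))) \<le> B * \<bar>c n\<bar>" for n
        using term_le[OF B, of x n] by simp
    qed
  qed
  have deriv: "((\<lambda>x. \<Sum>n. c n *\<^sub>R foldr partial_derivative is \<phi> (x - b n)) has_derivative
      (\<lambda>h. \<Sum>n. c n *\<^sub>R frechet_derivative (foldr partial_derivative is \<phi>) (at (x - b n)) h)) (at x)"
    for "is" x
  proof -
    define v where "v = foldr partial_derivative is \<phi>"
    define D where "D y = frechet_derivative v (at y)" for y
    have vd: "(v has_derivative D y) (at y)" for y
      unfolding D_def frechet_derivative_works[symmetric] v_def by (rule schwartz_differentiable[OF \<phi>])
    have "\<exists>B. \<forall>x. cmod (partial_derivative i v x) \<le> B" for i
      using schwartz_bound[OF \<phi>, of 0 "i # is"] by (auto simp: v_def)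
    then obtain B where B: "\<And>i x. cmod (partial_derivative i v x) \<le> B i" by metis
    define A where "A = (\<Sum>i\<in>UNIV. B i)"
    have A0: "0 \<le> A" unfolding A_def by (intro sum_nonneg order_trans[OF norm_ge_zero B])
    have DA: "cmod (D y h) \<le> A * norm h" for y h
    proof -
      have "cmod (D y h) \<le> (\<Sum>i\<in>UNIV. norm (h $ i *\<^sub>R partial_derivative i v y))"
        unfolding D_def frechet_derivative_partials[OF schwartz_differentiable[OF \<phi>, of "is", folded v_def]]
        by (rule norm_sum)
      also have "\<dots> \<le> (\<Sum>i\<in>UNIV. norm h * B i)"
        unfolding norm_scaleR using component_le_norm_cart[of h]
        by (intro sum_mono mult_mono B) (auto simp: order_trans[OF norm_ge_zero B])
      finally show ?thesis by (simp add: A_def sum_distrib_left mult_ac)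
    qed
    have Amono: "\<bar>c n\<bar> * cmod (D y h) \<le> A * norm h * \<bar>c n\<bar>" for n y h
      using mult_left_mono[OF DA[of y h] abs_ge_zero[of "c n"]] by (simp add: mult_ac)
    have sD: "summable (\<lambda>n. norm (c n *\<^sub>R D (x - b n) h))" for x h
      by (rule summable_comparison_test'[where N = 0, OF summable_mult[OF sc, of "A * norm h"]])
         (simp add: Amono)
    have "\<exists>g. \<forall>x\<in>UNIV. (\<lambda>n. c n *\<^sub>R v (x - b n)) sums g x \<and>
       (g has_derivative (\<lambda>h. \<Sum>n. c n *\<^sub>R D (x - b n) h)) (at x within UNIV)"
    proof (rule has_derivative_series)
      show "((\<lambda>x. c n *\<^sub>R v (x - b n)) has_derivative (\<lambda>h. c n *\<^sub>R D (x - b n) h)) (at x within UNIV)" for n x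
      proof -
        have "((\<lambda>x. v (x - b n)) has_derivative (\<lambda>h. D (x - b n) h)) (at x)"
          by (rule has_derivative_compose[of "\<lambda>x. x - b n" "\<lambda>h. h" x UNIV v "D (x - b n)", simplified])
             (auto intro!: derivative_eq_intros vd)
        then show ?thesis by (simp add: has_derivative_scaleR_right)
      qed
      show "\<forall>\<^sub>F n in sequentially. \<forall>x\<in>UNIV. \<forall>h. norm ((\<Sum>i<n. c i *\<^sub>R D (x - b i) h) - (\<Sum>n. c n *\<^sub>R D (x - b n) h)) \<le> e * norm h"
        if e: "e > 0" for e
      proof -
        have "(\<lambda>n. A * (\<Sum>i. \<bar>c (i + n)\<bar>)) \<longlonglongrightarrow> A * 0"
          by (intro tendsto_intros suminf_exist_split2 sc)
        then have "\<forall>\<^sub>F n in sequentially. A * (\<Sum>i. \<bar>c (i + n)\<bar>) < e"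
          using e by (intro order_tendstoD(2)) auto
        then show ?thesis
        proof eventually_elim
          case (elim n)
          show ?case
          proof (intro ballI allI)
            fix x h
            let ?u = "\<lambda>i. c i *\<^sub>R D (x - b i) h"
            have su: "summable (\<lambda>i. norm (?u (i + n)))" using sD by (rule summable_ignore_initial_segment)
            have sc': "summable (\<lambda>i. \<bar>c (i + n)\<bar>)" using sc by (rule summable_ignore_initial_segment)
            have "norm ((\<Sum>i<n. ?u i) - suminf ?u) = norm (\<Sum>i. ?u (i + n))"
              using suminf_split_initial_segment[OF summable_norm_cancel[OF sD[of x h]], of n]
              by (simp add: norm_minus_commute)
            also have "\<dots> \<le> (\<Sum>i. norm (?u (i + n)))" by (rule summable_norm[OF su])
            also have "\<dots> \<le> (\<Sum>i. (A * norm h) * \<bar>c (i + n)\<bar>)"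
              by (rule suminf_le[OF _ su summable_mult[OF sc']])
                 (simp add: Amono)
            also have "\<dots> = (A * (\<Sum>i. \<bar>c (i + n)\<bar>)) * norm h" using suminf_mult[OF sc', of "A * norm h"] by simp
            also have "\<dots> \<le> e * norm h" using elim by (intro mult_right_mono) auto
            finally show "norm ((\<Sum>i<n. ?u i) - suminf ?u) \<le> e * norm h" .
          qed
        qed
      qed
      have "summable (\<lambda>n. c n *\<^sub>R v (0 - b n))"
        unfolding v_def by (rule summable_norm_cancel[OF sum_d[of "is" 0]])
      then show "(\<lambda>n. c n *\<^sub>R v (0 - b n)) sums (\<Sum>n. c n *\<^sub>R v (0 - b n))"
        by (rule summable_sums)
    qed (rule convex_UNIV, rule UNIV_I)
    then obtain g where g': "\<forall>x\<in>UNIV. (\<lambda>n. c n *\<^sub>R v (x - b n)) sums g x \<and>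
       (g has_derivative (\<lambda>h. \<Sum>n. c n *\<^sub>R D (x - b n) h)) (at x within UNIV)" by (rule exE)
    have g: "(\<lambda>n. c n *\<^sub>R v (x - b n)) sums g x"
      "(g has_derivative (\<lambda>h. \<Sum>n. c n *\<^sub>R D (x - b n) h)) (at x)" for x
      using bspec[OF g' UNIV_I, of x] by (rule conjunct1, rule conjunct2)
    have "g = (\<lambda>x. \<Sum>n. c n *\<^sub>R v (x - b n))" using g(1) by (auto simp: sums_iff)
    with g(2)[of x] show ?thesis by (simp add: v_def D_def)
  qed
  have eq: "foldr partial_derivative is \<psi> = (\<lambda>x. \<Sum>n. c n *\<^sub>R foldr partial_derivative is \<phi> (x - b n))" for "is"
  proof (induction "is")
    case Nil
    show ?case by (simp add: \<psi>_def)
  next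
    case (Cons i "is")
    show ?case
    proof
      fix x
      show "foldr partial_derivative (i # is) \<psi> x
          = (\<Sum>n. c n *\<^sub>R foldr partial_derivative (i # is) \<phi> (x - b n))"
        using partial_derivative_eq[OF deriv[of "is" x], of i]
        by (simp add: Cons.IH) (simp add: partial_derivative_def)
    qed
  qed
  have "\<psi> \<in> schwartz_space"
    unfolding schwartz_space_def
  proof (intro CollectI allI conjI)
    fix "is" x
    show "foldr partial_derivative is \<psi> differentiable (at x)"
      unfolding eq differentiable_def using deriv by blast
  next
    fix "is" :: "'n list" and m :: nat
    obtain B where B: "0 \<le> B" "\<And>x. (1 + norm x) ^ m * cmod (foldr partial_derivative is \<phi> x) \<le> B"
      using schwartz_bound[OF \<phi>, of m "is"] by blast
    show "\<exists>B. \<forall>x. norm x ^ m * norm (foldr partial_derivative is \<psi> x) \<le> B"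
    proof (intro exI allI)
      fix x :: "real ^ 'n"
      let ?u = "\<lambda>n. c n *\<^sub>R foldr partial_derivative is \<phi> (x - b n)"
      have "norm x ^ m * norm (foldr partial_derivative is \<psi> x) \<le> (1 + norm x) ^ m * (\<Sum>n. norm (?u n))"
        unfolding eq by (intro mult_mono power_mono summable_norm sum_d) auto
      also have "\<dots> = (\<Sum>n. (1 + norm x) ^ m * norm (?u n))" by (rule suminf_mult[symmetric, OF sum_d])
      also have "\<dots> \<le> (\<Sum>n. B * (\<bar>c n\<bar> * (1 + norm (b n)) ^ m))"
        by (rule suminf_le[OF term_le[OF B(2)] summable_mult[OF sum_d] summable_mult[OF rapid]])
      finally show "norm x ^ m * norm (foldr partial_derivative is \<psi> x)
          \<le> (\<Sum>n. B * (\<bar>c n\<bar> * (1 + norm (b n)) ^ m))" .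
    qed
  qed
  then show ?thesis by (simp add: \<psi>_def)
qed

lemma schwartz_translate:
  assumes "\<phi> \<in> schwartz_space"
  shows "(\<lambda>x. \<phi> (x - b)) \<in> schwartz_space"
proof -
  let ?c = "\<lambda>n::nat. if n = 0 then 1 else 0 :: real"
  have "(\<lambda>x. \<Sum>n. ?c n *\<^sub>R \<phi> (x - b)) \<in> schwartz_space"
  proof (rule schwartz_translate_series[OF assms])
    show "summable (\<lambda>n. \<bar>?c n\<bar> * (1 + norm b) ^ m)" for m
      by (rule summable_finite[of "{0}"]) auto
  qed
  moreover have "(\<Sum>n. ?c n *\<^sub>R \<phi> (x - b)) = \<phi> (x - b)" for x
    using suminf_finite[of "{0}" "\<lambda>n. ?c n *\<^sub>R \<phi> (x - b)"] by simp
  ultimately show ?thesis by simp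
qed

lemma real_polynomial_function_derivative:
  assumes "real_polynomial_function p"
  obtains p' where "\<And>x. (p has_derivative p' x) (at x)" "\<And>h. real_polynomial_function (\<lambda>x. p' x h)"
proof -
  have "\<exists>p'. (\<forall>x. (p has_derivative p' x) (at x)) \<and> (\<forall>h. real_polynomial_function (\<lambda>x. p' x h))"
    using assms
  proof induction
    case (linear f)
    then show ?case
      by (intro exI[of _ "\<lambda>x. f"]) (auto intro: bounded_linear_imp_has_derivative)
  next
    case (const c)
    show ?case by (intro exI[of _ "\<lambda>x h. 0"]) auto
  next
    case (add f g)
    then obtain f' g' where "\<And>x. (f has_derivative f' x) (at x)" "\<And>h. real_polynomial_function (\<lambda>x. f' x h)"
      "\<And>x. (g has_derivative g' x) (at x)" "\<And>h. real_polynomial_function (\<lambda>x. g' x h)" by blast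
    then show ?case
      by (intro exI[of _ "\<lambda>x h. f' x h + g' x h"]) (auto intro: has_derivative_add)
  next
    case (mult f g)
    obtain f' g' where f': "\<And>x. (f has_derivative f' x) (at x)" "\<And>h. real_polynomial_function (\<lambda>x. f' x h)"
      and g': "\<And>x. (g has_derivative g' x) (at x)" "\<And>h. real_polynomial_function (\<lambda>x. g' x h)"
      using mult.IH by blast
    have "((\<lambda>x. f x * g x) has_derivative (\<lambda>h. f x * g' x h + f' x h * g x)) (at x)" for x
      by (rule has_derivative_mult[OF f'(1) g'(1)])
    moreover have "real_polynomial_function (\<lambda>x. f x * g' x h + f' x h * g x)" for h
      by (intro real_polynomial_function.intros(3,4) mult.hyps f' g')
    ultimately show ?case
      by (intro exI[of _ "\<lambda>x h. f x * g' x h + f' x h * g x"]) simp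
  qed
  then show ?thesis using that by blast
qed

lemma real_polynomial_function_growth:
  assumes "real_polynomial_function p"
  shows "\<exists>K N. 0 \<le> K \<and> (\<forall>x. \<bar>p x\<bar> \<le> K * (1 + norm x) ^ N)"
  using assms
proof induction
  case (linear f)
  then obtain K where "0 \<le> K" "\<And>x. \<bar>f x\<bar> \<le> norm x * K"
    using bounded_linear.nonneg_bounded[OF linear] by auto
  then show ?case
    by (intro exI[of _ K] exI[of _ 1]) (auto simp: algebra_simps add_increasing)
next
  case (const c)
  show ?case by (intro exI[of _ "\<bar>c\<bar>"] exI[of _ 0]) auto
next
  case (add f g)
  then obtain K N L M where "0 \<le> K" "0 \<le> L" "\<And>x. \<bar>f x\<bar> \<le> K * (1 + norm x) ^ N"
     "\<And>x. \<bar>g x\<bar> \<le> L * (1 + norm x) ^ M" by blast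
  note * = this
  have "\<bar>f x + g x\<bar> \<le> (K + L) * (1 + norm x) ^ (N + M)" for x
  proof -
    have "\<bar>f x + g x\<bar> \<le> K * (1 + norm x) ^ N + L * (1 + norm x) ^ M" using *(3,4)[of x] by linarith
    also have "\<dots> \<le> K * (1 + norm x) ^ (N + M) + L * (1 + norm x) ^ (N + M)"
      using *(1,2) by (intro add_mono mult_left_mono power_increasing) auto
    finally show ?thesis by (simp add: algebra_simps)
  qed
  then show ?case using *(1,2) by (intro exI[of _ "K + L"] exI[of _ "N + M"]) auto
next
  case (mult f g)
  then obtain K N L M where *: "0 \<le> K" "0 \<le> L" "\<And>x. \<bar>f x\<bar> \<le> K * (1 + norm x) ^ N"
     "\<And>x. \<bar>g x\<bar> \<le> L * (1 + norm x) ^ M" by blast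
  have "\<bar>f x * g x\<bar> \<le> (K * L) * (1 + norm x) ^ (N + M)" for x
  proof -
    have "\<bar>f x * g x\<bar> \<le> (K * (1 + norm x) ^ N) * (L * (1 + norm x) ^ M)"
      unfolding abs_mult using * by (intro mult_mono) auto
    then show ?thesis by (simp add: power_add mult_ac)
  qed
  then show ?case using *(1,2) by (intro exI[of _ "K * L"] exI[of _ "N + M"]) auto
qed

text \<open>
  From \<open>1 + r \<le> exp r\<close> the left-hand side is at most \<open>exp (M r - c r\<^sup>2)\<close>; completing the square bounds
  the exponent.
\<close>

lemma polynomial_gaussian_bound:
  fixes c :: real
  assumes "0 < c" "0 \<le> r"
  shows "(1 + r) ^ M * exp (- c * r\<^sup>2) \<le> exp ((real M)\<^sup>2 / (4 * c))"
proof -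
  have "(1 + r) ^ M \<le> exp r ^ M" using assms exp_ge_add_one_self[of r] by (intro power_mono) auto
  then have "(1 + r) ^ M * exp (- c * r\<^sup>2) \<le> exp (real M * r) * exp (- c * r\<^sup>2)"
    by (intro mult_right_mono) (auto simp: exp_of_nat_mult)
  also have "\<dots> = exp (real M * r - c * r\<^sup>2)" by (simp flip: exp_add)
  also have "real M * r - c * r\<^sup>2 \<le> (real M)\<^sup>2 / (4 * c)"
  proof -
    have "0 \<le> (2 * c * r - real M)\<^sup>2" by simp
    then have "4 * c * (real M * r - c * r\<^sup>2) \<le> (real M)\<^sup>2" by (simp add: power2_eq_square algebra_simps)
    then show ?thesis using assms(1) by (simp add: field_simps)
  qed
  finally show ?thesis by simp
qed

text \<open>
  Products of a polynomial and a fixed Gaussian are stable under partial derivatives, which is why the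
  polynomial factor is carried along.
\<close>

lemma schwartz_polynomial_gaussian:
  fixes p :: "real ^ 'n \<Rightarrow> real"
  assumes p: "real_polynomial_function p" and c: "0 < c"
  shows "(\<lambda>x. complex_of_real (p x * exp (- c * (norm x)\<^sup>2))) \<in> schwartz_space"
proof -
  define G where "G p x = complex_of_real (p x * exp (- c * (norm x)\<^sup>2))" for p and x :: "real ^ 'n"
  have der: "\<exists>q. real_polynomial_function q \<and> partial_derivative i (G p) = G q"
    and diff: "G p differentiable (at x)" if poly: "real_polynomial_function p" for p i x
  proof -
    obtain p' where p': "\<And>x. (p has_derivative p' x) (at x)" "\<And>h. real_polynomial_function (\<lambda>x. p' x h)"
      using real_polynomial_function_derivative[OF poly] by blast
    define q where "q x h = p' x h + (- 2 * c) * ((x \<bullet> h) * p x)" for x h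
    have q: "real_polynomial_function (\<lambda>x. q x h)" for h
      unfolding q_def
      by (intro real_polynomial_function.intros p' poly bounded_linear_inner_left)
    have d: "(G p has_derivative (\<lambda>h. complex_of_real (q x h * exp (- c * (norm x)\<^sup>2)))) (at x)" for x
    proof -
      have "((\<lambda>x. p x * exp (- c * (norm x)\<^sup>2)) has_derivative (\<lambda>h. q x h * exp (- c * (norm x)\<^sup>2))) (at x)"
        unfolding power2_norm_eq_inner
        by (rule has_derivative_eq_rhs, (rule derivative_intros p')+)
           (auto simp: q_def fun_eq_iff algebra_simps inner_commute)
      then show ?thesis unfolding G_def by (rule has_derivative_of_real)
    qed
    show "\<exists>q. real_polynomial_function q \<and> partial_derivative i (G p) = G q"
      using q[of "axis i 1"] partial_derivative_eq[OF d, of i]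
      by (intro exI[of _ "\<lambda>x. q x (axis i 1)"]) (auto simp: G_def)
    show "G p differentiable (at x)" using d unfolding differentiable_def by blast
  qed
  have ex: "\<exists>q. real_polynomial_function q \<and> foldr partial_derivative is (G p) = G q" for "is"
  proof (induction "is")
    case Nil
    show ?case using p by auto
  next
    case (Cons i "is")
    then show ?case using der by force
  qed
  have "G p \<in> schwartz_space"
    unfolding schwartz_space_def
  proof (intro CollectI allI conjI)
    fix "is" :: "'n list" and x
    obtain q where q: "real_polynomial_function q" "foldr partial_derivative is (G p) = G q"
      using ex by blast
    show "foldr partial_derivative is (G p) differentiable (at x)" using diff[OF q(1)] q(2) by simp
  next
    fix "is" :: "'n list" and m :: nat
    obtain q where q: "real_polynomial_function q" "foldr partial_derivative is (G p) = G q"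
      using ex by blast
    obtain K N where K: "0 \<le> K" "\<And>x. \<bar>q x\<bar> \<le> K * (1 + norm x) ^ N"
      using real_polynomial_function_growth[OF q(1)] by blast
    show "\<exists>B. \<forall>x. norm x ^ m * cmod (foldr partial_derivative is (G p) x) \<le> B"
    proof (intro exI allI)
      fix x :: "real ^ 'n"
      have "norm x ^ m * cmod (G q x) = norm x ^ m * (\<bar>q x\<bar> * exp (- c * (norm x)\<^sup>2))"
        unfolding G_def norm_of_real by (simp add: abs_mult)
      also have "\<dots> \<le> (1 + norm x) ^ m * ((K * (1 + norm x) ^ N) * exp (- c * (norm x)\<^sup>2))"
        using K by (intro mult_mono power_mono mult_nonneg_nonneg) auto
      also have "\<dots> = K * ((1 + norm x) ^ (m + N) * exp (- c * (norm x)\<^sup>2))"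
        by (simp add: power_add mult_ac)
      also have "\<dots> \<le> K * exp ((real (m + N))\<^sup>2 / (4 * c))"
        by (intro mult_left_mono polynomial_gaussian_bound c K) auto
      finally show "norm x ^ m * cmod (foldr partial_derivative is (G p) x) \<le> K * exp ((real (m + N))\<^sup>2 / (4 * c))"
        by (simp add: q(2))
    qed
  qed
  then show ?thesis by (simp add: G_def[abs_def])
qed

section \<open>Uniform boundedness along translates\<close>

text \<open>
  The principle of uniform boundedness for the functionals \<open>c \<mapsto> \<Sum>n. c n a(s n, t)\<close>, \<open>0 < t \<le> 1\<close>, on rapidly
  decreasing combinations of point masses. If \<open>a\<close> exceeded every polynomial bound, one could pick
  heights \<open>T n\<close> at which the supremum \<open>Q\<close> of \<open>|a(s, T n)|\<close> relative to the weight
  \<open>(1 + |s|) ^ (n + R)\<close> exceeds \<open>4 ^ n\<close>, and points \<open>s n\<close> that almost attain it. In the series with coefficients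
  \<open>\<plusminus> 3 ^ (-n)\<close> over that weight, the \<open>n\<close>-th term has size at least \<open>3/4 \<cdot> 3 ^ (-n) Q\<close> at height \<open>T n\<close>, the sign
  keeps the earlier terms from cancelling it, and the later terms add up to at most \<open>1/2 \<cdot> 3 ^ (-n) Q\<close>. The
  value of the series at \<open>T n\<close> is thus at least \<open>(4/3) ^ n / 4\<close>. Since the exponent of the weight increases
  with \<open>n\<close>, the coefficients decrease faster than every power of \<open>1 + |s n|\<close>.
\<close>

lemma gliding_hump:
  fixes a :: "real \<Rightarrow> real \<Rightarrow> complex" and R :: nat
  assumes away: "\<And>\<tau>. \<tau> > 0 \<Longrightarrow> \<exists>M. \<forall>s t. \<tau> \<le> t \<longrightarrow> cmod (a s t) \<le> M * (1 + \<bar>s\<bar>) ^ R"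
    and bdd: "\<And>(c :: nat \<Rightarrow> real) s. (\<And>m. summable (\<lambda>n. \<bar>c n\<bar> * (1 + \<bar>s n\<bar>) ^ m)) \<Longrightarrow>
      \<exists>B. \<forall>t. 0 < t \<longrightarrow> t \<le> 1 \<longrightarrow> cmod (\<Sum>n. c n *\<^sub>R a (s n) t) \<le> B"
  shows "\<exists>N K. \<forall>s t. 0 < t \<longrightarrow> t \<le> 1 \<longrightarrow> cmod (a s t) \<le> K * (1 + \<bar>s\<bar>) ^ N"
proof (rule ccontr)
  assume neg: "\<not> ?thesis"
  \<comment> \<open>starting the exponents at \<open>R\<close> makes all suprema finite\<close>
  define q where "q n t s = cmod (a s t) / (1 + \<bar>s\<bar>) ^ (n + R)" for n t s
  define Q where "Q n t = (SUP s. q n t s)" for n t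
  have bdd_q: "bdd_above (range (q n t))" if t: "t > 0" for n t
  proof -
    obtain M where M: "\<And>s. cmod (a s t) \<le> M * (1 + \<bar>s\<bar>) ^ R" using away[OF t] by blast
    have "q n t s \<le> M" for s
    proof -
      have "0 \<le> M" using order_trans[OF norm_ge_zero M[of 0]] by simp
      then have "cmod (a s t) \<le> M * (1 + \<bar>s\<bar>) ^ (n + R)"
        using M[of s] by (smt (verit) mult_left_mono power_increasing le_add2)
      then show ?thesis by (simp add: q_def divide_le_eq)
    qed
    then show ?thesis by (intro bdd_aboveI[where M = M]) auto
  qed
  have q_le: "q n t s \<le> Q n t" if "t > 0" for n t s
    unfolding Q_def by (rule cSUP_upper[OF _ bdd_q[OF that]]) simp
  have "\<exists>t. 0 < t \<and> t \<le> 1 \<and> 4 ^ n < Q n t" for n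
  proof -
    obtain s t where st: "0 < t" "t \<le> 1" "4 ^ n * (1 + \<bar>s\<bar>) ^ (n + R) < cmod (a s t)"
      using neg by (metis not_le)
    then have "4 ^ n < q n t s" by (simp add: q_def less_divide_eq)
    with q_le[OF st(1), of n s] st show ?thesis by (intro exI[of _ t]) auto
  qed
  then obtain T where T: "\<And>n. 0 < T n" "\<And>n. T n \<le> 1" "\<And>n. 4 ^ n < Q n (T n)" by metis
  have Qpos: "0 < Q n (T n)" for n
    by (rule less_trans[OF _ T(3)[of n]]) simp
  have "\<exists>s. 3/4 * Q n (T n) < q n (T n) s" for n
  proof -
    have "3/4 * Q n (T n) < (SUP s. q n (T n) s)" using Qpos[of n] by (simp add: Q_def[symmetric])
    then show ?thesis by (subst (asm) less_cSUP_iff[OF _ bdd_q[OF T(1)]]) auto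
  qed
  then obtain s where s: "\<And>n. 3/4 * Q n (T n) < q n (T n) (s n)" by metis
  define d where "d n = (1/3) ^ n / (1 + \<bar>s n\<bar>) ^ (n + R)" for n
  have dpos: "0 < d n" for n by (simp add: d_def zero_less_divide_iff add_pos_nonneg)
  define sg :: "(real \<Rightarrow> complex) \<Rightarrow> nat \<Rightarrow> real" where
    "sg l n = (if cmod (l (T n) + d n *\<^sub>R a (s n) (T n)) \<ge> cmod (d n *\<^sub>R a (s n) (T n)) then 1 else -1)"
    for l n
  \<comment> \<open>\<open>L n\<close> is the partial sum before step \<open>n\<close>; it is built recursively because the \<open>n\<close>-th sign depends on it\<close>
  define L where "L = rec_nat (\<lambda>t. 0) (\<lambda>n l t. l t + (sg l n * d n) *\<^sub>R a (s n) t)"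
  define c where "c n = sg (L n) n * d n" for n
  have L_Suc: "L (Suc n) = (\<lambda>t. L n t + c n *\<^sub>R a (s n) t)" for n by (simp add: L_def c_def)
  have L: "L n t = (\<Sum>m<n. c m *\<^sub>R a (s m) t)" for n t
    by (induction n) (simp_all add: L_Suc, simp add: L_def)
  have abs_c: "\<bar>c n\<bar> = d n" for n using dpos[of n] by (simp add: c_def sg_def abs_mult)
  \<comment> \<open>one of \<open>x + y\<close> and \<open>x - y\<close> is at least as long as \<open>y\<close>; the sign picks it\<close>
  have sel: "d n * cmod (a (s n) (T n)) \<le> cmod (L (Suc n) (T n))" for n
  proof -
    define x y where "x = L n (T n)" and "y = d n *\<^sub>R a (s n) (T n)"
    have ny: "cmod y = d n * cmod (a (s n) (T n))" using dpos[of n] by (simp add: y_def)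
    show ?thesis
    proof (cases "cmod (x + y) \<ge> cmod y")
      case True
      then have "L (Suc n) (T n) = x + y"
        by (simp add: L_Suc c_def sg_def x_def y_def)
      then show ?thesis using True ny by simp
    next
      case False
      then have "L (Suc n) (T n) = x - y"
        by (simp add: L_Suc c_def sg_def x_def y_def)
      moreover have "2 * cmod y \<le> cmod (x + y) + cmod (x - y)"
        using norm_triangle_ineq4[of "x + y" "x - y"] by simp
      ultimately show ?thesis using False ny by simp
    qed
  qed
  have rapid: "summable (\<lambda>n. \<bar>c n\<bar> * (1 + \<bar>s n\<bar>) ^ m)" for m
  proof (rule summable_comparison_test'[where g = "\<lambda>n. (1/3) ^ n" and N = m])
    show "summable (\<lambda>n. (1/3 :: real) ^ n)" by (simp add: summable_geometric)
    fix n assume "m \<le> n"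
    then have "(1 + \<bar>s n\<bar>) ^ m \<le> (1 + \<bar>s n\<bar>) ^ (n + R)" by (intro power_increasing) auto
    then have "(1 + \<bar>s n\<bar>) ^ m / (1 + \<bar>s n\<bar>) ^ (n + R) \<le> 1" by (simp add: divide_le_eq)
    then have "(1/3) ^ n * ((1 + \<bar>s n\<bar>) ^ m / (1 + \<bar>s n\<bar>) ^ (n + R)) \<le> (1/3 :: real) ^ n * 1"
      by (intro mult_left_mono) auto
    then show "norm (\<bar>c n\<bar> * (1 + \<bar>s n\<bar>) ^ m) \<le> (1/3) ^ n"
      by (simp add: abs_c d_def)
  qed
  obtain B where B: "\<And>t. 0 < t \<Longrightarrow> t \<le> 1 \<Longrightarrow> cmod (\<Sum>n. c n *\<^sub>R a (s n) t) \<le> B"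
    using bdd[of c s] rapid by blast
  have le_B: "(4/3) ^ n / 4 \<le> B" for n
  proof -
    define u where "u m = c m *\<^sub>R a (s m) (T n)" for m
    have tail: "cmod (u m) \<le> (1/3) ^ m * Q n (T n)" if "n \<le> m" for m
    proof -
      have "cmod (a (s m) (T n)) \<le> Q n (T n) * (1 + \<bar>s m\<bar>) ^ (n + R)"
        using q_le[OF T(1), of n n "s m"] by (simp add: q_def divide_le_eq)
      also have "\<dots> \<le> Q n (T n) * (1 + \<bar>s m\<bar>) ^ (m + R)"
        using that Qpos[of n] by (intro mult_left_mono power_increasing) auto
      finally have "d m * cmod (a (s m) (T n)) \<le> d m * (Q n (T n) * (1 + \<bar>s m\<bar>) ^ (m + R))"
        using dpos[of m] by (intro mult_left_mono) auto
      moreover have "1 + \<bar>s m\<bar> \<noteq> 0" by linarith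
      ultimately show ?thesis by (simp add: u_def abs_c d_def)
    qed
    have geo: "(\<lambda>m. (1/3) ^ (m + Suc n) * Q n (T n)) sums ((1/3) ^ n / 2 * Q n (T n))"
    proof -
      have "(\<lambda>m. (1/3) ^ m * ((1/3) ^ Suc n * Q n (T n))) sums (1 / (1 - 1/3) * ((1/3) ^ Suc n * Q n (T n)))"
        by (intro sums_mult2 geometric_sums) simp
      then show ?thesis by (simp add: power_add mult_ac)
    qed
    have su: "summable (\<lambda>m. cmod (u (m + Suc n)))"
      by (rule summable_comparison_test'[OF sums_summable[OF geo], where N = 0]) (simp add: tail del: power_Suc add_Suc_right)
    have "cmod (\<Sum>m. u (m + Suc n)) \<le> (\<Sum>m. cmod (u (m + Suc n)))"
      by (rule summable_norm[OF su])
    also have "\<dots> \<le> (\<Sum>m. (1/3) ^ (m + Suc n) * Q n (T n))"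
      by (rule suminf_le[OF _ su sums_summable[OF geo]]) (simp add: tail del: power_Suc add_Suc_right)
    also have "\<dots> = (1/3) ^ n / 2 * Q n (T n)" using geo by (rule sums_unique[symmetric])
    finally have tl: "cmod (\<Sum>m. u (m + Suc n)) \<le> (1/3) ^ n / 2 * Q n (T n)" .
    have "summable u" using su by (simp only: summable_iff_shift[of "\<lambda>m. cmod (u m)"]) (rule summable_norm_cancel)
    then have "(\<Sum>m. u m) = (\<Sum>m. u (m + Suc n)) + L (Suc n) (T n)"
      using suminf_split_initial_segment[of u "Suc n"] by (simp add: L u_def[abs_def])
    then have "cmod (L (Suc n) (T n)) \<le> cmod (\<Sum>m. u m) + cmod (\<Sum>m. u (m + Suc n))"
      using norm_triangle_ineq4[of "\<Sum>m. u m" "\<Sum>m. u (m + Suc n)"] by simp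
    moreover have "cmod (\<Sum>m. u m) \<le> B" unfolding u_def using B T by blast
    moreover have "(1/3) ^ n * (3/4 * Q n (T n)) \<le> d n * cmod (a (s n) (T n))"
    proof -
      have "(1/3) ^ n * (3/4 * Q n (T n)) \<le> (1/3) ^ n * q n (T n) (s n)"
        using s[of n] by (intro mult_left_mono) auto
      then show ?thesis by (simp add: q_def d_def)
    qed
    ultimately have "(1/3) ^ n * Q n (T n) / 4 \<le> B" using sel[of n] tl by linarith
    moreover have "(1/3) ^ n * 4 ^ n / 4 \<le> (1/3) ^ n * Q n (T n) / 4"
      using T(3)[of n] by (intro divide_right_mono mult_left_mono) auto
    ultimately show ?thesis by (simp flip: power_mult_distrib)
  qed
  obtain n where "4 * B < (4/3) ^ n" using real_arch_pow[of "4/3" "4 * B"] by auto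
  with le_B[of n] show False by simp
qed

section \<open>Boundary means on the upper half-plane\<close>

definition cayley :: "complex \<Rightarrow> complex" where
  "cayley z = \<i> * (1 + z) / (1 - z)"

lemma Im_cayley: "Im (cayley z) = (1 - (cmod z)\<^sup>2) / (cmod (1 - z))\<^sup>2"
  by (simp add: cayley_def Im_divide cmod_power2) (simp add: power2_eq_square algebra_simps)

text \<open>The damping factor of the mean value argument below has its pole at \<open>1 + \<epsilon>\<close>, outside the closed disc.\<close>

lemma norm_one_minus_ge: "cmod z \<le> 1 \<Longrightarrow> 0 < \<epsilon> \<Longrightarrow> \<epsilon> \<le> cmod (1 + of_real \<epsilon> - z)"
  using complex_Re_le_cmod[of "1 + of_real \<epsilon> - z"] complex_Re_le_cmod[of z] by simp

lemma cayley_circle: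
  assumes "0 < \<theta>" "\<theta> < 1"
  shows "cayley (exp (2 * of_real pi * \<i> * of_real \<theta>)) = of_real (- cot (pi * \<theta>))"
proof -
  define z where "z = exp (2 * of_real pi * \<i> * of_real \<theta>)"
  \<comment> \<open>dividing numerator and denominator by the half-angle point \<open>w\<close> leaves a cosine over a sine\<close>
  define w where "w = exp (\<i> * of_real (pi * \<theta>))"
  have z: "z = w * w" by (simp add: z_def w_def flip: exp_add) (simp add: algebra_simps)
  have w: "w = Complex (cos (pi * \<theta>)) (sin (pi * \<theta>))"
    unfolding w_def by (metis cis_conv_exp cis.ctr)
  have s: "sin (pi * \<theta>) \<noteq> 0" using assms by (intro order.strict_implies_not_eq[symmetric] sin_gt_zero) auto
  have w1: "w * cnj w = 1" using w by (simp add: complex_eq_iff power2_eq_square[symmetric])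
  have "1 - z = w * (cnj w - w)" "1 + z = w * (cnj w + w)" using w1 by (simp_all add: z algebra_simps)
  moreover have "w \<noteq> 0" by (simp add: w_def)
  ultimately have "cayley z = \<i> * (cnj w + w) / (cnj w - w)" by (simp add: cayley_def)
  also have "cnj w + w = of_real (2 * cos (pi * \<theta>))" by (simp add: w complex_eq_iff)
  also have "cnj w - w = - \<i> * of_real (2 * sin (pi * \<theta>))" by (simp add: w complex_eq_iff)
  finally show ?thesis using s by (simp add: z_def cot_def field_simps)
qed

text \<open>
  The Cayley transform carries the disc to the half-plane, its centre to \<open>i\<close> and the circle point
  \<open>exp (2\<pi>i\<theta>)\<close> to \<open>- cot (\<pi>\<theta>)\<close>, so the claim is the mean value property at the centre of the disc.
  Two obstacles are removed first. The point \<open>z = 1\<close> corresponds to infinity, where \<open>F\<close> may grow: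
  the factor \<open>((1 - z) / (1 + \<epsilon> - z)) ^ (N + 1)\<close> vanishes there to sufficient order, has modulus at most one
  on the disc, and tends to one at the centre as \<open>\<epsilon> \<rightarrow> 0\<close>. Moreover \<open>F\<close> has boundary limits only along
  vertical lines: the half-plane is shifted upwards by \<open>t\<close>, which makes the transplanted function continuous on
  the closed disc, and dominated convergence takes care of \<open>t \<rightarrow> 0\<close>.
\<close>

lemma halfplane_boundary_mean_bound:
  fixes F :: "complex \<Rightarrow> complex" and F0 :: "real \<Rightarrow> complex"
  assumes hol: "F holomorphic_on {w. 0 < Im w}"
    and bound: "\<And>w. 0 < Im w \<Longrightarrow> cmod (F w) \<le> K * (1 + cmod w) ^ N"
    and lim: "\<And>s. ((\<lambda>t. F (Complex s t)) \<longlongrightarrow> F0 s) (at_right 0)"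
  shows "ennreal (cmod (F \<i>)) \<le> (\<integral>\<^sup>+\<theta>. ennreal (cmod (F0 (- cot (pi * \<theta>)))) * indicator {0<..<1} \<theta> \<partial>lborel)"
    (is "_ \<le> ?I")
proof -
  have contF: "isCont F w" if "0 < Im w" for w
    using holomorphic_on_imp_differentiable_at[OF hol open_halfspace_Im_gt, of w] that
    by (intro field_differentiable_imp_continuous_at) auto
  define e where "e \<theta> = exp (2 * of_real pi * \<i> * of_real \<theta>)" for \<theta> :: real
  have e1: "cmod (e \<theta>) = 1" for \<theta>
    using norm_exp_i_times[of "2 * pi * \<theta>"] by (simp add: e_def mult_ac)
  have e_ne: "e \<theta> \<noteq> 1" if "0 < \<theta>" "\<theta> < 1" for \<theta>
  proof
    assume "e \<theta> = 1"
    then obtain n :: int where "2 * pi * \<theta> = real_of_int (2 * n) * pi"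
      unfolding e_def exp_eq_1 by auto
    then have "\<theta> = of_int n" by simp
    with that show False by auto
  qed
  have K0: "0 \<le> K"
  proof -
    have "0 \<le> K * 2 ^ N" using order_trans[OF norm_ge_zero bound[of \<i>]] by simp
    then show ?thesis by (simp add: zero_le_mult_iff) (metis not_le zero_less_numeral zero_less_power)
  qed
  have step: "ennreal (cmod (F \<i>) * (1 / (1 + \<epsilon>)) ^ Suc N) \<le> ?I" if \<epsilon>: "0 < \<epsilon>" for \<epsilon> :: real
  proof -
    \<comment> \<open>\<open>E\<close> is the damping factor; \<open>D\<close> comes from \<open>1 + |cayley z + i t| \<le> 6 / |1 - z|\<close> in \<open>gb\<close>\<close>
    define E where "E z = ((1 - z) / (1 + of_real \<epsilon> - z)) ^ Suc N" for z :: complex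
    define D where "D = K * 6 ^ N / \<epsilon> ^ Suc N"
    have D0: "0 \<le> D" using K0 \<epsilon> by (simp add: D_def)
    have E1: "cmod (E z) \<le> 1" if "cmod z \<le> 1" for z
    proof -
      have "cmod (1 - z) \<le> cmod (1 + of_real \<epsilon> - z)"
      proof (rule power2_le_imp_le)
        have "Re z \<le> 1" using complex_Re_le_cmod[of z] that by simp
        then have "(1 - Re z)\<^sup>2 \<le> (1 + \<epsilon> - Re z)\<^sup>2" using \<epsilon> by (intro power_mono) auto
        then show "(cmod (1 - z))\<^sup>2 \<le> (cmod (1 + of_real \<epsilon> - z))\<^sup>2" by (simp add: cmod_power2)
      qed simp
      then have "cmod ((1 - z) / (1 + of_real \<epsilon> - z)) \<le> 1"
        using norm_one_minus_ge[OF that \<epsilon>] \<epsilon> by (simp add: norm_divide divide_le_eq)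
      then show ?thesis unfolding E_def norm_power by (rule power_le_one[rotated]) simp
    qed
    define g where "g t z = (if z = 1 then 0 else F (cayley z + \<i> * of_real t) * E z)" for t :: real and z
    have Im_pos: "0 < Im (cayley z + \<i> * of_real t)" if "cmod z \<le> 1" "0 < t" for z t
    proof -
      have "0 \<le> Im (cayley z)" using that by (simp add: Im_cayley power_le_one)
      with that show ?thesis by simp
    qed
    have gb: "cmod (g t z) \<le> D * cmod (1 - z)" if z: "cmod z \<le> 1" and t: "0 < t" "t \<le> 1" for t z
    proof (cases "z = 1")
      case False
      define r where "r = cmod (1 - z)"
      have r: "0 < r" "r \<le> 2" using False z norm_triangle_ineq4[of 1 z] by (auto simp: r_def)
      have "cmod (1 + z) \<le> 2" using norm_triangle_ineq[of 1 z] z by simp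
      then have "cmod (cayley z) \<le> 2 / r"
        using r by (simp add: cayley_def norm_divide norm_mult r_def[symmetric] divide_right_mono)
      then have "1 + cmod (cayley z + \<i> * of_real t) \<le> 2 + 2 / r"
        using t norm_triangle_ineq[of "cayley z" "\<i> * of_real t"] by (simp add: norm_mult)
      also have "\<dots> \<le> 6 / r" using r by (simp add: field_simps)
      finally have w: "1 + cmod (cayley z + \<i> * of_real t) \<le> 6 / r" .
      have "cmod (F (cayley z + \<i> * of_real t)) \<le> K * (6 / r) ^ N"
        by (rule order_trans[OF bound[OF Im_pos[OF z t(1)]]]) (intro mult_left_mono power_mono w K0, simp)
      moreover have "cmod (E z) \<le> (r / \<epsilon>) ^ Suc N"
        unfolding E_def norm_power norm_divide r_def[symmetric]
        using norm_one_minus_ge[OF z \<epsilon>] r \<epsilon>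
        by (intro power_mono divide_left_mono mult_pos_pos) auto
      ultimately have "cmod (g t z) \<le> (K * (6 / r) ^ N) * (r / \<epsilon>) ^ Suc N"
        using False K0 r unfolding g_def by (simp add: norm_mult del: power_Suc) (intro mult_mono, auto)
      also have "\<dots> = D * r" using r by (simp add: D_def power_divide)
      finally show ?thesis by (simp add: r_def)
    qed (use D0 in \<open>simp add: g_def\<close>)
    have gball: "g t holomorphic_on ball 0 1" if t: "0 < t" for t
    proof (rule holomorphic_transform)
      have ne: "1 - z \<noteq> 0" "1 + of_real \<epsilon> - z \<noteq> 0" if "z \<in> ball 0 1" for z :: complex
        using that norm_one_minus_ge[of z \<epsilon>] \<epsilon> by auto
      have "(\<lambda>z. cayley z + \<i> * of_real t) holomorphic_on ball 0 1"
        unfolding cayley_def using ne by (intro holomorphic_intros) auto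
      then have "(F \<circ> (\<lambda>z. cayley z + \<i> * of_real t)) holomorphic_on ball 0 1"
        by (rule holomorphic_on_compose_gen[OF _ hol]) (use Im_pos[OF _ t] in auto)
      then show "(\<lambda>z. F (cayley z + \<i> * of_real t) * E z) holomorphic_on ball 0 1"
        unfolding E_def comp_def using ne by (intro holomorphic_intros) auto
    qed (auto simp: g_def)
    have gcont: "continuous_on (cball 0 1) (g t)" if t: "0 < t" "t \<le> 1" for t
      unfolding continuous_on_eq_continuous_within
    proof
      fix z :: complex assume z: "z \<in> cball 0 1"
      show "continuous (at z within cball 0 1) (g t)"
      proof (cases "z = 1")
        case True
        have "((\<lambda>z. D * cmod (1 - z)) \<longlongrightarrow> D * cmod (1 - 1)) (at 1 within cball 0 1)"
          by (intro tendsto_intros)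
        then have "((\<lambda>z. D * cmod (1 - z)) \<longlongrightarrow> 0) (at 1 within cball 0 1)" by simp
        then have "(g t \<longlongrightarrow> 0) (at 1 within cball 0 1)"
          by (rule Lim_null_comparison[rotated]) (auto simp: eventually_at_topological intro!: exI[of _ UNIV] gb t)
        then show ?thesis using True by (simp add: continuous_within g_def[of t 1])
      next
        case False
        have "isCont (\<lambda>z. F (cayley z + \<i> * of_real t) * E z) z"
        proof -
          have F: "isCont F (cayley z + \<i> * of_real t)"
            using Im_pos[OF _ t(1), of z] z by (intro contF) auto
          have "isCont (\<lambda>z. cayley z + \<i> * of_real t) z"
            unfolding cayley_def using False by (intro continuous_intros) auto
          from isCont_o2[OF this F] have "isCont (\<lambda>z. F (cayley z + \<i> * of_real t)) z" .
          moreover have "isCont E z"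
            unfolding E_def using norm_one_minus_ge[of z \<epsilon>] z \<epsilon> by (intro continuous_intros) auto
          ultimately show ?thesis by (intro continuous_intros)
        qed
        moreover have "eventually (\<lambda>z. F (cayley z + \<i> * of_real t) * E z = g t z) (nhds z)"
          using t1_space_nhds[OF False] by eventually_elim (simp add: g_def)
        ultimately have "isCont (g t) z" by (simp add: isCont_cong)
        then show ?thesis by (rule continuous_at_imp_continuous_at_within)
      qed
    qed
    have mean: "((\<lambda>\<theta>. g t (e \<theta>)) has_integral g t 0) {0..1}" if t: "0 < t" "t \<le> 1" for t
    proof -
      have "((\<lambda>u. g t u / (u - 0)) has_contour_integral (2 * of_real pi * \<i> * g t 0)) (circlepath 0 1)"
        by (rule Cauchy_integral_circlepath[OF gcont[OF t] gball[OF t(1)]]) simp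
      then have "((\<lambda>\<theta>. (2 * of_real pi * \<i>) * g t (e \<theta>)) has_integral (2 * of_real pi * \<i> * g t 0)) {0..1}"
        unfolding has_contour_integral_def
      proof (rule has_integral_eq[rotated])
        fix \<theta> :: real assume "\<theta> \<in> {0..1}"
        then have vd: "vector_derivative (circlepath 0 1) (at \<theta> within {0..1}) = 2 * of_real pi * \<i> * e \<theta>"
          using vector_derivative_circlepath01[of \<theta> 0 1] by (simp add: e_def)
        have circ: "circlepath 0 1 \<theta> = e \<theta>" by (simp add: circlepath e_def)
        have "e \<theta> \<noteq> 0" by (simp add: e_def)
        then show "g t (circlepath 0 1 \<theta>) / (circlepath 0 1 \<theta> - 0)
            * vector_derivative (circlepath 0 1) (at \<theta> within {0..1})
          = (2 * of_real pi * \<i>) * g t (e \<theta>)"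
          unfolding vd circ by simp
      qed
      from has_integral_mult_right[OF this, of "inverse (2 * of_real pi * \<i>)"]
      show ?thesis by (simp add: field_simps)
    qed
    define T where "T n = 1 / (real n + 2)" for n
    define u where "u n \<theta> = indicator {0<..<1} \<theta> *\<^sub>R g (T n) (e \<theta>)" for n \<theta>
    define v where "v \<theta> = indicator {0<..<1} \<theta> *\<^sub>R (F0 (- cot (pi * \<theta>)) * E (e \<theta>))" for \<theta>
    have T: "0 < T n" "T n \<le> 1" for n by (simp_all add: T_def field_simps)
    have T0: "filterlim T (at_right 0) sequentially"
      unfolding filterlim_at
    proof (rule conjI[rotated])
      show "T \<longlonglongrightarrow> 0" unfolding T_def by real_asymp
      have "T n \<noteq> 0" for n using T(1)[of n] by simp
      then show "\<forall>\<^sub>F n in sequentially. T n \<in> {0<..} \<and> T n \<noteq> 0" using T(1) by auto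
    qed
    have cont_ge: "continuous_on {0..1} (\<lambda>\<theta>. g (T n) (e \<theta>))" for n
      by (rule continuous_on_compose2[OF gcont[OF T]]) (auto simp: e1 e_def intro!: continuous_intros)
    have u: "u n \<in> borel_measurable lborel" "(\<integral>\<theta>. u n \<theta> \<partial>lborel) = g (T n) 0" for n
    proof -
      have i: "set_integrable lborel {0..1} (\<lambda>\<theta>. g (T n) (e \<theta>))"
        by (rule borel_integrable_atLeastAtMost'[OF cont_ge])
      have "AE \<theta> in lborel. indicator {0..1} \<theta> *\<^sub>R g (T n) (e \<theta>) = u n \<theta>"
        using AE_lborel_singleton[of 0] AE_lborel_singleton[of 1]
        by eventually_elim (auto simp: u_def indicator_def)
      moreover have m: "(\<lambda>\<theta>. indicator {0..1} \<theta> *\<^sub>R g (T n) (e \<theta>)) \<in> borel_measurable lborel"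
        using i unfolding set_integrable_def by (rule borel_measurable_integrable)
      moreover show um: "u n \<in> borel_measurable lborel"
      proof -
        have "(\<lambda>\<theta>. indicator {0<..<1} \<theta> *\<^sub>R (indicator {0..1} \<theta> *\<^sub>R g (T n) (e \<theta>))) \<in> borel_measurable lborel"
          using m by measurable
        moreover have "(\<lambda>\<theta>. indicator {0<..<1} \<theta> *\<^sub>R (indicator {0..1} \<theta> *\<^sub>R g (T n) (e \<theta>))) = u n"
          by (auto simp: u_def indicator_def fun_eq_iff)
        ultimately show ?thesis by simp
      qed
      ultimately have "(\<integral>\<theta>. u n \<theta> \<partial>lborel) = (\<integral>\<theta>. indicator {0..1} \<theta> *\<^sub>R g (T n) (e \<theta>) \<partial>lborel)"
        by (intro integral_cong_AE) auto
      also have "\<dots> = integral {0..1} (\<lambda>\<theta>. g (T n) (e \<theta>))"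
        using set_borel_integral_eq_integral(2)[OF i] by (simp add: set_lebesgue_integral_def)
      also have "\<dots> = g (T n) 0" using mean[OF T] by (rule integral_unique)
      finally show "(\<integral>\<theta>. u n \<theta> \<partial>lborel) = g (T n) 0" .
    qed
    have uv: "(\<lambda>n. u n \<theta>) \<longlonglongrightarrow> v \<theta>" for \<theta>
    proof (cases "0 < \<theta> \<and> \<theta> < 1")
      case True
      have c: "cayley (e \<theta>) + \<i> * of_real t = Complex (- cot (pi * \<theta>)) t" for t
        using cayley_circle[of \<theta>] True by (simp add: e_def complex_eq_iff)
      have "(\<lambda>n. F (Complex (- cot (pi * \<theta>)) (T n))) \<longlonglongrightarrow> F0 (- cot (pi * \<theta>))"
        by (rule filterlim_compose[OF lim T0])
      then have "(\<lambda>n. F (Complex (- cot (pi * \<theta>)) (T n)) * E (e \<theta>)) \<longlonglongrightarrow> F0 (- cot (pi * \<theta>)) * E (e \<theta>)"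
        by (intro tendsto_intros)
      then show ?thesis using True e_ne[of \<theta>] by (simp add: u_def v_def g_def c)
    qed (auto simp: u_def v_def)
    have vm: "v \<in> borel_measurable lborel"
      by (rule borel_measurable_LIMSEQ_metric[OF u(1)]) (rule uv)
    have "(\<lambda>n. (\<integral>\<theta>. u n \<theta> \<partial>lborel)) \<longlonglongrightarrow> (\<integral>\<theta>. v \<theta> \<partial>lborel)" and iv: "integrable lborel v"
    proof -
      have w: "integrable lborel (\<lambda>\<theta>::real. indicator {0<..<1} \<theta> *\<^sub>R (D * 2))" by simp
      have b: "AE \<theta> in lborel. norm (u n \<theta>) \<le> indicator {0<..<1} \<theta> *\<^sub>R (D * 2)" for n
      proof (rule AE_I2)
        fix \<theta>
        have "cmod (g (T n) (e \<theta>)) \<le> D * cmod (1 - e \<theta>)" by (rule gb) (simp_all add: e1 T)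
        also have "\<dots> \<le> D * 2" using norm_triangle_ineq4[of 1 "e \<theta>"] D0 by (intro mult_left_mono) (simp_all add: e1)
        finally show "norm (u n \<theta>) \<le> indicator {0<..<1} \<theta> *\<^sub>R (D * 2)"
          by (simp add: u_def indicator_def)
      qed
      show "(\<lambda>n. (\<integral>\<theta>. u n \<theta> \<partial>lborel)) \<longlonglongrightarrow> (\<integral>\<theta>. v \<theta> \<partial>lborel)"
        by (rule integral_dominated_convergence[where s = u, OF vm u(1) w _ b]) (simp add: uv)
      show "integrable lborel v"
        by (rule integrable_dominated_convergence[where s = u, OF vm u(1) w _ b]) (simp add: uv)
    qed
    then have "(\<lambda>n. g (T n) 0) \<longlonglongrightarrow> (\<integral>\<theta>. v \<theta> \<partial>lborel)" by (simp add: u)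
    moreover have "(\<lambda>n. g (T n) 0) \<longlonglongrightarrow> F \<i> * E 0"
    proof -
      have "isCont F \<i>" by (rule contF) simp
      moreover have "(\<lambda>n. \<i> + \<i> * of_real (T n)) \<longlonglongrightarrow> \<i> + \<i> * of_real 0"
        using T0 by (intro tendsto_intros) (simp add: filterlim_at)
      ultimately have "(\<lambda>n. F (\<i> + \<i> * of_real (T n))) \<longlonglongrightarrow> F \<i>"
        using isCont_tendsto_compose by fastforce
      then show ?thesis by (simp add: g_def cayley_def tendsto_mult_right)
    qed
    ultimately have "F \<i> * E 0 = (\<integral>\<theta>. v \<theta> \<partial>lborel)" by (rule LIMSEQ_unique[rotated])
    then have "ennreal (cmod (F \<i> * E 0)) \<le> (\<integral>\<^sup>+\<theta>. ennreal (norm (v \<theta>)) \<partial>lborel)"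
      using integral_norm_bound_ennreal[OF iv] by simp
    also have "\<dots> \<le> ?I"
    proof (rule nn_integral_mono)
      fix \<theta>
      have "cmod (F0 (- cot (pi * \<theta>)) * E (e \<theta>)) \<le> cmod (F0 (- cot (pi * \<theta>))) * 1"
        unfolding norm_mult by (intro mult_left_mono E1) (simp_all add: e1)
      then show "ennreal (norm (v \<theta>)) \<le> ennreal (cmod (F0 (- cot (pi * \<theta>)))) * indicator {0<..<1} \<theta>"
        by (simp add: v_def indicator_def ennreal_leI)
    qed
    also have "cmod (F \<i> * E 0) = cmod (F \<i>) * (1 / (1 + \<epsilon>)) ^ Suc N"
    proof -
      have "E 0 = of_real ((1 / (1 + \<epsilon>)) ^ Suc N)" by (simp add: E_def)
      then have "cmod (E 0) = (1 / (1 + \<epsilon>)) ^ Suc N" using \<epsilon> by (simp only: norm_of_real) simp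
      then show ?thesis by (simp add: norm_mult)
    qed
    finally show ?thesis .
  qed
  have "((\<lambda>\<epsilon>. ennreal (cmod (F \<i>) * (1 / (1 + \<epsilon>)) ^ Suc N)) \<longlongrightarrow> ennreal (cmod (F \<i>) * (1 / (1 + 0)) ^ Suc N)) (at_right 0)"
    by (intro tendsto_intros tendsto_ennrealI) auto
  then have "((\<lambda>\<epsilon>. ennreal (cmod (F \<i>) * (1 / (1 + \<epsilon>)) ^ Suc N)) \<longlongrightarrow> ennreal (cmod (F \<i>))) (at_right 0)"
    by simp
  then show ?thesis
    by (rule tendsto_upperbound) (rule eventually_mono[OF eventually_at_right_less[of 0] step], simp_all)
qed

section \<open>Smearing a family of analytic functions\<close>

text \<open>
  \<open>A x t\<close> stands for a scalar component of \<open>f(x + i t d)\<close>. Analyticity is required only in the complex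
  direction \<open>d\<close>, and the growth bound may deteriorate in an arbitrary way as \<open>t \<rightarrow> 0\<close>.
\<close>

locale boundary_family =
  fixes A :: "real ^ 'n \<Rightarrow> real \<Rightarrow> complex" and d :: "real ^ 'n" and R :: nat
    and H :: "real ^ 'n \<Rightarrow> complex"
  assumes hol: "\<And>x. (\<lambda>w. A (x + Re w *\<^sub>R d) (Im w)) holomorphic_on {w. 0 < Im w}"
    and cont: "\<And>t. 0 < t \<Longrightarrow> continuous_on UNIV (\<lambda>x. A x t)"
    and growth: "\<And>\<tau>. 0 < \<tau> \<Longrightarrow> \<exists>M\<ge>0. \<forall>x t. \<tau> \<le> t \<longrightarrow> cmod (A x t) \<le> M * (1 + norm x) ^ R"
    and bv: "\<And>\<phi>. \<phi> \<in> schwartz_space \<Longrightarrow>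
      ((\<lambda>t. \<integral>x. \<phi> x * A x t \<partial>lborel) \<longlongrightarrow> (\<integral>x. \<phi> x * H x \<partial>lebesgue)) (at_right 0)"
begin

definition smear :: "(real ^ 'n \<Rightarrow> complex) \<Rightarrow> complex \<Rightarrow> complex" where
  "smear \<phi> w = (\<integral>x. \<phi> x * A (x + Re w *\<^sub>R d) (Im w) \<partial>lborel)"

lemma shift_growth:
  assumes "0 < \<tau>"
  obtains M where "0 \<le> M" "\<And>x s t. \<tau> \<le> t \<Longrightarrow>
    cmod (A (x + s *\<^sub>R d) t) \<le> M * (1 + \<bar>s\<bar>) ^ R * (1 + norm x) ^ R"
proof -
  obtain M where M: "0 \<le> M" "\<And>x t. \<tau> \<le> t \<Longrightarrow> cmod (A x t) \<le> M * (1 + norm x) ^ R"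
    using growth[OF assms] by blast
  show ?thesis
  proof (rule that[of "M * (1 + norm d) ^ R"])
    fix x s t assume t: "\<tau> \<le> t"
    have "1 + norm (x + s *\<^sub>R d) \<le> 1 + norm x + \<bar>s\<bar> * norm d"
      using norm_triangle_ineq[of x "s *\<^sub>R d"] by simp
    also have "\<dots> \<le> (1 + norm x) * (1 + \<bar>s\<bar> * norm d)"
      using mult_nonneg_nonneg[OF norm_ge_zero[of x] mult_nonneg_nonneg[OF abs_ge_zero[of s] norm_ge_zero[of d]]]
      unfolding distrib_left distrib_right by linarith
    also have "\<dots> \<le> (1 + norm x) * ((1 + norm d) * (1 + \<bar>s\<bar>))"
      by (intro mult_left_mono) (auto simp: algebra_simps)
    finally have "(1 + norm (x + s *\<^sub>R d)) ^ R \<le> ((1 + norm x) * ((1 + norm d) * (1 + \<bar>s\<bar>))) ^ R"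
      by (intro power_mono) auto
    then have "M * (1 + norm (x + s *\<^sub>R d)) ^ R \<le> M * ((1 + norm x) * ((1 + norm d) * (1 + \<bar>s\<bar>))) ^ R"
      using M(1) by (rule mult_left_mono)
    with M(2)[OF t, of "x + s *\<^sub>R d"]
    show "cmod (A (x + s *\<^sub>R d) t) \<le> M * (1 + norm d) ^ R * (1 + \<bar>s\<bar>) ^ R * (1 + norm x) ^ R"
      by (simp add: power_mult_distrib mult_ac)
  qed (use M in simp)
qed

lemma integrable_moment:
  fixes \<phi> :: "real ^ 'n \<Rightarrow> complex"
  assumes "\<phi> \<in> schwartz_space"
  shows "integrable lborel (\<lambda>x. (1 + norm x) ^ R * cmod (\<phi> x))"
proof (rule integrableI_bounded)
  have [measurable]: "\<phi> \<in> borel_measurable borel"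
    by (rule borel_measurable_continuous_onI[OF schwartz_continuous[OF assms]])
  show "(\<lambda>x. (1 + norm x) ^ R * cmod (\<phi> x)) \<in> borel_measurable lborel" by measurable
  show "(\<integral>\<^sup>+x. ennreal (norm ((1 + norm x) ^ R * cmod (\<phi> x))) \<partial>lborel) < \<infinity>"
    using schwartz_moment_finite[OF assms, of R] by simp
qed

lemma measurable_integrand:
  assumes "\<phi> \<in> schwartz_space" "0 < t"
  shows "(\<lambda>x. \<phi> x * A (x + s *\<^sub>R d) t) \<in> borel_measurable lborel"
proof -
  have "continuous_on UNIV (\<lambda>x. \<phi> x * A (x + s *\<^sub>R d) t)"
    by (intro continuous_intros schwartz_continuous assms continuous_on_compose2[OF cont]) auto
  then show ?thesis by (simp add: borel_measurable_continuous_onI)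
qed

lemma integrand_le:
  assumes M: "cmod a \<le> L * (1 + norm x) ^ R"
  shows "cmod (\<phi> x * a) \<le> L * ((1 + norm x) ^ R * cmod (\<phi> x))"
proof -
  have "cmod (\<phi> x * a) \<le> cmod (\<phi> x) * (L * (1 + norm x) ^ R)"
    unfolding norm_mult by (intro mult_left_mono M) auto
  then show ?thesis by (simp add: mult_ac)
qed

lemma integrable_integrand:
  assumes \<phi>: "\<phi> \<in> schwartz_space" and t: "0 < t"
  shows "integrable lborel (\<lambda>x. \<phi> x * A (x + s *\<^sub>R d) t)"
proof -
  obtain M where M: "0 \<le> M" "\<And>x s t'. t \<le> t' \<Longrightarrow>
      cmod (A (x + s *\<^sub>R d) t') \<le> M * (1 + \<bar>s\<bar>) ^ R * (1 + norm x) ^ R"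
    using shift_growth[OF t] by blast
  show ?thesis
  proof (rule Bochner_Integration.integrable_bound)
    show "integrable lborel (\<lambda>x. M * (1 + \<bar>s\<bar>) ^ R * ((1 + norm x) ^ R * cmod (\<phi> x)))"
      by (intro integrable_mult_right integrable_moment \<phi>)
    show "AE x in lborel. norm (\<phi> x * A (x + s *\<^sub>R d) t)
        \<le> norm (M * (1 + \<bar>s\<bar>) ^ R * ((1 + norm x) ^ R * cmod (\<phi> x)))"
      using integrand_le[OF M(2)[OF order_refl]] M(1) by (intro AE_I2) (simp add: abs_mult)
  qed (rule measurable_integrand[OF \<phi> t])
qed

text \<open>
  Moving the translation to the test function turns boundary convergence of \<open>smear \<phi>\<close> at the real point
  \<open>s\<close> into the convergence \<open>bv\<close> for a translated test function.
\<close>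

lemma smear_translate:
  assumes \<phi>: "\<phi> \<in> schwartz_space" and t: "0 < t"
  shows "smear \<phi> (Complex s t) = (\<integral>x. \<phi> (x - s *\<^sub>R d) * A x t \<partial>lborel)"
proof -
  have m: "(\<lambda>x. \<phi> (x - s *\<^sub>R d) * A x t) \<in> borel_measurable borel"
    using measurable_integrand[OF schwartz_translate[OF \<phi>, of "s *\<^sub>R d"] t, of 0] by simp
  have "(\<integral>x. \<phi> (x - s *\<^sub>R d) * A x t \<partial>lborel)
      = (\<integral>x. \<phi> (x - s *\<^sub>R d) * A x t \<partial>(distr lborel borel ((+) (s *\<^sub>R d))))"
    by (simp only: lborel_distr_plus)
  also have "\<dots> = (\<integral>x. \<phi> (s *\<^sub>R d + x - s *\<^sub>R d) * A (s *\<^sub>R d + x) t \<partial>lborel)"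
    by (rule integral_distr[OF _ m]) measurable
  finally show ?thesis by (simp add: smear_def add.commute)
qed

lemma smear_growth:
  assumes \<phi>: "\<phi> \<in> schwartz_space" and \<tau>: "0 < \<tau>"
  shows "\<exists>M\<ge>0. \<forall>s t. \<tau> \<le> t \<longrightarrow> cmod (smear \<phi> (Complex s t)) \<le> M * (1 + \<bar>s\<bar>) ^ R"
proof -
  obtain M where M: "0 \<le> M" "\<And>x s t. \<tau> \<le> t \<Longrightarrow>
      cmod (A (x + s *\<^sub>R d) t) \<le> M * (1 + \<bar>s\<bar>) ^ R * (1 + norm x) ^ R"
    using shift_growth[OF \<tau>] by blast
  define J where "J = (\<integral>x. (1 + norm x) ^ R * cmod (\<phi> x) \<partial>lborel)"
  have J: "0 \<le> J" unfolding J_def by (intro integral_nonneg_AE AE_I2) simp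
  have "cmod (smear \<phi> (Complex s t)) \<le> M * J * (1 + \<bar>s\<bar>) ^ R" if "\<tau> \<le> t" for s t
  proof -
    have "cmod (smear \<phi> (Complex s t)) \<le> (\<integral>x. M * (1 + \<bar>s\<bar>) ^ R * ((1 + norm x) ^ R * cmod (\<phi> x)) \<partial>lborel)"
      unfolding smear_def complex.sel
    proof (rule Bochner_Integration.integral_norm_bound_integral)
      show "integrable lborel (\<lambda>x. \<phi> x * A (x + s *\<^sub>R d) t)"
        using \<tau> that by (intro integrable_integrand \<phi>) simp
      show "integrable lborel (\<lambda>x. M * (1 + \<bar>s\<bar>) ^ R * ((1 + norm x) ^ R * cmod (\<phi> x)))"
        by (intro integrable_mult_right integrable_moment \<phi>)
    qed (rule integrand_le[OF M(2)[OF that]])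
    also have "\<dots> = M * (1 + \<bar>s\<bar>) ^ R * J" unfolding J_def by (rule integral_mult_right_zero)
    finally show ?thesis by (simp only: mult_ac)
  qed
  then show ?thesis using M(1) J by (intro exI[of _ "M * J"]) auto
qed

lemma smear_boundary:
  assumes "\<phi> \<in> schwartz_space"
  shows "((\<lambda>t. smear \<phi> (Complex s t)) \<longlongrightarrow> (\<integral>x. \<phi> (x - s *\<^sub>R d) * H x \<partial>lebesgue)) (at_right 0)"
proof (rule Lim_transform_eventually)
  show "((\<lambda>t. \<integral>x. \<phi> (x - s *\<^sub>R d) * A x t \<partial>lborel) \<longlongrightarrow> (\<integral>x. \<phi> (x - s *\<^sub>R d) * H x \<partial>lebesgue)) (at_right 0)"
    by (rule bv[OF schwartz_translate[OF assms]])
  show "\<forall>\<^sub>F t in at_right 0. (\<integral>x. \<phi> (x - s *\<^sub>R d) * A x t \<partial>lborel) = smear \<phi> (Complex s t)"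
    using eventually_at_right_less[of "0::real"]
    by eventually_elim (simp add: smear_translate[OF assms])
qed

lemma smear_series:
  assumes \<phi>: "\<phi> \<in> schwartz_space" and t: "0 < t"
    and rapid: "\<And>m. summable (\<lambda>n. \<bar>c n\<bar> * (1 + \<bar>s n\<bar>) ^ m)"
  shows "(\<integral>x. (\<Sum>n. c n *\<^sub>R \<phi> (x - s n *\<^sub>R d)) * A x t \<partial>lborel)
    = (\<Sum>n. c n *\<^sub>R smear \<phi> (Complex (s n) t))"
proof -
  define f where "f n x = c n *\<^sub>R (\<phi> (x - s n *\<^sub>R d) * A x t)" for n x
  have int0: "integrable lborel (\<lambda>x. \<phi> (x - s n *\<^sub>R d) * A x t)" for n
    using integrable_integrand[OF schwartz_translate[OF \<phi>, of "s n *\<^sub>R d"] t, of 0] by simp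
  have int: "integrable lborel (f n)" for n unfolding f_def by (intro integrable_scaleR_right int0)
  obtain M where M: "0 \<le> M" "\<And>x s t'. t \<le> t' \<Longrightarrow>
      cmod (A (x + s *\<^sub>R d) t') \<le> M * (1 + \<bar>s\<bar>) ^ R * (1 + norm x) ^ R"
    using shift_growth[OF t] by blast
  obtain B where B: "\<And>x. (1 + norm x) ^ 0 * cmod (foldr partial_derivative [] \<phi> x) \<le> B"
    using schwartz_bound[OF \<phi>, of 0 "[]"] by blast
  have B': "cmod (\<phi> x) \<le> B" for x using B[of x] by simp
  define J where "J = (\<integral>x. (1 + norm x) ^ R * cmod (\<phi> x) \<partial>lborel)"
  have sc: "summable (\<lambda>n. \<bar>c n\<bar>)" using rapid[of 0] by simp
  have sn: "summable (\<lambda>n. norm (c n *\<^sub>R \<phi> (x - s n *\<^sub>R d)))" for x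
    by (rule summable_comparison_test'[where N = 0, OF summable_mult[OF sc, of B]])
       (use mult_left_mono[OF B' abs_ge_zero] in \<open>simp add: mult.commute[of B]\<close>)
  have nf: "norm (f n x) = norm (c n *\<^sub>R \<phi> (x - s n *\<^sub>R d)) * cmod (A x t)" for n x
    by (simp add: f_def norm_mult)
  have "(\<integral>x. (\<Sum>n. f n x) \<partial>lborel) = (\<Sum>n. (\<integral>x. f n x \<partial>lborel))"
  proof (rule integral_suminf[OF int])
    show "AE x in lborel. summable (\<lambda>n. norm (f n x))"
      unfolding nf using sn by (intro AE_I2 summable_mult2)
    have tr: "(\<integral>x. norm (f n x) \<partial>lborel) \<le> M * J * (\<bar>c n\<bar> * (1 + \<bar>s n\<bar>) ^ R)" for n
    proof -
      have "(\<integral>x. norm (f n x) \<partial>lborel) = (\<integral>x. norm (f n x) \<partial>(distr lborel borel ((+) (s n *\<^sub>R d))))"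
        by (simp only: lborel_distr_plus)
      also have "\<dots> = (\<integral>x. norm (f n (s n *\<^sub>R d + x)) \<partial>lborel)"
        using borel_measurable_integrable[OF int[of n]] by (intro integral_distr) auto
      also have "\<dots> = (\<integral>x. \<bar>c n\<bar> * cmod (\<phi> x * A (x + s n *\<^sub>R d) t) \<partial>lborel)"
        by (simp add: f_def add.commute)
      also have "\<dots> \<le> (\<integral>x. \<bar>c n\<bar> * (M * (1 + \<bar>s n\<bar>) ^ R * ((1 + norm x) ^ R * cmod (\<phi> x))) \<partial>lborel)"
        by (intro integral_mono integrable_mult_right integrable_norm integrable_integrand \<phi> t
            integrable_moment mult_left_mono integrand_le M(2)) auto
      also have "\<dots> = (\<integral>x. (\<bar>c n\<bar> * (M * (1 + \<bar>s n\<bar>) ^ R)) * ((1 + norm x) ^ R * cmod (\<phi> x)) \<partial>lborel)"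
        by (simp only: mult.assoc)
      also have "\<dots> = (\<bar>c n\<bar> * (M * (1 + \<bar>s n\<bar>) ^ R)) * J"
        unfolding J_def by (rule integral_mult_right_zero)
      finally show ?thesis by (simp only: mult_ac)
    qed
    show "summable (\<lambda>n. \<integral>x. norm (f n x) \<partial>lborel)"
      by (rule summable_comparison_test'[where N = 0, OF summable_mult[OF rapid, of "M * J" R]])
         (use tr in \<open>simp add: integral_nonneg_AE\<close>)
  qed
  moreover have "(\<Sum>n. f n x) = (\<Sum>n. c n *\<^sub>R \<phi> (x - s n *\<^sub>R d)) * A x t" for x
    unfolding f_def using suminf_mult2[OF summable_norm_cancel[OF sn[of x]], of "A x t"] by simp
  ultimately show ?thesis using int0 by (simp add: f_def smear_translate[OF \<phi> t])
qed

text \<open>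
  For each rapidly convergent series of translates the hypothesis \<open>bv\<close> bounds the pairing near
  \<open>t = 0\<close>, while \<open>growth\<close> bounds it at the remaining heights; \<open>gliding_hump\<close> makes this uniform.
\<close>

lemma smear_polynomial_bound:
  assumes \<phi>: "\<phi> \<in> schwartz_space"
  shows "\<exists>N K. \<forall>w. 0 < Im w \<longrightarrow> cmod (smear \<phi> w) \<le> K * (1 + cmod w) ^ N"
proof -
  have "\<exists>N K. \<forall>s t. 0 < t \<longrightarrow> t \<le> 1 \<longrightarrow> cmod (smear \<phi> (Complex s t)) \<le> K * (1 + \<bar>s\<bar>) ^ N"
  proof (rule gliding_hump)
    show "\<exists>M. \<forall>s t. \<tau> \<le> t \<longrightarrow> cmod (smear \<phi> (Complex s t)) \<le> M * (1 + \<bar>s\<bar>) ^ R" if "0 < \<tau>" for \<tau>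
      using smear_growth[OF \<phi> that] by blast
    fix c s :: "nat \<Rightarrow> real" assume rapid: "\<And>m. summable (\<lambda>n. \<bar>c n\<bar> * (1 + \<bar>s n\<bar>) ^ m)"
    define \<psi> where "\<psi> = (\<lambda>x. \<Sum>n. c n *\<^sub>R \<phi> (x - s n *\<^sub>R d))"
    have \<psi>: "\<psi> \<in> schwartz_space"
      unfolding \<psi>_def
    proof (rule schwartz_translate_series[OF \<phi>])
      fix m
      show "summable (\<lambda>n. \<bar>c n\<bar> * (1 + norm (s n *\<^sub>R d)) ^ m)"
      proof (rule summable_comparison_test'[where N = 0])
        show "summable (\<lambda>n. (1 + norm d) ^ m * (\<bar>c n\<bar> * (1 + \<bar>s n\<bar>) ^ m))"
          by (intro summable_mult rapid)
        fix n
        have "1 + norm (s n *\<^sub>R d) \<le> (1 + norm d) * (1 + \<bar>s n\<bar>)" by (auto simp: algebra_simps)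
        then have "(1 + norm (s n *\<^sub>R d)) ^ m \<le> ((1 + norm d) * (1 + \<bar>s n\<bar>)) ^ m"
          by (intro power_mono) auto
        then have "\<bar>c n\<bar> * (1 + norm (s n *\<^sub>R d)) ^ m \<le> \<bar>c n\<bar> * ((1 + norm d) * (1 + \<bar>s n\<bar>)) ^ m"
          by (intro mult_left_mono) auto
        then show "norm (\<bar>c n\<bar> * (1 + norm (s n *\<^sub>R d)) ^ m) \<le> (1 + norm d) ^ m * (\<bar>c n\<bar> * (1 + \<bar>s n\<bar>) ^ m)"
          by (simp add: power_mult_distrib mult_ac abs_mult)
      qed
    qed
    define L where "L = (\<integral>x. \<psi> x * H x \<partial>lebesgue)"
    have "\<forall>\<^sub>F t in at_right 0. dist (\<integral>x. \<psi> x * A x t \<partial>lborel) L < 1"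
      using bv[OF \<psi>] unfolding L_def by (rule tendstoD) simp
    then obtain b where b: "0 < b" "\<And>t. 0 < t \<Longrightarrow> t < b \<Longrightarrow> dist (\<integral>x. \<psi> x * A x t \<partial>lborel) L < 1"
      unfolding eventually_at_right_field by blast
    obtain M where M: "\<And>s t. b \<le> t \<Longrightarrow> cmod (smear \<psi> (Complex s t)) \<le> M * (1 + \<bar>s\<bar>) ^ R"
      using smear_growth[OF \<psi> b(1)] by blast
    show "\<exists>B. \<forall>t. 0 < t \<longrightarrow> t \<le> 1 \<longrightarrow> cmod (\<Sum>n. c n *\<^sub>R smear \<phi> (Complex (s n) t)) \<le> B"
    proof (intro exI allI impI)
      fix t :: real assume t: "0 < t" "t \<le> 1"
      have eq: "(\<Sum>n. c n *\<^sub>R smear \<phi> (Complex (s n) t)) = (\<integral>x. \<psi> x * A x t \<partial>lborel)"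
        unfolding \<psi>_def by (rule smear_series[OF \<phi> t(1) rapid, symmetric])
      show "cmod (\<Sum>n. c n *\<^sub>R smear \<phi> (Complex (s n) t)) \<le> max (cmod L + 1) M"
      proof (cases "t < b")
        case True
        then show ?thesis
          using b(2)[OF t(1)] norm_triangle_sub[of "\<integral>x. \<psi> x * A x t \<partial>lborel" L]
          unfolding eq by (simp add: dist_norm)
      next
        case False
        then show ?thesis using M[of t 0] unfolding eq by (simp add: smear_def)
      qed
    qed
  qed
  then obtain N K where NK: "\<And>s t. 0 < t \<Longrightarrow> t \<le> 1 \<Longrightarrow> cmod (smear \<phi> (Complex s t)) \<le> K * (1 + \<bar>s\<bar>) ^ N"
    by blast
  obtain M where M: "0 \<le> M" "\<And>s t. 1 \<le> t \<Longrightarrow> cmod (smear \<phi> (Complex s t)) \<le> M * (1 + \<bar>s\<bar>) ^ R"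
    using smear_growth[OF \<phi>, of 1] by auto
  have K: "0 \<le> K" using order_trans[OF norm_ge_zero NK[of 1 0]] by simp
  have "cmod (smear \<phi> w) \<le> (K + M) * (1 + cmod w) ^ (N + R)" if w: "0 < Im w" for w
  proof -
    define s where "s = Re w"
    have ws: "w = Complex s (Im w)" by (simp add: s_def)
    have "\<bar>s\<bar> \<le> cmod w" by (simp add: s_def abs_Re_le_cmod)
    have p: "(1 + \<bar>s\<bar>) ^ m \<le> (1 + cmod w) ^ (N + R)" if "m \<le> N + R" for m
    proof -
      have "(1 + \<bar>s\<bar>) ^ m \<le> (1 + cmod w) ^ m" using \<open>\<bar>s\<bar> \<le> cmod w\<close> by (intro power_mono) auto
      also have "\<dots> \<le> (1 + cmod w) ^ (N + R)" using that by (intro power_increasing) auto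
      finally show ?thesis .
    qed
    have "cmod (smear \<phi> w) \<le> K * (1 + \<bar>s\<bar>) ^ N + M * (1 + \<bar>s\<bar>) ^ R"
    proof (cases "Im w \<le> 1")
      case True
      then show ?thesis using NK[OF w True, of s] M(1) ws by (simp add: add_increasing2)
    next
      case False
      then show ?thesis using M(2)[of "Im w" s] K ws by (simp add: add_increasing)
    qed
    also have "\<dots> \<le> K * (1 + cmod w) ^ (N + R) + M * (1 + cmod w) ^ (N + R)"
      using K M(1) by (intro add_mono mult_left_mono p) auto
    finally show ?thesis by (simp add: algebra_simps)
  qed
  then show ?thesis by blast
qed

text \<open>
  Differentiation under the integral sign. Cauchy's inequality turns the growth bound on a disc around
  \<open>w\<close> into a bound for the derivative, hence for the difference quotients, with the same polynomial
  weight in \<open>x\<close>; this dominates them.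
\<close>

lemma smear_holomorphic:
  assumes \<phi>: "\<phi> \<in> schwartz_space"
  shows "smear \<phi> holomorphic_on {w. 0 < Im w}"
proof -
  have "smear \<phi> field_differentiable (at w)" if w: "0 < Im w" for w
  proof -
    \<comment> \<open>the disc of radius \<open>2 r\<close> around \<open>w\<close> stays at height at least \<open>r\<close>\<close>
    define r where "r = Im w / 3"
    have r: "0 < r" using w by (simp add: r_def)
    define g where "g x w = A (x + Re w *\<^sub>R d) (Im w)" for x w
    have Im_r: "r \<le> Im v" if "cmod (v - w) \<le> 2 * r" for v
      using abs_Im_le_cmod[of "v - w"] that by (simp add: r_def)
    have gd: "g x field_differentiable (at v)" if "0 < Im v" for x v
      using holomorphic_on_imp_differentiable_at[OF hol[of x] open_halfspace_Im_gt[of 0]] that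
      unfolding g_def[abs_def] by simp
    obtain M where M: "0 \<le> M" "\<And>x s t. r \<le> t \<Longrightarrow>
        cmod (A (x + s *\<^sub>R d) t) \<le> M * (1 + \<bar>s\<bar>) ^ R * (1 + norm x) ^ R"
      using shift_growth[OF r] by blast
    define L where "L = M * (1 + (\<bar>Re w\<bar> + 2 * r)) ^ R"
    have L0: "0 \<le> L" using M(1) r by (simp add: L_def)
    have gL: "cmod (g x v) \<le> L * (1 + norm x) ^ R" if v: "cmod (v - w) \<le> 2 * r" for x v
    proof -
      have "\<bar>Re v\<bar> \<le> \<bar>Re w\<bar> + 2 * r" using abs_Re_le_cmod[of "v - w"] v by simp
      then have "M * (1 + \<bar>Re v\<bar>) ^ R * (1 + norm x) ^ R \<le> L * (1 + norm x) ^ R"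
        unfolding L_def using M(1) by (intro mult_right_mono mult_left_mono power_mono) auto
      then show ?thesis
        using M(2)[OF Im_r[OF v], of x "Re v"] unfolding g_def by (rule order_trans[rotated])
    qed
    have g'L: "cmod (deriv (g x) v) \<le> L / r * (1 + norm x) ^ R" if v: "cmod (v - w) \<le> r" for x v
    proof -
      have near: "cmod (u - w) \<le> 2 * r" if "cmod (v - u) \<le> r" for u
        using norm_triangle_ineq4[of "v - w" "v - u"] v that by (simp add: norm_minus_commute)
      have "norm ((deriv ^^ 1) (g x) v) \<le> fact 1 * (L * (1 + norm x) ^ R) / r ^ 1"
      proof (rule Cauchy_inequality)
        have *: "g x field_differentiable (at u)" if "cmod (v - u) \<le> r" for u
          by (rule gd) (use Im_r[OF near[OF that]] r in linarith)
        show "g x holomorphic_on ball v r"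
        proof (rule holomorphic_onI)
          fix u assume "u \<in> ball v r"
          then have "cmod (v - u) \<le> r" by (simp add: dist_norm)
          then show "g x field_differentiable (at u within ball v r)"
            by (rule field_differentiable_at_within[OF *])
        qed
        show "continuous_on (cball v r) (g x)"
        proof (rule continuous_at_imp_continuous_on, rule ballI)
          fix u assume "u \<in> cball v r"
          then have "cmod (v - u) \<le> r" by (simp add: dist_norm)
          then show "isCont (g x) u" by (rule field_differentiable_imp_continuous_at[OF *])
        qed
        show "cmod (g x u) \<le> L * (1 + norm x) ^ R" if "cmod (v - u) = r" for u
          using that by (intro gL near) simp
      qed (rule r)
      then show ?thesis by simp
    qed
    have lip: "cmod (g x (w + h) - g x w) \<le> L / r * (1 + norm x) ^ R * cmod h" if h: "cmod h \<le> r" for x h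
    proof -
      have "cmod (g x (w + h) - g x w) \<le> L / r * (1 + norm x) ^ R * cmod (w + h - w)"
      proof (rule field_differentiable_bound[of "cball w r" "g x" "deriv (g x)"])
        fix u assume "u \<in> cball w r"
        then have u: "cmod (u - w) \<le> r" by (simp add: dist_norm norm_minus_commute)
        then have "r \<le> Im u" using r by (intro Im_r) simp
        then show "(g x has_field_derivative deriv (g x) u) (at u within cball w r)"
          using r by (intro has_field_derivative_at_within[OF field_differentiable_derivI[OF gd]]) simp
        show "cmod (deriv (g x) u) \<le> L / r * (1 + norm x) ^ R" using u by (rule g'L)
      qed (use h r in \<open>simp_all add: dist_norm\<close>)
      then show ?thesis by simp
    qed
    have g0: "(\<lambda>x. \<phi> x * g x v) \<in> borel_measurable lborel" "integrable lborel (\<lambda>x. \<phi> x * g x v)" if "0 < Im v" for v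
      unfolding g_def using measurable_integrand[OF \<phi> that] integrable_integrand[OF \<phi> that] by auto
    define D where "D = (\<integral>x. \<phi> x * deriv (g x) w \<partial>lborel)"
    have "((\<lambda>h. (smear \<phi> (w + h) - smear \<phi> w) / h) \<longlongrightarrow> D) (at 0)"
      unfolding tendsto_at_iff_sequentially
    proof (intro allI impI, unfold comp_def)
      fix h :: "nat \<Rightarrow> complex" assume h0: "\<forall>i. h i \<in> UNIV - {0}" and hl: "h \<longlonglongrightarrow> 0"
      have "\<forall>\<^sub>F i in sequentially. cmod (h i) < r"
        using tendstoD[OF hl r] by simp
      then obtain N where N: "\<And>i. N \<le> i \<Longrightarrow> cmod (h i) < r" unfolding eventually_sequentially by blast
      define k where "k i = h (i + N)" for i
      have k: "cmod (k i) \<le> r" "k i \<noteq> 0" for i using N[of "i + N"] h0 by (auto simp: k_def less_imp_le)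
      have kl: "k \<longlonglongrightarrow> 0" unfolding k_def using hl by (rule LIMSEQ_ignore_initial_segment)
      have Imk: "0 < Im (w + k i)" for i
        using Im_r[of "w + k i"] k(1)[of i] r by simp
      define q where "q i x = \<phi> x * ((g x (w + k i) - g x w) / k i)" for i x
      have qm: "q i \<in> borel_measurable lborel" for i
      proof -
        have "(\<lambda>x. (\<phi> x * g x (w + k i) - \<phi> x * g x w) / k i) \<in> borel_measurable lborel"
          using g0(1)[OF Imk] g0(1)[OF w] by measurable
        then show ?thesis unfolding q_def by (simp add: algebra_simps diff_divide_distrib)
      qed
      have ql: "(\<lambda>i. q i x) \<longlonglongrightarrow> \<phi> x * deriv (g x) w" for x
      proof -
        have "(g x has_field_derivative deriv (g x) w) (at w)"
          using gd[OF w] by (simp add: field_differentiable_derivI)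
        then have "((\<lambda>h. (g x (w + h) - g x w) / h) \<longlongrightarrow> deriv (g x) w) (at 0)" by (simp add: DERIV_def)
        moreover have "filterlim k (at 0) sequentially"
          using kl k(2) by (simp add: filterlim_at)
        ultimately have "(\<lambda>i. (g x (w + k i) - g x w) / k i) \<longlonglongrightarrow> deriv (g x) w" by (rule filterlim_compose)
        then show ?thesis unfolding q_def by (intro tendsto_intros)
      qed
      have lm: "(\<lambda>x. \<phi> x * deriv (g x) w) \<in> borel_measurable lborel"
        by (rule borel_measurable_LIMSEQ_metric[OF qm ql])
      have "(\<lambda>i. \<integral>x. q i x \<partial>lborel) \<longlonglongrightarrow> D"
        unfolding D_def
      proof (rule integral_dominated_convergence[where s = q, OF lm qm])
        show "integrable lborel (\<lambda>x. L / r * ((1 + norm x) ^ R * cmod (\<phi> x)))"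
          by (intro integrable_mult_right integrable_moment \<phi>)
        show "AE x in lborel. (\<lambda>i. q i x) \<longlonglongrightarrow> \<phi> x * deriv (g x) w" using ql by simp
        show "AE x in lborel. norm (q i x) \<le> L / r * ((1 + norm x) ^ R * cmod (\<phi> x))" for i
        proof (rule AE_I2)
          fix x
          have "cmod ((g x (w + k i) - g x w) / k i) \<le> L / r * (1 + norm x) ^ R"
            using lip[OF k(1), of x i] k(2)[of i] by (simp add: norm_divide divide_le_eq)
          then show "norm (q i x) \<le> L / r * ((1 + norm x) ^ R * cmod (\<phi> x))"
            unfolding q_def by (rule integrand_le)
        qed
      qed
      moreover have "(\<integral>x. q i x \<partial>lborel) = (smear \<phi> (w + k i) - smear \<phi> w) / k i" for i
      proof -
        have "q i = (\<lambda>x. (\<phi> x * g x (w + k i) - \<phi> x * g x w) / k i)"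
          by (auto simp: q_def fun_eq_iff right_diff_distrib)
        moreover have "smear \<phi> v = (\<integral>x. \<phi> x * g x v \<partial>lborel)" for v by (simp add: smear_def g_def)
        ultimately show ?thesis using g0(2)[OF Imk] g0(2)[OF w] by simp
      qed
      ultimately have "(\<lambda>i. (smear \<phi> (w + k i) - smear \<phi> w) / k i) \<longlonglongrightarrow> D" by simp
      then show "(\<lambda>i. (smear \<phi> (w + h i) - smear \<phi> w) / h i) \<longlonglongrightarrow> D"
        unfolding k_def by (rule LIMSEQ_offset)
    qed
    then have "(smear \<phi> has_field_derivative D) (at w)" by (simp add: DERIV_def)
    then show ?thesis by (auto simp: field_differentiable_def)
  qed
  then show ?thesis by (auto intro: holomorphic_onI field_differentiable_at_within)
qed

lemma pairing_le_boundary_mean: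
  assumes \<phi>: "\<phi> \<in> schwartz_space"
  shows "ennreal (cmod (\<integral>x. \<phi> x * A x 1 \<partial>lborel))
    \<le> (\<integral>\<^sup>+\<theta>. ennreal (cmod (\<integral>x. \<phi> (x + cot (pi * \<theta>) *\<^sub>R d) * H x \<partial>lebesgue)) * indicator {0<..<1} \<theta> \<partial>lborel)"
proof -
  obtain N K where NK: "\<And>w. 0 < Im w \<Longrightarrow> cmod (smear \<phi> w) \<le> K * (1 + cmod w) ^ N"
    using smear_polynomial_bound[OF \<phi>] by blast
  show ?thesis
    using halfplane_boundary_mean_bound[OF smear_holomorphic[OF \<phi>] NK smear_boundary[OF \<phi>]]
    by (simp add: smear_def)
qed

end

section \<open>Jensen's inequality and Gaussian kernels\<close>

text \<open>The graph of \<open>x \<mapsto> x powr p\<close> lies above its tangent at \<open>y\<close>.\<close>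

lemma powr_tangent:
  fixes x y p :: real
  assumes "1 < p" "0 \<le> x" "0 \<le> y"
  shows "p * y powr (p - 1) * x \<le> x powr p + (p - 1) * y powr p"
proof -
  have "x * y powr (p - 1) \<le> x powr p / p + (y powr (p - 1)) powr (p / (p - 1)) / (p / (p - 1))"
    using assms by (intro Youngs_inequality) (auto simp: field_simps)
  also have "(y powr (p - 1)) powr (p / (p - 1)) = y powr p" using assms by (simp add: powr_powr)
  finally have "p * (x * y powr (p - 1)) \<le> p * (x powr p / p + y powr p / (p / (p - 1)))"
    using assms by (intro mult_left_mono) auto
  also have "p * (x powr p / p + y powr p / (p / (p - 1))) = x powr p + (p - 1) * y powr p"
    using assms by (simp add: distrib_left)
  finally show ?thesis by (simp add: mult_ac)
qed

text \<open>
  Jensen's inequality for a weight of mass one, obtained by integrating the tangent inequality at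
  \<open>y\<close>. Using the finite number \<open>y\<close> as the point of tangency leaves the mean of \<open>X\<close> free to be infinite.
\<close>

lemma powr_le_weighted_mean:
  fixes X :: "'a \<Rightarrow> real"
  assumes p: "1 < p" and y: "0 \<le> y" and X: "\<And>x. 0 \<le> X x"
    and [measurable]: "X \<in> borel_measurable M" "w \<in> borel_measurable M"
    and w: "(\<integral>\<^sup>+x. w x \<partial>M) = 1"
    and le: "ennreal y \<le> (\<integral>\<^sup>+x. ennreal (X x) * w x \<partial>M)"
  shows "ennreal (y powr p) \<le> (\<integral>\<^sup>+x. ennreal (X x powr p) * w x \<partial>M)"
proof -
  define c where "c = p * y powr (p - 1)"
  have c: "0 \<le> c" using p by (simp add: c_def)
  have cy: "c * y = p * y powr p"
    using y powr_mult_base[OF y, of "p - 1"] by (simp add: c_def mult_ac)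
  have "ennreal (p * y powr p) = ennreal c * ennreal y" using c y by (simp add: cy flip: ennreal_mult)
  also have "\<dots> \<le> ennreal c * (\<integral>\<^sup>+x. ennreal (X x) * w x \<partial>M)" by (intro mult_left_mono le) simp
  also have "\<dots> = (\<integral>\<^sup>+x. ennreal c * (ennreal (X x) * w x) \<partial>M)" by (rule nn_integral_cmult[symmetric]) measurable
  also have "\<dots> \<le> (\<integral>\<^sup>+x. ennreal (X x powr p) * w x + ennreal ((p - 1) * y powr p) * w x \<partial>M)"
  proof (rule nn_integral_mono)
    fix x
    have "ennreal c * (ennreal (X x) * w x) = ennreal (c * X x) * w x"
      using c X by (simp add: ennreal_mult mult_ac)
    also have "\<dots> \<le> ennreal (X x powr p + (p - 1) * y powr p) * w x"
      unfolding c_def by (intro mult_right_mono ennreal_leI powr_tangent p X y) simp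
    also have "\<dots> = ennreal (X x powr p) * w x + ennreal ((p - 1) * y powr p) * w x"
      using p by (simp add: distrib_right)
    finally show "ennreal c * (ennreal (X x) * w x) \<le> \<dots>" .
  qed
  also have "\<dots> = (\<integral>\<^sup>+x. ennreal (X x powr p) * w x \<partial>M) + ennreal ((p - 1) * y powr p)"
    by (subst nn_integral_add) (simp_all add: nn_integral_cmult w)
  finally have "ennreal (p * y powr p) \<le> (\<integral>\<^sup>+x. ennreal (X x powr p) * w x \<partial>M) + ennreal ((p - 1) * y powr p)" .
  moreover have "ennreal (p * y powr p) = ennreal (y powr p) + ennreal ((p - 1) * y powr p)"
  proof -
    have "p * y powr p = y powr p + (p - 1) * y powr p" by (simp add: algebra_simps)
    then show ?thesis using p by (metis diff_ge_0_iff_ge ennreal_plus less_imp_le mult_nonneg_nonneg powr_ge_zero)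
  qed
  ultimately show ?thesis by (simp add: ennreal_add_left_cancel_le add.commute)
qed

lemma nn_integral_lborel_rescale:
  fixes f :: "'a::euclidean_space \<Rightarrow> ennreal"
  assumes [measurable]: "f \<in> borel_measurable borel" and "0 < \<delta>"
  shows "(\<integral>\<^sup>+x. f x \<partial>lborel) = (\<integral>\<^sup>+u. ennreal (\<delta> ^ DIM('a)) * f (a + \<delta> *\<^sub>R u) \<partial>lborel)"
  using assms(2)
  by (subst lborel_affine[of \<delta> a]) (auto simp: nn_integral_density nn_integral_distr)

lemma integral_lborel_rescale:
  fixes f :: "'a::euclidean_space \<Rightarrow> complex"
  assumes [measurable]: "f \<in> borel_measurable borel" and "0 < \<delta>"
  shows "(\<integral>x. f x \<partial>lborel) = (\<integral>u. (\<delta> ^ DIM('a)) *\<^sub>R f (a + \<delta> *\<^sub>R u) \<partial>lborel)"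
  using assms(2)
  by (subst lborel_affine[of \<delta> a]) (auto simp: integral_density integral_distr)

text \<open>The value is \<open>pi powr (DIM('a) / 2)\<close>; leaving it as an integral makes the normalisation immediate.\<close>

definition gaussian_mass :: "'a::euclidean_space itself \<Rightarrow> real" where
  "gaussian_mass _ = enn2real (\<integral>\<^sup>+u. ennreal (exp (- (norm (u :: 'a))\<^sup>2)) \<partial>lborel)"

definition gaussian_kernel :: "real \<Rightarrow> 'a::euclidean_space \<Rightarrow> real" where
  "gaussian_kernel \<delta> u = exp (- (norm u / \<delta>)\<^sup>2) / (gaussian_mass TYPE('a) * \<delta> ^ DIM('a))"

lemma gaussian_mass_eq:
  shows "ennreal (gaussian_mass TYPE(real ^ 'n)) = (\<integral>\<^sup>+u. ennreal (exp (- (norm (u :: real ^ 'n))\<^sup>2)) \<partial>lborel)"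
    and "0 < gaussian_mass TYPE(real ^ 'n)"
proof -
  let ?I = "\<integral>\<^sup>+u. ennreal (exp (- (norm (u :: real ^ 'n))\<^sup>2)) \<partial>lborel"
  have "(\<lambda>x :: real ^ 'n. complex_of_real (1 * exp (- 1 * (norm x)\<^sup>2))) \<in> schwartz_space"
    by (intro schwartz_polynomial_gaussian real_polynomial_function.intros) simp
  from schwartz_moment_finite[OF this, of 0] have fin: "?I < \<infinity>" by simp
  then show eq: "ennreal (gaussian_mass TYPE(real ^ 'n)) = ?I" by (simp add: gaussian_mass_def)
  have "?I \<noteq> 0"
  proof
    assume "?I = 0"
    then have "AE u in (lborel :: (real ^ 'n) measure). ennreal (exp (- (norm u)\<^sup>2)) = 0"
      by (subst (asm) nn_integral_0_iff_AE) simp_all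
    then have "AE u in (lborel :: (real ^ 'n) measure). False" by (simp add: not_le)
    then have "ae_filter (lborel :: (real ^ 'n) measure) = bot" by (simp add: trivial_limit_def)
    then show False by (simp add: ae_filter_eq_bot_iff)
  qed
  then show "0 < gaussian_mass TYPE(real ^ 'n)"
    using eq by (metis ennreal_eq_0_iff not_le)
qed

lemma gaussian_kernel_nonneg: "0 < \<delta> \<Longrightarrow> 0 \<le> gaussian_kernel \<delta> (u :: real ^ 'n)"
  using gaussian_mass_eq(2)[where 'n = 'n] by (simp add: gaussian_kernel_def)

lemma gaussian_kernel_measurable [measurable]: "gaussian_kernel \<delta> \<in> borel_measurable borel"
  unfolding gaussian_kernel_def[abs_def] by measurable

lemma gaussian_kernel_scale:
  "0 < \<delta> \<Longrightarrow> \<delta> ^ DIM(real ^ 'n) * gaussian_kernel \<delta> (\<delta> *\<^sub>R (u :: real ^ 'n)) = gaussian_kernel 1 u"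
  by (simp add: gaussian_kernel_def field_simps)

lemma gaussian_kernel_schwartz:
  assumes "0 < \<delta>"
  shows "(\<lambda>x :: real ^ 'n. complex_of_real (gaussian_kernel \<delta> (x - a))) \<in> schwartz_space"
proof -
  let ?c = "1 / (gaussian_mass TYPE(real ^ 'n) * \<delta> ^ DIM(real ^ 'n))"
  have "(\<lambda>x :: real ^ 'n. complex_of_real (?c * exp (- (1 / \<delta>\<^sup>2) * (norm x)\<^sup>2))) \<in> schwartz_space"
    using assms by (intro schwartz_polynomial_gaussian real_polynomial_function.intros) simp
  then have "(\<lambda>x :: real ^ 'n. complex_of_real (gaussian_kernel \<delta> x)) \<in> schwartz_space"
    by (simp add: gaussian_kernel_def power_divide del: of_real_mult of_real_divide)
  then show ?thesis by (rule schwartz_translate)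
qed

lemma gaussian_kernel_mass:
  assumes \<delta>: "0 < \<delta>"
  shows "(\<integral>\<^sup>+x. ennreal (gaussian_kernel \<delta> (x - a :: real ^ 'n)) \<partial>lborel) = 1"
proof -
  let ?m = "gaussian_mass TYPE(real ^ 'n)"
  have "(\<integral>\<^sup>+x. ennreal (gaussian_kernel \<delta> (x - a)) \<partial>lborel)
     = (\<integral>\<^sup>+u. ennreal (\<delta> ^ DIM(real ^ 'n)) * ennreal (gaussian_kernel \<delta> (a + \<delta> *\<^sub>R u - a)) \<partial>lborel)"
    by (rule nn_integral_lborel_rescale[OF _ \<delta>]) measurable
  also have "\<dots> = (\<integral>\<^sup>+u. ennreal (1 / ?m) * ennreal (exp (- (norm (u :: real ^ 'n))\<^sup>2)) \<partial>lborel)"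
    using gaussian_kernel_scale[OF \<delta>, where 'n = 'n] gaussian_mass_eq(2)[where 'n = 'n] \<delta>
    by (simp add: gaussian_kernel_nonneg[OF \<delta>] gaussian_kernel_def[of 1] flip: ennreal_mult)
  also have "\<dots> = ennreal (1 / ?m) * ennreal ?m"
    by (subst nn_integral_cmult) (simp_all add: gaussian_mass_eq(1))
  also have "\<dots> = 1" using gaussian_mass_eq(2)[where 'n = 'n] by (simp flip: ennreal_mult)
  finally show ?thesis .
qed

lemma gaussian_kernel_symmetric: "gaussian_kernel \<delta> (- u) = gaussian_kernel \<delta> u"
  by (simp add: gaussian_kernel_def)

text \<open>
  Rescaling moves the width \<open>\<delta>\<close> from the kernel into the argument of \<open>g\<close>. The integrand then converges
  pointwise and is dominated by a moment of the unit Gaussian.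
\<close>

lemma gaussian_kernel_tendsto:
  fixes g :: "real ^ 'n \<Rightarrow> complex"
  assumes g: "continuous_on UNIV g" and bound: "\<And>x. cmod (g x) \<le> M * (1 + norm x) ^ R"
    and \<delta>: "\<And>m. 0 < \<delta> m" "\<And>m. \<delta> m \<le> 1" "\<delta> \<longlonglongrightarrow> 0"
  shows "(\<lambda>m. \<integral>x. complex_of_real (gaussian_kernel (\<delta> m) (x - a)) * g x \<partial>lborel) \<longlonglongrightarrow> g a"
proof -
  have [measurable]: "g \<in> borel_measurable borel" by (rule borel_measurable_continuous_onI[OF g])
  have M0: "0 \<le> M" using order_trans[OF norm_ge_zero bound[of 0]] by simp
  define \<gamma> where "\<gamma> u = gaussian_kernel 1 (u :: real ^ 'n)" for u
  have [measurable]: "\<gamma> \<in> borel_measurable borel" unfolding \<gamma>_def[abs_def] by measurable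
  have \<gamma>0: "0 \<le> \<gamma> u" for u by (simp add: \<gamma>_def gaussian_kernel_nonneg)
  have "(\<lambda>x :: real ^ 'n. complex_of_real (gaussian_kernel 1 (x - 0))) \<in> schwartz_space"
    by (rule gaussian_kernel_schwartz) simp
  then have \<gamma>S: "(\<lambda>x. complex_of_real (\<gamma> x)) \<in> schwartz_space" by (simp add: \<gamma>_def)
  have int\<gamma>: "integrable lborel (\<lambda>u. (1 + norm u) ^ R * \<gamma> u)"
    by (rule integrableI_bounded)
       (use schwartz_moment_finite[OF \<gamma>S, of R] in \<open>simp_all add: abs_mult \<gamma>0\<close>)
  have eq: "(\<integral>x. complex_of_real (gaussian_kernel (\<delta> m) (x - a)) * g x \<partial>lborel)
      = (\<integral>u. complex_of_real (\<gamma> u) * g (a + \<delta> m *\<^sub>R u) \<partial>lborel)" for m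
  proof -
    have "(\<integral>x. complex_of_real (gaussian_kernel (\<delta> m) (x - a)) * g x \<partial>lborel)
      = (\<integral>u. (\<delta> m ^ DIM(real ^ 'n)) *\<^sub>R (complex_of_real (gaussian_kernel (\<delta> m) (a + \<delta> m *\<^sub>R u - a))
          * g (a + \<delta> m *\<^sub>R u)) \<partial>lborel)"
      by (rule integral_lborel_rescale[OF _ \<delta>(1)]) measurable
    also have "\<dots> = (\<integral>u. complex_of_real (\<gamma> u) * g (a + \<delta> m *\<^sub>R u) \<partial>lborel)"
    proof (rule Bochner_Integration.integral_cong[OF refl])
      fix u :: "real ^ 'n"
      have "complex_of_real (\<delta> m ^ DIM(real ^ 'n) * gaussian_kernel (\<delta> m) (\<delta> m *\<^sub>R u)) = complex_of_real (\<gamma> u)"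
        unfolding \<gamma>_def by (simp only: gaussian_kernel_scale[OF \<delta>(1)])
      then show "(\<delta> m ^ DIM(real ^ 'n)) *\<^sub>R (complex_of_real (gaussian_kernel (\<delta> m) (a + \<delta> m *\<^sub>R u - a))
          * g (a + \<delta> m *\<^sub>R u)) = complex_of_real (\<gamma> u) * g (a + \<delta> m *\<^sub>R u)"
        by (simp add: scaleR_conv_of_real mult.assoc[symmetric])
    qed
    finally show ?thesis .
  qed
  have lim: "(\<lambda>m. g (a + \<delta> m *\<^sub>R u)) \<longlonglongrightarrow> g a" for u :: "real ^ 'n"
  proof -
    have "(\<lambda>m. a + \<delta> m *\<^sub>R u) \<longlonglongrightarrow> a + 0 *\<^sub>R u"
      by (intro tendsto_intros \<delta>)
    then show ?thesis using continuous_on_tendsto_compose[OF g, of "\<lambda>m. a + \<delta> m *\<^sub>R u" a sequentially] by simp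
  qed
  have "(\<lambda>m. \<integral>u. complex_of_real (\<gamma> u) * g (a + \<delta> m *\<^sub>R u) \<partial>lborel) \<longlonglongrightarrow> (\<integral>u. complex_of_real (\<gamma> u) * g a \<partial>lborel)"
  proof (rule integral_dominated_convergence)
    show "integrable lborel (\<lambda>u. (M * (1 + norm a) ^ R) * ((1 + norm u) ^ R * \<gamma> u))"
      by (intro integrable_mult_right int\<gamma>)
    show "AE u in lborel. (\<lambda>m. complex_of_real (\<gamma> u) * g (a + \<delta> m *\<^sub>R u)) \<longlonglongrightarrow> complex_of_real (\<gamma> u) * g a"
      by (intro AE_I2 tendsto_intros lim)
    show "AE u in lborel. norm (complex_of_real (\<gamma> u) * g (a + \<delta> m *\<^sub>R u))
        \<le> (M * (1 + norm a) ^ R) * ((1 + norm u) ^ R * \<gamma> u)" for m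
    proof (rule AE_I2)
      fix u :: "real ^ 'n"
      have "norm (\<delta> m *\<^sub>R u) \<le> 1 * norm u"
        unfolding norm_scaleR using \<delta>(1)[of m] \<delta>(2)[of m] by (intro mult_right_mono) auto
      then have "1 + norm (a + \<delta> m *\<^sub>R u) \<le> 1 + norm a + norm u"
        using norm_triangle_ineq[of a "\<delta> m *\<^sub>R u"] by simp
      also have "\<dots> \<le> (1 + norm a) * (1 + norm u)" by (simp add: algebra_simps)
      finally have "M * (1 + norm (a + \<delta> m *\<^sub>R u)) ^ R \<le> M * ((1 + norm a) * (1 + norm u)) ^ R"
        using M0 by (intro mult_left_mono power_mono) auto
      with bound[of "a + \<delta> m *\<^sub>R u"]
      have "cmod (g (a + \<delta> m *\<^sub>R u)) \<le> M * (1 + norm a) ^ R * (1 + norm u) ^ R"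
        by (simp add: power_mult_distrib)
      then have "\<gamma> u * cmod (g (a + \<delta> m *\<^sub>R u)) \<le> \<gamma> u * (M * (1 + norm a) ^ R * (1 + norm u) ^ R)"
        using \<gamma>0 by (rule mult_left_mono)
      then show "norm (complex_of_real (\<gamma> u) * g (a + \<delta> m *\<^sub>R u))
        \<le> (M * (1 + norm a) ^ R) * ((1 + norm u) ^ R * \<gamma> u)"
        using \<gamma>0[of u] by (simp add: norm_mult mult_ac)
    qed
  qed measurable
  moreover have "(\<integral>u. complex_of_real (\<gamma> u) * g a \<partial>lborel) = g a"
  proof -
    have "(\<integral>u. \<gamma> u \<partial>lborel) = 1"
      using gaussian_kernel_mass[of 1 "0 :: real ^ 'n"] \<gamma>0
      by (subst integral_eq_nn_integral) (simp_all add: \<gamma>_def)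
    then show ?thesis by simp
  qed
  ultimately show ?thesis by (simp only: eq)
qed

section \<open>Tubes over regular cones\<close>

text \<open>An open cone containing the vertex is the whole space and hence contains lines.\<close>

lemma regular_cone_zero_notin:
  assumes "regular_cone (C :: (real ^ 'n) set)"
  shows "0 \<notin> C"
proof
  assume "0 \<in> C"
  then obtain r where r: "0 < r" "ball 0 r \<subseteq> C"
    using assms unfolding regular_cone_def open_contains_ball by blast
  have all: "x \<in> C" for x
  proof -
    define c where "c = r / (2 * (norm x + 1))"
    have n: "0 < norm x + 1" by (simp add: add_nonneg_pos)
    have c: "0 < c" using r n by (simp add: c_def)
    have "norm (c *\<^sub>R x) < r"
    proof -
      have "norm (c *\<^sub>R x) = c * norm x" using c by simp
      also have "\<dots> = r / 2 * (norm x / (norm x + 1))" by (simp add: c_def)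
      also have "\<dots> \<le> r / 2 * 1" using r n by (intro mult_left_mono) (auto simp: divide_le_eq)
      finally show ?thesis using r by simp
    qed
    then have "c *\<^sub>R x \<in> C" using r by auto
    then have "(1 / c) *\<^sub>R (c *\<^sub>R x) \<in> C"
      using assms c unfolding regular_cone_def positive_cone_def by (meson zero_less_divide_1_iff)
    then show ?thesis using c by simp
  qed
  have "axis undefined 1 \<noteq> (0 :: real ^ 'n)" by (simp add: axis_eq_0_iff)
  with all assms show False unfolding regular_cone_def by blast
qed

text \<open>
  Rays are the subcones along which the growth bound and the boundary value are used: the closure of a
  ray adds only the vertex, which is not on the unit sphere.
\<close>

lemma ray_compact_subcone:
  assumes C: "regular_cone (C :: (real ^ 'n) set)" and d: "d \<in> C"
  shows "compact_subcone {t *\<^sub>R d | t. 0 < t} C"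
proof -
  have d0: "d \<noteq> 0" using regular_cone_zero_notin[OF C] d by blast
  have pc: "c *\<^sub>R y \<in> C" if "y \<in> C" "0 < c" for c y
    using C that unfolding regular_cone_def positive_cone_def by blast
  have "closed ((\<lambda>t. t *\<^sub>R d) ` {0..})"
  proof (rule closed_injective_linear_image[OF closed_atLeast])
    show "linear (\<lambda>t. t *\<^sub>R d)" by (simp add: linear_scaleR_left)
    show "inj (\<lambda>t. t *\<^sub>R d)" using d0 by (auto intro: injI)
  qed
  then have cl: "closure {t *\<^sub>R d | t. 0 < t} \<subseteq> (\<lambda>t. t *\<^sub>R d) ` {0..}"
    by (rule closure_minimal[rotated]) auto
  show ?thesis
    unfolding compact_subcone_def
  proof (intro conjI)
    show "positive_cone {t *\<^sub>R d | t. 0 < t}"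
      unfolding positive_cone_def
    proof (intro ballI allI impI)
      fix y and c :: real assume "y \<in> {t *\<^sub>R d | t. 0 < t}" "0 < c"
      then obtain t where "0 < t" "y = t *\<^sub>R d" by blast
      with \<open>0 < c\<close> show "c *\<^sub>R y \<in> {t *\<^sub>R d | t. 0 < t}"
        by (intro CollectI exI[of _ "c * t"]) simp
    qed
    show "{t *\<^sub>R d | t. 0 < t} \<subseteq> C" using pc[OF d] by blast
    show "cone_projection (closure {t *\<^sub>R d | t. 0 < t}) \<subseteq> cone_projection C"
    proof
      fix y assume "y \<in> cone_projection (closure {t *\<^sub>R d | t. 0 < t})"
      then have y: "y \<in> closure {t *\<^sub>R d | t. 0 < t}" "norm y = 1" by (auto simp: cone_projection_def)
      then obtain t where t: "0 \<le> t" "y = t *\<^sub>R d" using cl by auto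
      with y(2) have "t \<noteq> 0" by auto
      with t pc[OF d] y(2) show "y \<in> cone_projection C" by (simp add: cone_projection_def)
    qed
  qed
qed

lemma continuous_on_cvec: "continuous_on UNIV (\<lambda>x. cvec x y)"
  unfolding cvec_def Complex_eq by (intro continuous_intros)

lemma cvec_line:
  "cvec (x + Re w *\<^sub>R d) (Im w *\<^sub>R d) = cvec x 0 + w *s cvec d 0"
  by (simp add: cvec_def vec_eq_iff complex_eq_iff)

lemma vector_analytic_on_line:
  fixes f :: "complex ^ 'n \<Rightarrow> 'h::complex_hilbert"
  assumes f: "vector_analytic_on f S" and S: "\<And>w. w \<in> U \<Longrightarrow> a + w *s b \<in> S"
  shows "(\<lambda>w. cinner (f (a + w *s b)) e) holomorphic_on U"
proof (rule holomorphic_onI)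
  fix w assume "w \<in> U"
  then obtain D where D: "(f has_derivative D) (at (a + w *s b))" and Ds: "\<And>c v. D (c *s v) = c *\<^sub>C D v"
    using f S unfolding vector_analytic_on_def by blast
  have bl: "bounded_linear (\<lambda>w. w *s b)"
    unfolding linear_conv_bounded_linear[symmetric]
    by (rule linearI) (auto simp: vec_eq_iff algebra_simps)
  have "((\<lambda>w. a + w *s b) has_derivative (\<lambda>h. h *s b)) (at w)"
    using has_derivative_add[OF has_derivative_const bounded_linear_imp_has_derivative[OF bl]] by simp
  then have "((\<lambda>w. f (a + w *s b)) has_derivative (\<lambda>h. D (h *s b))) (at w)"
    using has_derivative_compose[of "\<lambda>w. a + w *s b" "\<lambda>h. h *s b" w UNIV f D] D by simp
  then have "((\<lambda>w. cinner (f (a + w *s b)) e) has_derivative (\<lambda>h. cinner (D (h *s b)) e)) (at w)"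
    by (rule bounded_linear.has_derivative[OF bounded_linear_cinner_left])
  moreover have "(\<lambda>h. cinner (D (h *s b)) e) = (*) (cinner (D b) e)"
    by (simp add: fun_eq_iff Ds cinner_scaleC_left mult.commute)
  ultimately show "(\<lambda>w. cinner (f (a + w *s b)) e) field_differentiable (at w within U)"
    unfolding field_differentiable_def has_field_derivative_def
    by (metis has_derivative_at_withinI)
qed

lemma vector_analytic_on_continuous:
  assumes "vector_analytic_on f (tube C)" "y \<in> C"
  shows "continuous_on UNIV (\<lambda>x. f (cvec x y))"
  unfolding continuous_on_eq_continuous_at[OF open_UNIV]
proof
  fix x
  have "cvec x y \<in> tube C" using assms(2) by (auto simp: tube_def)
  then have "isCont f (cvec x y)"
    using assms(1) has_derivative_continuous unfolding vector_analytic_on_def by blast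
  moreover have "isCont (\<lambda>x. cvec x y) x"
    using continuous_on_cvec[of y] by (simp add: continuous_on_eq_continuous_at)
  ultimately show "isCont (\<lambda>x. f (cvec x y)) x" by (rule isCont_o2[rotated])
qed

lemma cinner_distribution_pairing:
  fixes g :: "real ^ 'n \<Rightarrow> 'h::complex_hilbert"
  assumes \<phi>: "\<phi> \<in> schwartz_space" and g: "strongly_measurable lebesgue g"
    and fin: "(\<integral>\<^sup>+x. ennreal (norm (\<phi> x *\<^sub>C g x)) \<partial>lebesgue) < \<infinity>"
  shows "cinner (distribution_pairing g \<phi>) e = (\<integral>x. \<phi> x * cinner (g x) e \<partial>lebesgue)"
  unfolding distribution_pairing_def
  using cinner_strong_bochner_integral[OF strongly_measurable_scaleC[OF schwartz_continuous[OF \<phi>] g] fin]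
  by (simp add: cinner_scaleC_left)

text \<open>For a finite exponent \<open>r\<close> this rests on \<open>u \<le> 1 + u powr r\<close> and on the boundedness of \<open>\<phi>\<close>.\<close>

lemma vector_Lp_pairing_finite:
  assumes p: "2 \<le> p" and h: "h \<in> vector_Lp p" and \<phi>: "\<phi> \<in> schwartz_space"
  shows "(\<integral>\<^sup>+x. ennreal (norm (\<phi> x *\<^sub>C h x)) \<partial>lebesgue) < \<infinity>"
proof -
  have I: "(\<integral>\<^sup>+x. ennreal (cmod (\<phi> x)) \<partial>lebesgue) < \<infinity>"
    using schwartz_moment_finite[OF \<phi>, of 0] by (simp add: nn_integral_completion)
  have [measurable]: "\<phi> \<in> borel_measurable lebesgue"
    using borel_measurable_continuous_onI[OF schwartz_continuous[OF \<phi>]] by (simp add: measurable_completion)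
  have hm: "strongly_measurable lebesgue h" using h by (simp add: vector_Lp_def)
  have [measurable]: "(\<lambda>x. norm (h x)) \<in> borel_measurable lebesgue"
    by (intro strongly_measurable_compose_borel[OF hm] continuous_intros)
  show ?thesis
  proof (cases "p = \<infinity>")
    case True
    then obtain B where B: "AE x in lebesgue. norm (h x) \<le> B" using h by (auto simp: vector_Lp_def)
    have "(\<integral>\<^sup>+x. ennreal (norm (\<phi> x *\<^sub>C h x)) \<partial>lebesgue)
        \<le> (\<integral>\<^sup>+x. ennreal (max B 0) * ennreal (cmod (\<phi> x)) \<partial>lebesgue)"
      using B
    proof (intro nn_integral_mono_AE, eventually_elim)
      case (elim x)
      then have "norm (h x) * cmod (\<phi> x) \<le> max B 0 * cmod (\<phi> x)" by (intro mult_right_mono) auto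
      then have "ennreal (norm (\<phi> x *\<^sub>C h x)) \<le> ennreal (max B 0 * cmod (\<phi> x))"
        unfolding norm_scaleC mult.commute[of "cmod (\<phi> x)"] by (rule ennreal_leI)
      then show ?case by (simp add: ennreal_mult)
    qed
    also have "\<dots> = ennreal (max B 0) * (\<integral>\<^sup>+x. ennreal (cmod (\<phi> x)) \<partial>lebesgue)"
      by (rule nn_integral_cmult) measurable
    also have "\<dots> < \<infinity>" using I by (simp add: ennreal_mult_less_top)
    finally show ?thesis .
  next
    case False
    then obtain r where r: "p = ereal r" "2 \<le> r" using p by (cases p) auto
    have fin: "(\<integral>\<^sup>+x. ennreal (norm (h x) powr r) \<partial>lebesgue) < \<infinity>"
      using h r by (simp add: vector_Lp_def)
    obtain B where B: "0 \<le> B" "\<And>x. cmod (\<phi> x) \<le> B"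
      using schwartz_bound[OF \<phi>, of 0 "[]"] by auto
    have "(\<integral>\<^sup>+x. ennreal (norm (\<phi> x *\<^sub>C h x)) \<partial>lebesgue)
        \<le> (\<integral>\<^sup>+x. ennreal (cmod (\<phi> x)) + ennreal B * ennreal (norm (h x) powr r) \<partial>lebesgue)"
    proof (rule nn_integral_mono)
      fix x
      have "norm (h x) \<le> 1 + norm (h x) powr r"
      proof (cases "norm (h x) \<le> 1")
        case False
        then have "norm (h x) powr 1 \<le> norm (h x) powr r" using r by (intro powr_mono) auto
        then show ?thesis using False by simp
      qed (simp add: add_increasing2)
      then have "cmod (\<phi> x) * norm (h x) \<le> cmod (\<phi> x) * (1 + norm (h x) powr r)"
        by (rule mult_left_mono) simp
      also have "\<dots> = cmod (\<phi> x) + cmod (\<phi> x) * norm (h x) powr r" by (simp add: distrib_left)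
      also have "\<dots> \<le> cmod (\<phi> x) + B * norm (h x) powr r"
        by (intro add_left_mono mult_right_mono B) simp
      finally show "ennreal (norm (\<phi> x *\<^sub>C h x)) \<le> ennreal (cmod (\<phi> x)) + ennreal B * ennreal (norm (h x) powr r)"
        using B(1) by (simp add: norm_scaleC ennreal_leI flip: ennreal_mult ennreal_plus)
    qed
    also have "\<dots> = (\<integral>\<^sup>+x. ennreal (cmod (\<phi> x)) \<partial>lebesgue)
        + ennreal B * (\<integral>\<^sup>+x. ennreal (norm (h x) powr r) \<partial>lebesgue)"
      by (subst nn_integral_add) (simp_all add: nn_integral_cmult)
    also have "\<dots> < \<infinity>" using I fin by (simp add: ennreal_mult_less_top)
    finally show ?thesis .
  qed
qed

lemma ray_growth:
  fixes f :: "complex ^ 'n \<Rightarrow> 'h::complex_hilbert"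
  assumes C: "regular_cone C" and d: "d \<in> C" and k: "1 < k"
    and bound: "\<And>C' r. compact_subcone C' C \<Longrightarrow> r > 0 \<Longrightarrow>
           \<exists>M::real. \<forall>x. \<forall>y \<in> C' - (C' \<inter> cball 0 r).
             norm (f (cvec x y)) \<le> M * (1 + norm x) ^ R * norm y powi (- k)"
    and \<tau>: "0 < \<tau>"
  shows "\<exists>M\<ge>0. \<forall>x t. \<tau> \<le> t \<longrightarrow> norm (f (cvec x (t *\<^sub>R d))) \<le> M * (1 + norm x) ^ R"
proof -
  have d0: "0 < norm d" using regular_cone_zero_notin[OF C] d by auto
  define r where "r = \<tau> * norm d / 2"
  have r: "0 < r" using \<tau> d0 by (simp add: r_def)
  let ?ray = "{t *\<^sub>R d | t. 0 < t}"
  obtain M where "\<forall>x. \<forall>y \<in> ?ray - (?ray \<inter> cball 0 r).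
      norm (f (cvec x y)) \<le> M * (1 + norm x) ^ R * norm y powi (- k)"
    using bound[OF ray_compact_subcone[OF C d] r] by (rule exE)
  then have M: "norm (f (cvec x y)) \<le> M * (1 + norm x) ^ R * norm y powi (- k)"
    if "y \<in> ?ray" "r < norm y" for x y
    using that by auto
  have "norm (f (cvec x (t *\<^sub>R d))) \<le> (max M 0 / r ^ nat k) * (1 + norm x) ^ R" if t: "\<tau> \<le> t" for x t
  proof -
    have ge: "r < norm (t *\<^sub>R d)"
    proof -
      have "\<tau> * norm d \<le> t * norm d" using t d0 by (intro mult_right_mono) auto
      then show ?thesis using t \<tau> d0 r by (simp add: r_def)
    qed
    have pw: "norm (t *\<^sub>R d) powi (- k) = 1 / norm (t *\<^sub>R d) ^ nat k"
      using k by (simp add: power_int_def field_simps)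
    have "norm (f (cvec x (t *\<^sub>R d))) \<le> M * (1 + norm x) ^ R * norm (t *\<^sub>R d) powi (- k)"
      using t \<tau> by (intro M ge) auto
    also have "\<dots> \<le> max M 0 * (1 + norm x) ^ R * (1 / r ^ nat k)"
      unfolding pw using ge r
      by (intro mult_mono mult_right_mono divide_left_mono power_mono mult_nonneg_nonneg mult_pos_pos zero_less_power) auto
    finally show ?thesis by simp
  qed
  then show ?thesis using r by (intro exI[of _ "max M 0 / r ^ nat k"]) auto
qed

lemma boundary_family_ray:
  fixes f :: "complex ^ 'n \<Rightarrow> 'h::complex_hilbert"
  assumes p: "2 \<le> p" and C: "regular_cone C" and f: "vector_analytic_on f (tube C)"
    and growth: "\<And>\<tau>. 0 < \<tau> \<Longrightarrow>
      \<exists>M\<ge>0. \<forall>x t. \<tau> \<le> t \<longrightarrow> norm (f (cvec x (t *\<^sub>R d))) \<le> M * (1 + norm x) ^ R"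
    and h: "h \<in> vector_Lp p" and bv: "has_boundary_value f C h" and d: "d \<in> C"
  shows "boundary_family (\<lambda>x t. cinner (f (cvec x (t *\<^sub>R d))) e) d R (\<lambda>x. cinner (h x) e)"
proof
  have tC: "t *\<^sub>R d \<in> C" if "0 < t" for t
    using C d that unfolding regular_cone_def positive_cone_def by blast
  have d0: "d \<noteq> 0" using regular_cone_zero_notin[OF C] d by blast
  have cf: "continuous_on UNIV (\<lambda>x. f (cvec x (t *\<^sub>R d)))" if "0 < t" for t
    by (rule vector_analytic_on_continuous[OF f tC[OF that]])
  show "(\<lambda>w. cinner (f (cvec (x + Re w *\<^sub>R d) (Im w *\<^sub>R d))) e) holomorphic_on {w. 0 < Im w}" for x
    unfolding cvec_line
    by (rule vector_analytic_on_line[OF f]) (auto simp: tube_def cvec_line[symmetric] intro!: tC)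
  show cont: "continuous_on UNIV (\<lambda>x. cinner (f (cvec x (t *\<^sub>R d))) e)" if "0 < t" for t
    by (rule bounded_linear.continuous_on[OF bounded_linear_cinner_left cf[OF that]])
  show "\<exists>M\<ge>0. \<forall>x t. \<tau> \<le> t \<longrightarrow> cmod (cinner (f (cvec x (t *\<^sub>R d))) e) \<le> M * (1 + norm x) ^ R"
    if \<tau>: "0 < \<tau>" for \<tau>
  proof -
    obtain M where M: "0 \<le> M" "\<And>x t. \<tau> \<le> t \<Longrightarrow> norm (f (cvec x (t *\<^sub>R d))) \<le> M * (1 + norm x) ^ R"
      using growth[OF \<tau>] by blast
    have "cmod (cinner (f (cvec x (t *\<^sub>R d))) e) \<le> (M * norm e) * (1 + norm x) ^ R" if "\<tau> \<le> t" for x t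
      using order_trans[OF norm_cinner_le mult_right_mono[OF M(2)[OF that, of x] norm_ge_zero[of e]]]
      by (simp add: mult_ac)
    then show ?thesis using M(1) by (intro exI[of _ "M * norm e"]) auto
  qed
  fix \<phi> :: "real ^ 'n \<Rightarrow> complex" assume \<phi>: "\<phi> \<in> schwartz_space"
  define P where "P y = distribution_pairing (\<lambda>x. f (cvec x y)) \<phi>" for y
  define Q where "Q = distribution_pairing h \<phi>"
  have "((\<lambda>y. norm (P y - Q)) \<longlongrightarrow> 0) (at 0 within {t *\<^sub>R d | t. 0 < t})"
    using bv \<phi> ray_compact_subcone[OF C d] unfolding has_boundary_value_def P_def Q_def by blast
  moreover have "filterlim (\<lambda>t. t *\<^sub>R d) (at 0 within {t *\<^sub>R d | t. 0 < t}) (at_right 0)"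
    unfolding filterlim_at
  proof
    have "((\<lambda>t. t *\<^sub>R d) \<longlongrightarrow> 0 *\<^sub>R d) (at_right 0)" by (intro tendsto_intros)
    then show "((\<lambda>t. t *\<^sub>R d) \<longlongrightarrow> 0) (at_right 0)" by simp
    show "\<forall>\<^sub>F t in at_right 0. t *\<^sub>R d \<in> {t *\<^sub>R d | t. 0 < t} \<and> t *\<^sub>R d \<noteq> 0"
      using eventually_at_right_less[of "0::real"] by eventually_elim (use d0 in auto)
  qed
  ultimately have "((\<lambda>t. norm (P (t *\<^sub>R d) - Q)) \<longlongrightarrow> 0) (at_right 0)"
    by (rule filterlim_compose)
  then have "((\<lambda>t. P (t *\<^sub>R d)) \<longlongrightarrow> Q) (at_right 0)"
    by (simp add: tendsto_norm_zero_iff LIM_zero_iff)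
  then have lim: "((\<lambda>t. cinner (P (t *\<^sub>R d)) e) \<longlongrightarrow> cinner Q e) (at_right 0)"
    by (rule bounded_linear.tendsto[OF bounded_linear_cinner_left])
  have Q: "cinner Q e = (\<integral>x. \<phi> x * cinner (h x) e \<partial>lebesgue)"
    unfolding Q_def using h
    by (intro cinner_distribution_pairing[OF \<phi>] vector_Lp_pairing_finite[OF p h \<phi>]) (simp add: vector_Lp_def)
  have P: "cinner (P (t *\<^sub>R d)) e = (\<integral>x. \<phi> x * cinner (f (cvec x (t *\<^sub>R d))) e \<partial>lborel)" if t: "0 < t" for t
  proof -
    obtain M where M: "0 \<le> M" "\<And>x. norm (f (cvec x (t *\<^sub>R d))) \<le> M * (1 + norm x) ^ R"
      using growth[OF t] by blast
    have "(\<integral>\<^sup>+x. ennreal (norm (\<phi> x *\<^sub>C f (cvec x (t *\<^sub>R d)))) \<partial>lebesgue)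
        = (\<integral>\<^sup>+x. ennreal (norm (\<phi> x *\<^sub>C f (cvec x (t *\<^sub>R d)))) \<partial>lborel)"
      by (rule nn_integral_completion)
    also have "\<dots> \<le> (\<integral>\<^sup>+x. ennreal M * ennreal ((1 + norm x) ^ R * cmod (\<phi> x)) \<partial>lborel)"
    proof (rule nn_integral_mono)
      fix x
      have "norm (\<phi> x *\<^sub>C f (cvec x (t *\<^sub>R d))) \<le> cmod (\<phi> x) * (M * (1 + norm x) ^ R)"
        unfolding norm_scaleC by (intro mult_left_mono M) simp
      then show "ennreal (norm (\<phi> x *\<^sub>C f (cvec x (t *\<^sub>R d)))) \<le> ennreal M * ennreal ((1 + norm x) ^ R * cmod (\<phi> x))"
        using M(1) by (simp add: ennreal_leI mult_ac flip: ennreal_mult)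
    qed
    also have "\<dots> = ennreal M * (\<integral>\<^sup>+x. ennreal ((1 + norm x) ^ R * cmod (\<phi> x)) \<partial>lborel)"
    proof (rule nn_integral_cmult)
      have [measurable]: "\<phi> \<in> borel_measurable borel"
        by (rule borel_measurable_continuous_onI[OF schwartz_continuous[OF \<phi>]])
      show "(\<lambda>x. ennreal ((1 + norm x) ^ R * cmod (\<phi> x))) \<in> borel_measurable lborel" by measurable
    qed
    also have "\<dots> < \<infinity>" using schwartz_moment_finite[OF \<phi>, of R] by (simp add: ennreal_mult_less_top)
    finally have fin: "(\<integral>\<^sup>+x. ennreal (norm (\<phi> x *\<^sub>C f (cvec x (t *\<^sub>R d)))) \<partial>lebesgue) < \<infinity>" .
    have "cinner (P (t *\<^sub>R d)) e = (\<integral>x. \<phi> x * cinner (f (cvec x (t *\<^sub>R d))) e \<partial>lebesgue)"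
      unfolding P_def
      by (rule cinner_distribution_pairing[OF \<phi> continuous_imp_strongly_measurable[OF cf[OF t]] fin])
    also have "\<dots> = (\<integral>x. \<phi> x * cinner (f (cvec x (t *\<^sub>R d))) e \<partial>lborel)"
    proof (rule integral_completion)
      have "(\<lambda>x. \<phi> x * cinner (f (cvec x (t *\<^sub>R d))) e) \<in> borel_measurable borel"
        by (intro borel_measurable_continuous_onI continuous_intros schwartz_continuous \<phi> cont t)
      then show "(\<lambda>x. \<phi> x * cinner (f (cvec x (t *\<^sub>R d))) e) \<in> borel_measurable lborel" by simp
    qed
    finally show ?thesis .
  qed
  show "((\<lambda>t. \<integral>x. \<phi> x * cinner (f (cvec x (t *\<^sub>R d))) e \<partial>lborel) \<longlongrightarrow>
      (\<integral>x. \<phi> x * cinner (h x) e \<partial>lebesgue)) (at_right 0)"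
    using lim unfolding Q
  proof (rule Lim_transform_eventually)
    show "\<forall>\<^sub>F t in at_right 0. cinner (P (t *\<^sub>R d)) e = (\<integral>x. \<phi> x * cinner (f (cvec x (t *\<^sub>R d))) e \<partial>lborel)"
      using eventually_at_right_less[of "0::real"] by eventually_elim (rule P)
  qed
qed

section \<open>Bounds for Gaussian averages\<close>

text \<open>
  For \<open>\<theta>\<close> uniform in the unit interval, \<open>- cot (\<pi>\<theta>)\<close> is distributed according to the Poisson kernel of
  the point \<open>i\<close>. The weight is the joint density of \<open>\<theta>\<close> and of a point \<open>x\<close> with Gaussian distribution of width
  \<open>\<delta>\<close> around \<open>a - cot (\<pi>\<theta>) d\<close>.
\<close>

definition boundary_weight :: "real ^ 'n \<Rightarrow> real \<Rightarrow> real ^ 'n \<Rightarrow> real \<times> (real ^ 'n) \<Rightarrow> ennreal" where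
  "boundary_weight d \<delta> a z =
    ennreal (gaussian_kernel \<delta> (snd z + cot (pi * fst z) *\<^sub>R d - a)) * indicator {0<..<1} (fst z)"

lemma cot_measurable [measurable]: "(cot :: real \<Rightarrow> real) \<in> borel_measurable borel"
  unfolding cot_def[abs_def] by measurable

lemma borel_pair_measurable:
  fixes g :: "'a::euclidean_space \<times> 'b::euclidean_space \<Rightarrow> ennreal"
  assumes "g \<in> borel_measurable (borel \<Otimes>\<^sub>M borel)"
  shows "g \<in> borel_measurable (lborel \<Otimes>\<^sub>M lborel)" "g \<in> borel_measurable borel"
  using assms by (simp_all add: lborel_prod borel_prod)

lemma boundary_weight_measurable:
  fixes d :: "real ^ 'n"
  assumes [measurable]: "X \<in> borel_measurable borel"
  shows "(\<lambda>(a, z). X (snd z) * boundary_weight d \<delta> a z) \<in> borel_measurable (lborel \<Otimes>\<^sub>M lborel)"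
proof (rule borel_pair_measurable(1))
  have "(\<lambda>(a, z). X (snd z) * boundary_weight d \<delta> a z) \<in> borel_measurable (borel \<Otimes>\<^sub>M (borel \<Otimes>\<^sub>M borel))"
    unfolding boundary_weight_def split_def by measurable
  then show "(\<lambda>(a, z). X (snd z) * boundary_weight d \<delta> a z) \<in> borel_measurable (borel \<Otimes>\<^sub>M borel)"
    by (simp only: borel_prod)
qed

lemma boundary_weight_measurable_snd:
  assumes [measurable]: "X \<in> borel_measurable borel"
  shows "(\<lambda>z. X (snd z) * boundary_weight d \<delta> a z) \<in> borel_measurable (borel \<Otimes>\<^sub>M borel)"
  unfolding boundary_weight_def by measurable

lemma boundary_weight_borel [measurable]: "boundary_weight d \<delta> a \<in> borel_measurable borel"
  using borel_pair_measurable(2)[OF boundary_weight_measurable_snd[of "\<lambda>_. 1" d \<delta> a]] by simp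

lemma nn_integral_boundary_weight:
  assumes [measurable]: "X \<in> borel_measurable borel"
  shows "(\<integral>\<^sup>+z. X (snd z) * boundary_weight d \<delta> a z \<partial>lborel)
    = (\<integral>\<^sup>+\<theta>. (\<integral>\<^sup>+x. X x * ennreal (gaussian_kernel \<delta> (x + cot (pi * \<theta>) *\<^sub>R d - a)) \<partial>lborel)
        * indicator {0<..<1} \<theta> \<partial>lborel)"
proof -
  have "(\<integral>\<^sup>+z. X (snd z) * boundary_weight d \<delta> a z \<partial>lborel)
    = (\<integral>\<^sup>+z. X (snd z) * boundary_weight d \<delta> a z \<partial>(lborel \<Otimes>\<^sub>M lborel))" by (simp add: lborel_prod)
  also have "\<dots> = (\<integral>\<^sup>+\<theta>. \<integral>\<^sup>+x. X (snd (\<theta>, x)) * boundary_weight d \<delta> a (\<theta>, x) \<partial>lborel \<partial>lborel)"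
    by (rule lborel.nn_integral_fst[symmetric, OF borel_pair_measurable(1)[OF boundary_weight_measurable_snd]]) measurable
  also have "\<dots> = (\<integral>\<^sup>+\<theta>. \<integral>\<^sup>+x. (X x * ennreal (gaussian_kernel \<delta> (x + cot (pi * \<theta>) *\<^sub>R d - a)))
      * indicator {0<..<1} \<theta> \<partial>lborel \<partial>lborel)"
    by (simp add: boundary_weight_def mult.assoc)
  also have "\<dots> = (\<integral>\<^sup>+\<theta>. (\<integral>\<^sup>+x. X x * ennreal (gaussian_kernel \<delta> (x + cot (pi * \<theta>) *\<^sub>R d - a)) \<partial>lborel)
        * indicator {0<..<1} \<theta> \<partial>lborel)"
    by (intro nn_integral_cong nn_integral_multc) measurable
  finally show ?thesis .
qed

lemma boundary_weight_mass:
  assumes "0 < \<delta>"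
  shows "(\<integral>\<^sup>+z. boundary_weight d \<delta> a z \<partial>lborel) = 1"
proof -
  have "(\<integral>\<^sup>+x. ennreal (gaussian_kernel \<delta> (x + c *\<^sub>R d - a)) \<partial>lborel) = 1" for c
    using gaussian_kernel_mass[OF assms, of "a - c *\<^sub>R d"] by (simp add: algebra_simps)
  then show ?thesis using nn_integral_boundary_weight[of "\<lambda>_. 1" d \<delta> a] by simp
qed

text \<open>As a function of the centre \<open>a\<close> the Gaussian factor has mass one too, by its symmetry.\<close>

lemma boundary_weight_mass_center:
  assumes "0 < \<delta>"
  shows "(\<integral>\<^sup>+a. boundary_weight d \<delta> a z \<partial>lborel) = indicator {0<..<1} (fst z)"
proof -
  let ?b = "snd z + cot (pi * fst z) *\<^sub>R d"
  have "gaussian_kernel \<delta> (?b - a) = gaussian_kernel \<delta> (a - ?b)" for a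
    using gaussian_kernel_symmetric[of \<delta> "?b - a"] by simp
  then have "(\<integral>\<^sup>+a. ennreal (gaussian_kernel \<delta> (?b - a)) \<partial>lborel) = 1"
    using gaussian_kernel_mass[OF assms, of ?b] by simp
  then show ?thesis
    unfolding boundary_weight_def by (subst nn_integral_multc) simp_all
qed

text \<open>
  The boundary mean of \<open>pairing_le_boundary_mean\<close> for a Gaussian test function, with the inner integral
  against \<open>h\<close> estimated in norm. The function \<open>X\<close> is a Borel version of the norm of \<open>h\<close>, as required for
  Tonelli's theorem.
\<close>

lemma smeared_value_le:
  fixes f :: "complex ^ 'n \<Rightarrow> 'h::complex_hilbert" and X :: "real ^ 'n \<Rightarrow> real"
  assumes bf: "boundary_family (\<lambda>x t. cinner (f (cvec x (t *\<^sub>R d))) e) d R (\<lambda>x. cinner (h x) e)"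
    and e: "norm e \<le> 1" and \<delta>: "0 < \<delta>"
    and X: "X \<in> borel_measurable borel" "\<And>x. 0 \<le> X x" "AE x in lborel. norm (h x) = X x"
  shows "ennreal (cmod (\<integral>x. complex_of_real (gaussian_kernel \<delta> (x - a)) * cinner (f (cvec x d)) e \<partial>lborel))
    \<le> (\<integral>\<^sup>+z. ennreal (X (snd z)) * boundary_weight d \<delta> a z \<partial>lborel)"
proof -
  interpret boundary_family "\<lambda>x t. cinner (f (cvec x (t *\<^sub>R d))) e" d R "\<lambda>x. cinner (h x) e" by (rule bf)
  note [measurable] = X(1)
  have inner: "ennreal (cmod (\<integral>x. complex_of_real (gaussian_kernel \<delta> (x + c *\<^sub>R d - a)) * cinner (h x) e \<partial>lebesgue))
    \<le> (\<integral>\<^sup>+x. ennreal (X x) * ennreal (gaussian_kernel \<delta> (x + c *\<^sub>R d - a)) \<partial>lborel)" for c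
  proof -
    let ?g = "\<lambda>x. complex_of_real (gaussian_kernel \<delta> (x + c *\<^sub>R d - a)) * cinner (h x) e"
    have "ennreal (cmod (integral\<^sup>L lebesgue ?g)) \<le> (\<integral>\<^sup>+x. ennreal (cmod (?g x)) \<partial>lebesgue)"
      by (cases "integrable lebesgue ?g") (simp_all add: integral_norm_bound_ennreal not_integrable_integral_eq)
    also have "\<dots> = (\<integral>\<^sup>+x. ennreal (cmod (?g x)) \<partial>lborel)" by (rule nn_integral_completion)
    also have "\<dots> \<le> (\<integral>\<^sup>+x. ennreal (X x) * ennreal (gaussian_kernel \<delta> (x + c *\<^sub>R d - a)) \<partial>lborel)"
      using X(3)
    proof (intro nn_integral_mono_AE, eventually_elim)
      case (elim x)
      have "cmod (cinner (h x) e) \<le> X x * 1"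
        using order_trans[OF norm_cinner_le[of "h x" e] mult_left_mono[OF e norm_ge_zero]] elim by simp
      then have "cmod (?g x) \<le> X x * gaussian_kernel \<delta> (x + c *\<^sub>R d - a)"
        using gaussian_kernel_nonneg[OF \<delta>, of "x + c *\<^sub>R d - a"]
        by (simp add: norm_mult mult.commute[of "gaussian_kernel _ _"] mult_right_mono)
      then show ?case
        using X(2)[of x] gaussian_kernel_nonneg[OF \<delta>, of "x + c *\<^sub>R d - a"] by (simp add: ennreal_leI flip: ennreal_mult)
    qed
    finally show ?thesis .
  qed
  have "ennreal (cmod (\<integral>x. complex_of_real (gaussian_kernel \<delta> (x - a)) * cinner (f (cvec x d)) e \<partial>lborel))
    \<le> (\<integral>\<^sup>+\<theta>. ennreal (cmod (\<integral>x. complex_of_real (gaussian_kernel \<delta> (x + cot (pi * \<theta>) *\<^sub>R d - a)) * cinner (h x) e \<partial>lebesgue))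
        * indicator {0<..<1} \<theta> \<partial>lborel)"
    using pairing_le_boundary_mean[OF gaussian_kernel_schwartz[OF \<delta>, of a]] by simp
  also have "\<dots> \<le> (\<integral>\<^sup>+\<theta>. (\<integral>\<^sup>+x. ennreal (X x) * ennreal (gaussian_kernel \<delta> (x + cot (pi * \<theta>) *\<^sub>R d - a)) \<partial>lborel)
        * indicator {0<..<1} \<theta> \<partial>lborel)"
    by (intro nn_integral_mono mult_right_mono inner) simp
  also have "\<dots> = (\<integral>\<^sup>+z. ennreal (X (snd z)) * boundary_weight d \<delta> a z \<partial>lborel)"
    by (rule nn_integral_boundary_weight[symmetric]) measurable
  finally show ?thesis .
qed

text \<open>
  Averaging and then integrating over all centres preserves the total integral; for
  \<open>X = \<parallel>h\<parallel> powr p\<close> this is what makes the resulting bound independent of \<open>d\<close>.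
\<close>

lemma nn_integral_boundary_weight_all:
  assumes [measurable]: "X \<in> borel_measurable borel" and \<delta>: "0 < \<delta>"
  shows "(\<integral>\<^sup>+a. \<integral>\<^sup>+z. X (snd z) * boundary_weight d \<delta> a z \<partial>lborel \<partial>lborel) = (\<integral>\<^sup>+x. X x \<partial>lborel)"
proof -
  have "(\<integral>\<^sup>+a. \<integral>\<^sup>+z. X (snd z) * boundary_weight d \<delta> a z \<partial>lborel \<partial>lborel)
    = (\<integral>\<^sup>+z. \<integral>\<^sup>+a. X (snd z) * boundary_weight d \<delta> a z \<partial>lborel \<partial>lborel)"
    by (rule lborel_pair.Fubini'[where f = "\<lambda>a z. X (snd z) * boundary_weight d \<delta> a z", OF boundary_weight_measurable, symmetric]) measurable
  also have "\<dots> = (\<integral>\<^sup>+z. X (snd z) * indicator {0<..<1 :: real} (fst z) \<partial>lborel)"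
  proof (rule nn_integral_cong)
    fix z
    have "(\<lambda>a. boundary_weight d \<delta> a z) \<in> borel_measurable lborel"
      unfolding boundary_weight_def by measurable
    then show "(\<integral>\<^sup>+a. X (snd z) * boundary_weight d \<delta> a z \<partial>lborel) = X (snd z) * indicator {0<..<1} (fst z)"
      by (subst nn_integral_cmult) (simp_all add: boundary_weight_mass_center[OF \<delta>])
  qed
  also have "\<dots> = (\<integral>\<^sup>+z. X (snd z) * indicator {0<..<1 :: real} (fst z) \<partial>(lborel \<Otimes>\<^sub>M lborel))"
    by (simp add: lborel_prod)
  also have "\<dots> = (\<integral>\<^sup>+\<theta>. \<integral>\<^sup>+x. X (snd (\<theta> :: real, x)) * indicator {0<..<1} (fst (\<theta>, x)) \<partial>lborel \<partial>lborel)"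
  proof (rule lborel.nn_integral_fst[symmetric, OF borel_pair_measurable(1)])
    show "(\<lambda>z. X (snd z) * indicator {0<..<1 :: real} (fst z)) \<in> borel_measurable (borel \<Otimes>\<^sub>M borel)"
      by measurable
  qed
  also have "\<dots> = (\<integral>\<^sup>+\<theta>. (\<integral>\<^sup>+x. X x \<partial>lborel) * indicator {0<..<1} (\<theta> :: real) \<partial>lborel)"
    by (intro nn_integral_cong) (simp add: nn_integral_multc)
  also have "\<dots> = (\<integral>\<^sup>+x. X x \<partial>lborel)" by (simp add: nn_integral_cmult)
  finally show ?thesis .
qed

theorem theorem4p4:
  fixes p :: ereal
    and C :: "(real ^ 'n) set"
    and f :: "complex ^ 'n \<Rightarrow> 'h::complex_hilbert"
    and h :: "real ^ 'n \<Rightarrow> 'h"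
    and R :: nat
    and k :: int
  assumes "2 \<le> p"
    and "regular_cone C"
    and "vector_analytic_on f (tube C)"
    and "k > 1"
    and "\<And>C' r. compact_subcone C' C \<Longrightarrow> r > 0 \<Longrightarrow>
           \<exists>M::real. \<forall>x. \<forall>y \<in> C' - (C' \<inter> cball 0 r).
             norm (f (cvec x y)) \<le> M * (1 + norm x) ^ R * norm y powi (- k)"
    and "h \<in> vector_Lp p"
    and "has_boundary_value f C h"
  shows "f \<in> hardy_space p C"
proof -
  have "strongly_measurable lebesgue h" using assms(6) by (simp add: vector_Lp_def)
  then have "(\<lambda>x. norm (h x)) \<in> borel_measurable lebesgue"
    by (rule strongly_measurable_compose_borel) (intro continuous_intros)
  then obtain X0 where X0: "X0 \<in> borel_measurable lborel" "AE x in lborel. norm (h x) = X0 x"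
    using completion_ex_borel_measurable_real by blast
  define X where "X x = \<bar>X0 x\<bar>" for x
  have Xm [measurable]: "X \<in> borel_measurable borel" using X0(1) unfolding X_def[abs_def] by simp
  have X: "\<And>x. 0 \<le> X x" "AE x in lborel. norm (h x) = X x"
  proof -
    show "AE x in lborel. norm (h x) = X x"
      using X0(2) by eventually_elim (metis X_def abs_norm_cancel)
  qed (simp add: X_def)
  define \<delta> where "\<delta> m = 1 / (real m + 1)" for m
  have \<delta>: "0 < \<delta> m" "\<delta> m \<le> 1" for m by (simp_all add: \<delta>_def)
  have \<delta>lim: "\<delta> \<longlonglongrightarrow> 0" unfolding \<delta>_def[abs_def] using LIMSEQ_inverse_real_of_nat by (simp add: inverse_eq_divide add.commute)
  have approx: "\<exists>y. (\<forall>m. 0 \<le> y m \<and> ennreal (y m) \<le> (\<integral>\<^sup>+z. ennreal (X (snd z)) * boundary_weight d (\<delta> m) a z \<partial>lborel))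
      \<and> y \<longlonglongrightarrow> norm (f (cvec a d))" if d: "d \<in> C" for a d
  proof -
    define v where "v = f (cvec a d)"
    \<comment> \<open>the unit vector that norms \<open>v\<close>; for \<open>v = 0\<close> it is \<open>0\<close> and \<open>ve\<close> below still holds\<close>
    define e where "e = (1 / norm v) *\<^sub>R v"
    have e1: "norm e \<le> 1" by (simp add: e_def)
    have ve: "cmod (cinner v e) = norm v"
    proof -
      have "cinner v e = of_real (1 / norm v) * cinner v v"
        unfolding e_def scaleC_of_real[symmetric] cinner_scaleC_right by simp
      then show ?thesis by (simp add: cinner_self norm_mult norm_divide power2_eq_square)
    qed
    have gr: "\<exists>M\<ge>0. \<forall>x t. \<tau> \<le> t \<longrightarrow> norm (f (cvec x (t *\<^sub>R d))) \<le> M * (1 + norm x) ^ R" if "0 < \<tau>" for \<tau>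
      by (rule ray_growth[OF assms(2) d assms(4) assms(5) that])
    note bf = boundary_family_ray[OF assms(1-3) gr assms(6,7) d, of e]
    obtain M where M: "0 \<le> M" "\<And>x. norm (f (cvec x d)) \<le> M * (1 + norm x) ^ R"
      using gr[of 1] by (metis order_refl scaleR_one zero_less_one)
    define y where "y m = cmod (\<integral>x. complex_of_real (gaussian_kernel (\<delta> m) (x - a)) * cinner (f (cvec x d)) e \<partial>lborel)" for m
    have "(\<lambda>m. \<integral>x. complex_of_real (gaussian_kernel (\<delta> m) (x - a)) * cinner (f (cvec x d)) e \<partial>lborel)
        \<longlonglongrightarrow> cinner (f (cvec a d)) e"
    proof (rule gaussian_kernel_tendsto[OF _ _ \<delta> \<delta>lim])
      show "continuous_on UNIV (\<lambda>x. cinner (f (cvec x d)) e)"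
        by (intro bounded_linear.continuous_on[OF bounded_linear_cinner_left]
            vector_analytic_on_continuous[OF assms(3) d])
      show "cmod (cinner (f (cvec x d)) e) \<le> M * (1 + norm x) ^ R" for x
        using order_trans[OF norm_cinner_le mult_left_mono[OF e1 norm_ge_zero]] M(2)[of x]
        by (metis mult.right_neutral order_trans)
    qed
    then have "y \<longlonglongrightarrow> norm (f (cvec a d))"
      using tendsto_norm ve unfolding y_def[abs_def] v_def by fastforce
    moreover have "ennreal (y m) \<le> (\<integral>\<^sup>+z. ennreal (X (snd z)) * boundary_weight d (\<delta> m) a z \<partial>lborel)" for m
      unfolding y_def by (rule smeared_value_le[OF bf e1 \<delta>(1) Xm X])
    ultimately show ?thesis by (intro exI[of _ y]) (auto simp: y_def)
  qed
  show ?thesis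
  proof (cases "p = \<infinity>")
    case True
    then obtain B where B: "AE x in lebesgue. norm (h x) \<le> B" using assms(6) by (auto simp: vector_Lp_def)
    have "AE x in lborel. X x \<le> max B 0"
      using B X(2) unfolding AE_completion_iff by eventually_elim auto
    then have bb: "norm (f (cvec a d)) \<le> max B 0" if d: "d \<in> C" for a d
    proof -
      obtain y where y: "\<And>m. 0 \<le> y m" "y \<longlonglongrightarrow> norm (f (cvec a d))"
        "\<And>m. ennreal (y m) \<le> (\<integral>\<^sup>+z. ennreal (X (snd z)) * boundary_weight d (\<delta> m) a z \<partial>lborel)"
        using approx[OF d] by blast
      have "y m \<le> max B 0" for m
      proof -
        have "ennreal (y m) \<le> (\<integral>\<^sup>+z. ennreal (X (snd z)) * boundary_weight d (\<delta> m) a z \<partial>lborel)" by (rule y(3))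
        also have "\<dots> = (\<integral>\<^sup>+\<theta>. (\<integral>\<^sup>+x. ennreal (X x) * ennreal (gaussian_kernel (\<delta> m) (x + cot (pi * \<theta>) *\<^sub>R d - a)) \<partial>lborel)
            * indicator {0<..<1} \<theta> \<partial>lborel)"
          by (rule nn_integral_boundary_weight) measurable
        also have "\<dots> \<le> (\<integral>\<^sup>+\<theta>. (\<integral>\<^sup>+x. ennreal (max B 0) * ennreal (gaussian_kernel (\<delta> m) (x + cot (pi * \<theta>) *\<^sub>R d - a)) \<partial>lborel)
            * indicator {0<..<1} \<theta> \<partial>lborel)"
          using \<open>AE x in lborel. X x \<le> max B 0\<close>
          by (intro nn_integral_mono mult_right_mono nn_integral_mono_AE)
             (auto elim!: eventually_mono intro!: mult_right_mono ennreal_leI)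
        also have "\<dots> = (\<integral>\<^sup>+z. ennreal (max B 0) * boundary_weight d (\<delta> m) a z \<partial>lborel)"
          by (rule nn_integral_boundary_weight[of "\<lambda>_. ennreal (max B 0)", symmetric]) measurable
        also have "\<dots> = ennreal (max B 0)"
          by (subst nn_integral_cmult) (simp_all add: boundary_weight_mass[OF \<delta>(1)])
        finally show ?thesis by (simp add: ennreal_le_iff)
      qed
      then show ?thesis using y(2) by (intro LIMSEQ_le_const2[OF y(2)]) auto
    qed
    have "\<forall>z\<in>tube C. norm (f z) \<le> max B 0" using bb by (auto simp: tube_def)
    then show ?thesis using True assms(3) by (auto simp: hardy_space_def)
  next
    case False
    then obtain r where r: "p = ereal r" "2 \<le> r" using assms(1) by (cases p) auto
    define J where "J = (\<integral>\<^sup>+x. ennreal (norm (h x) powr r) \<partial>lebesgue)"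
    have J: "J < \<infinity>" using assms(6) r by (simp add: J_def vector_Lp_def)
    have JX: "J = (\<integral>\<^sup>+x. ennreal (X x powr r) \<partial>lborel)"
      unfolding J_def nn_integral_completion using X(2) by (intro nn_integral_cong_AE) (auto elim!: eventually_mono)
    have le: "(\<integral>\<^sup>+x. ennreal (norm (f (cvec x d)) powr r) \<partial>lebesgue) \<le> J" if d: "d \<in> C" for d
    proof -
      define \<Theta> where "\<Theta> m a = (\<integral>\<^sup>+z. ennreal (X (snd z) powr r) * boundary_weight d (\<delta> m) a z \<partial>lborel)" for m a
      have \<Theta>m: "\<Theta> m \<in> borel_measurable lborel" for m
        unfolding \<Theta>_def[abs_def]
        by (rule lborel.borel_measurable_nn_integral, rule boundary_weight_measurable) measurable
      have Xsnd: "(\<lambda>z :: real \<times> (real ^ 'n). X (snd z)) \<in> borel_measurable lborel"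
        using measurable_compose[OF borel_measurable_continuous_onI[OF continuous_on_snd[OF continuous_on_id]] Xm]
        by simp
      have pt: "ennreal (norm (f (cvec a d)) powr r) \<le> liminf (\<lambda>m. \<Theta> m a)" for a
      proof -
        obtain y where y: "\<And>m. 0 \<le> y m" "y \<longlonglongrightarrow> norm (f (cvec a d))"
          "\<And>m. ennreal (y m) \<le> (\<integral>\<^sup>+z. ennreal (X (snd z)) * boundary_weight d (\<delta> m) a z \<partial>lborel)"
          using approx[OF d] by blast
        have "ennreal (y m powr r) \<le> \<Theta> m a" for m
          unfolding \<Theta>_def
          by (rule powr_le_weighted_mean[OF _ y(1) _ _ _ boundary_weight_mass[OF \<delta>(1)] y(3)])
             (use r X(1) Xsnd in auto)
        then have "liminf (\<lambda>m. ennreal (y m powr r)) \<le> liminf (\<lambda>m. \<Theta> m a)" by (intro Liminf_mono) auto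
        moreover have "(\<lambda>m. ennreal (y m powr r)) \<longlonglongrightarrow> ennreal (norm (f (cvec a d)) powr r)"
          using r y(1) by (intro tendsto_ennrealI tendsto_powr2[OF y(2) tendsto_const]) auto
        ultimately show ?thesis by (simp add: lim_imp_Liminf)
      qed
      have "(\<integral>\<^sup>+x. ennreal (norm (f (cvec x d)) powr r) \<partial>lebesgue) = (\<integral>\<^sup>+x. ennreal (norm (f (cvec x d)) powr r) \<partial>lborel)"
        by (rule nn_integral_completion)
      also have "\<dots> \<le> (\<integral>\<^sup>+a. liminf (\<lambda>m. \<Theta> m a) \<partial>lborel)" by (intro nn_integral_mono pt)
      also have "\<dots> \<le> liminf (\<lambda>m. \<integral>\<^sup>+a. \<Theta> m a \<partial>lborel)" by (rule nn_integral_liminf[OF \<Theta>m])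
      also have "\<dots> = J"
        unfolding \<Theta>_def JX by (subst nn_integral_boundary_weight_all[OF _ \<delta>(1)]) (simp_all add: Liminf_const)
      finally show ?thesis .
    qed
    have "J = ennreal (enn2real J)" using J by simp
    then have "\<exists>A::real. \<forall>y\<in>C. (\<integral>\<^sup>+x. ennreal (norm (f (cvec x y)) powr r) \<partial>lebesgue) \<le> ennreal A"
      using le by metis
    then show ?thesis using False r assms(3) by (simp add: hardy_space_def)
  qed
qed

end
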